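(* The projective closure in $\mathbb{P}^{1}$ of a $\delta$-variety in $\mathbb{A}^1$ defined by a linear ordinary differential equation in one variable (with coefficients in $\mathcal{F}$) is $\delta$-complete.
   Context: All differential fields have characteristic zero and a single derivation $\delta$ (written $x'$, $x''$, $x^{(k)}$). $\mathcal{F}$ is a fixed arbitrary differentially closed field of characteristic zero (a model of $DCF_0$), contained in a large saturated model $\mathcal{U}$ of $DCF_0$. $\mathbb{P}^n$ and $\mathbb{A}^m$ mean $\mathbb{P}^n(\mathcal{U})$ and $\mathbb{A}^m(\mathcal{U})$. A linear ordinary differential equation in one variable is an equation of the form $x^{(k)}=\sum_{i=0}^{k-1}a_i x^{(i)}+b$ with $a_i,b\in\mathcal{F}$. A $\delta$-polynomial $g(x_0,\dots,x_n)$ is $\delta$-homogeneous if there is a natural number $d$ with $g(\lambda\bar x)=\lambda^d g(\bar x)$ for all nonzero $\lambda$ in the ground $\delta$-field. $\delta$-varieties (Kolchin-closed subsets) in $\mathbb{A}^m$, resp. $\mathbb{P}^n$, are the zero loci, in $\mathcal{U}$-points, of sets of $\delta$-polynomials, resp. $\delta$-homogeneous $\delta$-polynomials, with coefficients in $\mathcal{F}$; Kolchin-closed subsets of a product with projective factors are defined by $\delta$-polynomials over $\mathcal{F}$ that are $\delta$-homogeneous in each group of projective coordinates. The projective closure of an affine $\delta$-variety $X\subseteq\mathbb{A}^1$ (embedded in $\mathbb{P}^1$ by $x\mapsto(x:1)$) is the intersection of all projective $\delta$-varieties in $\mathbb{P}^1$ containing it. A projective $\delta$-variety $V$ is $\delta$-complete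 if for every projective $\delta$-variety $W$ over $\mathcal{F}$ and every Kolchin-closed $Z\subseteq V\times W$, the image $\pi_2(Z)\subseteq W$ under the second projection is Kolchin-closed (equivalently, one may take $W=\mathbb{A}^m$, $m$ arbitrary). *)

theory Defs
  imports Complex_Main "HOL-Library.Poly_Mapping"
begin

unbundle cardinal_syntax

section \<open>Differential fields and differential polynomials\<close>

definition derivation :: "('u::field \<Rightarrow> 'u) \<Rightarrow> bool" where
  "derivation \<delta> \<longleftrightarrow>
     (\<forall>x y. \<delta> (x + y) = \<delta> x + \<delta> y) \<and> (\<forall>x y. \<delta> (x * y) = \<delta> x * y + x * \<delta> y)"

definition differential_subfield :: "('u::field \<Rightarrow> 'u) \<Rightarrow> 'u set \<Rightarrow> bool" where
  "differential_subfield \<delta> K \<longleftrightarrow>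
     0 \<in> K \<and> 1 \<in> K \<and> (\<forall>x\<in>K. \<forall>y\<in>K. x + y \<in> K \<and> x * y \<in> K) \<and>
     (\<forall>x\<in>K. - x \<in> K \<and> inverse x \<in> K \<and> \<delta> x \<in> K)"

text \<open>A differential polynomial in the differential indeterminates \<open>x\<^sub>i\<close> (\<open>i :: 'i\<close>) is a
  polynomial in the algebraic indeterminates \<open>(i, k)\<close>, which stand for the \<open>k\<close>-th derivative
  of \<open>x\<^sub>i\<close>; the inner finitely supported map is a monomial, given by its exponents.\<close>

type_synonym ('u, 'i) dpoly = "(('i \<times> nat) \<Rightarrow>\<^sub>0 nat) \<Rightarrow>\<^sub>0 'u"

definition deval :: "('u::field \<Rightarrow> 'u) \<Rightarrow> ('u, 'i) dpoly \<Rightarrow> ('i \<Rightarrow> 'u) \<Rightarrow> 'u" where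
  "deval \<delta> g x =
     (\<Sum>m\<in>Poly_Mapping.keys g. Poly_Mapping.lookup g m *
        (\<Prod>(i, k)\<in>Poly_Mapping.keys m. ((\<delta> ^^ k) (x i)) ^ Poly_Mapping.lookup m (i, k)))"

definition dvars :: "('u::zero, 'i) dpoly \<Rightarrow> ('i \<times> nat) set" where
  "dvars g = (\<Union>m\<in>Poly_Mapping.keys g. Poly_Mapping.keys m)"

definition dpolys :: "'u::zero set \<Rightarrow> 'i set \<Rightarrow> ('u, 'i) dpoly set" where
  "dpolys K I = {g. (\<forall>m. Poly_Mapping.lookup g m \<in> K) \<and> dvars g \<subseteq> I \<times> UNIV}"

section \<open>Models of \<open>DCF\<^sub>0\<close> and saturation\<close>

text \<open>The order of a differential polynomial in one indeterminate; it is \<open>-1\<close> for elements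
  of the ground field.\<close>

definition dorder :: "('u::zero, unit) dpoly \<Rightarrow> int" where
  "dorder g = (if dvars g = {} then - 1 else int (Max (snd ` dvars g)))"

text \<open>Blum's axioms. The case \<open>dorder f = 0\<close>, \<open>dorder g = - 1\<close> says that \<open>K\<close> is
  algebraically closed.\<close>

definition differentially_closed :: "('u::field_char_0 \<Rightarrow> 'u) \<Rightarrow> 'u set \<Rightarrow> bool" where
  "differentially_closed \<delta> K \<longleftrightarrow> differential_subfield \<delta> K \<and>
     (\<forall>f\<in>dpolys K UNIV. \<forall>g\<in>dpolys K UNIV. g \<noteq> 0 \<and> dorder g < dorder f \<longrightarrow>
        (\<exists>a\<in>K. deval \<delta> f (\<lambda>_. a) = 0 \<and> deval \<delta> g (\<lambda>_. a) \<noteq> 0))"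

text \<open>First-order formulas in the language \<open>{0, 1, +, -, \<cdot>, \<delta>}\<close> of differential rings,
  with parameters.\<close>

datatype (tm_params: 'u) tm =
    TVar nat | TParam 'u | TZero | TOne
  | TAdd "'u tm" "'u tm" | TNeg "'u tm" | TMult "'u tm" "'u tm" | TDeriv "'u tm"

datatype (fm_params: 'u) fm =
    FEq "'u tm" "'u tm" | FNot "'u fm" | FAnd "'u fm" "'u fm" | FEx nat "'u fm"

primrec tm_vars :: "'u tm \<Rightarrow> nat set" where
  "tm_vars (TVar n) = {n}"
| "tm_vars (TParam a) = {}"
| "tm_vars TZero = {}"
| "tm_vars TOne = {}"
| "tm_vars (TAdd s t) = tm_vars s \<union> tm_vars t"
| "tm_vars (TNeg t) = tm_vars t"
| "tm_vars (TMult s t) = tm_vars s \<union> tm_vars t"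
| "tm_vars (TDeriv t) = tm_vars t"

primrec fm_free :: "'u fm \<Rightarrow> nat set" where
  "fm_free (FEq s t) = tm_vars s \<union> tm_vars t"
| "fm_free (FNot \<phi>) = fm_free \<phi>"
| "fm_free (FAnd \<phi> \<psi>) = fm_free \<phi> \<union> fm_free \<psi>"
| "fm_free (FEx n \<phi>) = fm_free \<phi> - {n}"

primrec tm_val :: "('u::field \<Rightarrow> 'u) \<Rightarrow> (nat \<Rightarrow> 'u) \<Rightarrow> 'u tm \<Rightarrow> 'u" where
  "tm_val \<delta> e (TVar n) = e n"
| "tm_val \<delta> e (TParam a) = a"
| "tm_val \<delta> e TZero = 0"
| "tm_val \<delta> e TOne = 1"
| "tm_val \<delta> e (TAdd s t) = tm_val \<delta> e s + tm_val \<delta> e t"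
| "tm_val \<delta> e (TNeg t) = - tm_val \<delta> e t"
| "tm_val \<delta> e (TMult s t) = tm_val \<delta> e s * tm_val \<delta> e t"
| "tm_val \<delta> e (TDeriv t) = \<delta> (tm_val \<delta> e t)"

primrec fm_sat :: "('u::field \<Rightarrow> 'u) \<Rightarrow> (nat \<Rightarrow> 'u) \<Rightarrow> 'u fm \<Rightarrow> bool" where
  "fm_sat \<delta> e (FEq s t) \<longleftrightarrow> tm_val \<delta> e s = tm_val \<delta> e t"
| "fm_sat \<delta> e (FNot \<phi>) \<longleftrightarrow> \<not> fm_sat \<delta> e \<phi>"
| "fm_sat \<delta> e (FAnd \<phi> \<psi>) \<longleftrightarrow> fm_sat \<delta> e \<phi> \<and> fm_sat \<delta> e \<psi>"
| "fm_sat \<delta> e (FEx n \<phi>) \<longleftrightarrow> (\<exists>a. fm_sat \<delta> (e(n := a)) \<phi>)"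

text \<open>The differential field on the whole type \<open>'u\<close> is saturated: every finitely satisfiable
  set of formulas in one free variable, over a parameter set of smaller cardinality than the
  field, is realized. Only variable \<open>0\<close> is free, so the values of the assignment elsewhere are
  irrelevant.\<close>

definition saturated :: "('u::field \<Rightarrow> 'u) \<Rightarrow> bool" where
  "saturated \<delta> \<longleftrightarrow>
     (\<forall>A \<Phi>. |A| <o |UNIV :: 'u set| \<longrightarrow>
        (\<forall>\<phi>\<in>\<Phi>. fm_params \<phi> \<subseteq> A \<and> fm_free \<phi> \<subseteq> {0}) \<longrightarrow>
        (\<forall>\<Psi>. finite \<Psi> \<and> \<Psi> \<subseteq> \<Phi> \<longrightarrow> (\<exists>a. \<forall>\<phi>\<in>\<Psi>. fm_sat \<delta> (\<lambda>_. a) \<phi>)) \<longrightarrow>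
        (\<exists>a. \<forall>\<phi>\<in>\<Phi>. fm_sat \<delta> (\<lambda>_. a) \<phi>))"

section \<open>Projective differential varieties\<close>

text \<open>Points of \<open>\<P>\<^sup>n\<close> have homogeneous coordinates \<open>x 0, \<dots>, x n\<close>; coordinate vectors are
  padded with zeros, and a point is the set of all its coordinate vectors.\<close>

definition hcoords :: "nat \<Rightarrow> (nat \<Rightarrow> 'u::field) set" where
  "hcoords n = {x. (\<exists>i\<le>n. x i \<noteq> 0) \<and> (\<forall>i>n. x i = 0)}"

definition proportional :: "nat \<Rightarrow> ((nat \<Rightarrow> 'u::field) \<times> (nat \<Rightarrow> 'u)) set" where
  "proportional n =
     {(x, y). x \<in> hcoords n \<and> y \<in> hcoords n \<and> (\<exists>c. c \<noteq> 0 \<and> y = (\<lambda>i. c * x i))}"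

definition proj_space :: "nat \<Rightarrow> (nat \<Rightarrow> 'u::field) set set" where
  "proj_space n = hcoords n // proportional n"

text \<open>The arguments \<open>K\<close> below are the ground differential field: the field of coefficients of
  the differential polynomials and of the scalars in the definition of homogeneity. The
  coordinates of points range over the whole type \<open>'u\<close>.\<close>

definition dhomogeneous :: "'u set \<Rightarrow> ('u::field \<Rightarrow> 'u) \<Rightarrow> ('u, nat) dpoly \<Rightarrow> bool" where
  "dhomogeneous K \<delta> g \<longleftrightarrow>
     (\<exists>d::nat. \<forall>l\<in>K - {0}. \<forall>x. deval \<delta> g (\<lambda>i. l * x i) = l ^ d * deval \<delta> g x)"

definition proj_variety :: "'u set \<Rightarrow> ('u::field \<Rightarrow> 'u) \<Rightarrow> nat \<Rightarrow> (nat \<Rightarrow> 'u) set set \<Rightarrow> bool" where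
  "proj_variety K \<delta> n V \<longleftrightarrow>
     (\<exists>G \<subseteq> {g \<in> dpolys K {..n}. dhomogeneous K \<delta> g}.
        V = {p \<in> proj_space n. \<forall>g\<in>G. \<forall>x\<in>p. deval \<delta> g x = 0})"

text \<open>On \<open>\<P>\<^sup>n \<times> \<P>\<^sup>m\<close> the two groups of coordinates are indexed by \<open>Inl i\<close> (\<open>i \<le> n\<close>) and
  \<open>Inr j\<close> (\<open>j \<le> m\<close>).\<close>

definition dbihomogeneous :: "'u set \<Rightarrow> ('u::field \<Rightarrow> 'u) \<Rightarrow> ('u, nat + nat) dpoly \<Rightarrow> bool" where
  "dbihomogeneous K \<delta> g \<longleftrightarrow>
     (\<exists>d::nat. \<forall>l\<in>K - {0}. \<forall>x y.
        deval \<delta> g (case_sum (\<lambda>i. l * x i) y) = l ^ d * deval \<delta> g (case_sum x y)) \<and>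
     (\<exists>e::nat. \<forall>l\<in>K - {0}. \<forall>x y.
        deval \<delta> g (case_sum x (\<lambda>j. l * y j)) = l ^ e * deval \<delta> g (case_sum x y))"

definition biproj_closed ::
  "'u set \<Rightarrow> ('u::field \<Rightarrow> 'u) \<Rightarrow> nat \<Rightarrow> nat \<Rightarrow> ((nat \<Rightarrow> 'u) set \<times> (nat \<Rightarrow> 'u) set) set \<Rightarrow> bool"
where
  "biproj_closed K \<delta> n m Z \<longleftrightarrow>
     (\<exists>G \<subseteq> {g \<in> dpolys K ({..n} <+> {..m}). dbihomogeneous K \<delta> g}.
        Z = {(p, q) \<in> proj_space n \<times> proj_space m.
               \<forall>g\<in>G. \<forall>x\<in>p. \<forall>y\<in>q. deval \<delta> g (case_sum x y) = 0})"

definition delta_complete :: "'u set \<Rightarrow> ('u::field \<Rightarrow> 'u) \<Rightarrow> nat \<Rightarrow> (nat \<Rightarrow> 'u) set set \<Rightarrow> bool" where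
  "delta_complete K \<delta> n V \<longleftrightarrow> proj_variety K \<delta> n V \<and>
     (\<forall>m W Z. proj_variety K \<delta> m W \<and> biproj_closed K \<delta> n m Z \<and> Z \<subseteq> V \<times> W \<longrightarrow>
        proj_variety K \<delta> m (snd ` Z))"

definition proj_embed :: "'u::field \<Rightarrow> (nat \<Rightarrow> 'u) set" where
  "proj_embed x = proportional 1 `` {(\<lambda>_. 0)(0 := x, 1 := 1)}"

definition proj_closure :: "'u set \<Rightarrow> ('u::field \<Rightarrow> 'u) \<Rightarrow> 'u set \<Rightarrow> (nat \<Rightarrow> 'u) set set" where
  "proj_closure K \<delta> X = \<Inter>{V. proj_variety K \<delta> 1 V \<and> proj_embed ` X \<subseteq> V}"

definition linear_ode_solutions ::
  "('u::field \<Rightarrow> 'u) \<Rightarrow> nat \<Rightarrow> (nat \<Rightarrow> 'u) \<Rightarrow> 'u \<Rightarrow> 'u set" where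
  "linear_ode_solutions \<delta> k a b = {x. (\<delta> ^^ k) x = (\<Sum>i<k. a i * (\<delta> ^^ i) x) + b}"

end

theory Submission
  imports Defs "HOL-Computational_Algebra.Polynomial" "Jordan_Normal_Form.Determinant"
    "HOL-Library.Countable_Set"
begin

text \<open>Write \<open>U\<close> for the field carried by the type, \<open>C\<close> for its constants and \<open>X\<close> for the solutions of
  the equation.

  The closure of \<open>X\<close> is a projective space over the constants in disguise. Since \<open>F\<close> is
  differentially closed, the equation has a particular solution \<open>v k\<close> in \<open>F\<close> and its homogeneous
  part has a basis \<open>v 0, \<dots>, v (k - 1)\<close> of solutions in \<open>F\<close> that spans all solutions in \<open>U\<close> over
  \<open>C\<close> (\<open>solution_basis_exists\<close>). Hence every point of the closure is
  \<open>(\<Sum>i\<le>k. c i * v i : c k)\<close> for constants \<open>c 0, \<dots>, c k\<close> that are not all zero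
  (\<open>closure_points\<close>). A differential polynomial \<open>g (x, y)\<close>, homogeneous in \<open>x\<close>, becomes at such a
  point a homogeneous polynomial in \<open>c\<close> whose coefficients are differential polynomials in \<open>y\<close>
  over \<open>F\<close> (\<open>homogeneous_expansion\<close>). So completeness amounts to classical elimination theory, in
  which the unknowns are constants but the coefficients are not.

  This twist is met by adding to the equations \<open>P g = 0\<close> all their derivatives, taken
  coefficientwise: a constant zero of \<open>P g\<close> is a zero of these as well. The ideal they generate in
  \<open>U[c 0, \<dots>, c k]\<close> is a differential ideal, and a version of the Nullstellensatz holds for it:
  unless it contains a power of every indeterminate, it has a nontrivial zero in \<open>C\<close>
  (\<open>kernel_imp_common_zero\<close>). The coordinates of the zero are found one after the other
  (\<open>ideal_specialisation\<close>); this rests on \<open>C\<close> being algebraically closed and, by saturation,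
  uncountable. That the ideal contains all monomials of degree \<open>N\<close> is a rank condition on a matrix
  (the Macaulay matrix in degree \<open>N\<close>). Therefore a nontrivial constant zero exists iff
  all maximal minors of these matrices vanish, for every \<open>N\<close> (\<open>elimination\<close>).

  These minors are differential polynomials in \<open>y\<close> over \<open>F\<close>, so they define the image of the
  projection on coordinate vectors. They need not be homogeneous, because a derivative of a
  homogeneous differential polynomial need not be; but their common zero set is stable under scaling,
  and it is therefore also defined by the homogeneous forms of the minors in the charts
  \<open>y i \<noteq> 0\<close> (\<open>homogenisation\<close>, \<open>image_is_variety\<close>).

  One more point needs care: homogeneity is only given for scalars in \<open>F\<close>, whereas the
  coordinates of a point are determined up to scalars in \<open>U\<close>. The gap is closed by showing that a
  differential polynomial over \<open>U\<close> which vanishes on \<open>F\<close> away from \<open>0\<close> vanishes on \<open>U\<close> away from \<open>0\<close>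
  (\<open>vanishing_on_nonzero\<close>).\<close>

section \<open>Polynomials and their values\<close>

type_synonym ('v, 'u) mpoly = "('v \<Rightarrow>\<^sub>0 nat) \<Rightarrow>\<^sub>0 'u"

definition mval :: "('v \<Rightarrow>\<^sub>0 nat) \<Rightarrow> ('v \<Rightarrow> 'u::comm_semiring_1) \<Rightarrow> 'u" where
  "mval m z = (\<Prod>v\<in>Poly_Mapping.keys m. z v ^ Poly_Mapping.lookup m v)"

definition peval :: "('v, 'u::comm_semiring_1) mpoly \<Rightarrow> ('v \<Rightarrow> 'u) \<Rightarrow> 'u" where
  "peval P z = (\<Sum>m\<in>Poly_Mapping.keys P. Poly_Mapping.lookup P m * mval m z)"

lemma mval_superset:
  assumes "finite S" "Poly_Mapping.keys m \<subseteq> S"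
  shows "mval m z = (\<Prod>v\<in>S. z v ^ Poly_Mapping.lookup m v)"
  unfolding mval_def using assms by (intro prod.mono_neutral_left) (auto simp: in_keys_iff)

lemma mval_0 [simp]: "mval 0 z = 1"
  by (simp add: mval_def)

lemma mval_add: "mval (m + n) z = mval m z * mval n z"
proof -
  let ?S = "Poly_Mapping.keys m \<union> Poly_Mapping.keys n"
  have "mval (m + n) z = (\<Prod>v\<in>?S. z v ^ Poly_Mapping.lookup (m + n) v)"
    by (rule mval_superset) (auto simp: keys_add)
  also have "\<dots> = (\<Prod>v\<in>?S. z v ^ Poly_Mapping.lookup m v) * (\<Prod>v\<in>?S. z v ^ Poly_Mapping.lookup n v)"
    by (simp add: lookup_add power_add prod.distrib)
  also have "\<dots> = mval m z * mval n z"
    by (subst (1 2) mval_superset[of ?S]) auto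
  finally show ?thesis .
qed

lemma mval_single [simp]: "mval (Poly_Mapping.single v k) z = z v ^ k"
  by (cases "k = 0") (simp_all add: mval_def)

lemma peval_superset:
  assumes "finite S" "Poly_Mapping.keys P \<subseteq> S"
  shows "peval P z = (\<Sum>m\<in>S. Poly_Mapping.lookup P m * mval m z)"
  unfolding peval_def using assms by (intro sum.mono_neutral_left) (auto simp: in_keys_iff)

lemma peval_0 [simp]: "peval 0 z = 0"
  by (simp add: peval_def)

lemma peval_single [simp]: "peval (Poly_Mapping.single m c) z = c * mval m z"
  by (cases "c = 0") (simp_all add: peval_def)

lemma peval_add: "peval (P + Q) z = peval P z + peval Q z"
proof -
  let ?S = "Poly_Mapping.keys P \<union> Poly_Mapping.keys Q"
  have "peval (P + Q) z = (\<Sum>m\<in>?S. Poly_Mapping.lookup (P + Q) m * mval m z)"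
    by (rule peval_superset) (auto simp: keys_add)
  also have "\<dots> = (\<Sum>m\<in>?S. Poly_Mapping.lookup P m * mval m z) + (\<Sum>m\<in>?S. Poly_Mapping.lookup Q m * mval m z)"
    by (simp add: lookup_add algebra_simps sum.distrib)
  also have "\<dots> = peval P z + peval Q z"
    by (subst (1 2) peval_superset[of ?S]) auto
  finally show ?thesis .
qed

lemma poly_mapping_sum_singles:
  fixes P :: "'a \<Rightarrow>\<^sub>0 'b::comm_monoid_add"
  shows "P = (\<Sum>m\<in>Poly_Mapping.keys P. Poly_Mapping.single m (Poly_Mapping.lookup P m))"
  by (rule poly_mapping_eqI)
     (auto simp: lookup_sum lookup_single when_def in_keys_iff)

text \<open>Identities that are additive in a polynomial only have to be checked on monomials; the product
  rules below are obtained by two nested inductions of this kind.\<close>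

lemma poly_mapping_add_induct [case_names zero single add]:
  fixes p :: "'a \<Rightarrow>\<^sub>0 'b::comm_monoid_add"
  assumes "R 0" "\<And>m c. R (Poly_Mapping.single m c)" "\<And>p q. R p \<Longrightarrow> R q \<Longrightarrow> R (p + q)"
  shows "R p"
proof -
  have "R (\<Sum>m\<in>S. Poly_Mapping.single m (Poly_Mapping.lookup p m))" if "finite S" for S
    using that by induction (auto intro: assms)
  from this[of "Poly_Mapping.keys p"] show ?thesis
    using poly_mapping_sum_singles[of p] by simp
qed

lemma peval_mult: "peval (P * Q) z = peval P z * peval Q (z :: 'v \<Rightarrow> 'u::comm_semiring_1)"
proof (induction P rule: poly_mapping_add_induct)
  case (single m c)
  show ?case
    by (induction Q rule: poly_mapping_add_induct)
       (simp_all add: mult_single mval_add peval_add algebra_simps)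
qed (simp_all add: peval_add algebra_simps)

lemma peval_sum: "peval (\<Sum>i\<in>I. P i) z = (\<Sum>i\<in>I. peval (P i) z)"
  by (induction I rule: infinite_finite_induct) (simp_all add: peval_add)

text \<open>A differential polynomial is an ordinary polynomial in the jet coordinates \<open>(i, k)\<close>, so its
  evaluation inherits the homomorphism properties of \<open>peval\<close>.\<close>

lemma deval_peval: "deval \<delta> g x = peval g (\<lambda>(i, k). (\<delta> ^^ k) (x i))"
  unfolding deval_def peval_def mval_def
  by (intro sum.cong prod.cong arg_cong2[of _ _ _ _ "(*)"]) auto

section \<open>Derivations\<close>

lemma derivation_add: "derivation \<delta> \<Longrightarrow> \<delta> (x + y) = \<delta> x + \<delta> y"
  by (simp add: derivation_def)

lemma derivation_mult: "derivation \<delta> \<Longrightarrow> \<delta> (x * y) = \<delta> x * y + x * \<delta> y"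
  by (simp add: derivation_def)

lemma derivation_0: "derivation \<delta> \<Longrightarrow> \<delta> 0 = 0"
  using derivation_add[of \<delta> 0 0] by (metis add_cancel_right_right add_0)

lemma derivation_1: "derivation \<delta> \<Longrightarrow> \<delta> 1 = 0"
  using derivation_mult[of \<delta> 1 1] by (metis add_cancel_right_right mult_1 mult_1_right)

lemma derivation_minus: "derivation \<delta> \<Longrightarrow> \<delta> (- x) = - \<delta> x"
  using derivation_add[of \<delta> x "- x"] by (simp add: derivation_0 eq_neg_iff_add_eq_0 add.commute)

lemma derivation_diff: "derivation \<delta> \<Longrightarrow> \<delta> (x - y) = \<delta> x - \<delta> y"
  using derivation_add[of \<delta> x "- y"] by (simp add: derivation_minus)

lemma derivation_inverse:
  assumes "derivation \<delta>" "x \<noteq> 0"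
  shows "\<delta> (inverse x) = - \<delta> x * inverse x ^ 2"
proof -
  have "\<delta> x * inverse x + x * \<delta> (inverse x) = 0"
    using derivation_mult[OF assms(1), of x "inverse x"] assms by (simp add: derivation_1)
  then have "x * \<delta> (inverse x) = - \<delta> x * inverse x"
    by (simp add: eq_neg_iff_add_eq_0 add.commute)
  then have "inverse x * (x * \<delta> (inverse x)) = inverse x * (- \<delta> x * inverse x)"
    by (rule arg_cong)
  moreover have "inverse x * (x * \<delta> (inverse x)) = \<delta> (inverse x)"
    using assms(2) by (simp add: mult.assoc[symmetric])
  ultimately show ?thesis by (simp add: power2_eq_square mult_ac)
qed

lemma derivation_of_nat: "derivation \<delta> \<Longrightarrow> \<delta> (of_nat n) = 0"
  by (induction n) (simp_all add: derivation_0 derivation_1 derivation_add)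

lemma derivation_power_const: "derivation \<delta> \<Longrightarrow> \<delta> c = 0 \<Longrightarrow> \<delta> (c ^ n) = 0"
  by (induction n) (simp_all add: derivation_1 derivation_mult)

lemma derivation_funpow_add: "derivation \<delta> \<Longrightarrow> (\<delta> ^^ n) (x + y) = (\<delta> ^^ n) x + (\<delta> ^^ n) y"
  by (induction n) (simp_all add: derivation_add)

lemma derivation_funpow_0: "derivation \<delta> \<Longrightarrow> (\<delta> ^^ n) 0 = 0"
  by (induction n) (simp_all add: derivation_0)

lemma derivation_funpow_sum: "derivation \<delta> \<Longrightarrow> (\<delta> ^^ n) (\<Sum>i\<in>I. f i) = (\<Sum>i\<in>I. (\<delta> ^^ n) (f i))"
  by (induction I rule: infinite_finite_induct) (simp_all add: derivation_funpow_0 derivation_funpow_add)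

lemma derivation_funpow_diff: "derivation \<delta> \<Longrightarrow> (\<delta> ^^ n) (x - y) = (\<delta> ^^ n) x - (\<delta> ^^ n) y"
  by (induction n) (simp_all add: derivation_diff)

lemma derivation_funpow_mult_const:
  "derivation \<delta> \<Longrightarrow> \<delta> c = 0 \<Longrightarrow> (\<delta> ^^ n) (c * x) = c * (\<delta> ^^ n) x"
  by (induction n) (simp_all add: derivation_mult)

section \<open>Differential polynomial functions\<close>

text \<open>The functions defined by differential polynomials over \<open>K\<close> in the indeterminates \<open>I\<close>. Generating
  them by ring operations from the derivatives of coordinates makes closure under \<open>\<delta>\<close>,
  substitution and homogenisation plain inductions; \<open>dfuns_eq\<close> leads back to polynomials.\<close>

inductive_set dfuns :: "('u::field \<Rightarrow> 'u) \<Rightarrow> 'u set \<Rightarrow> 'i set \<Rightarrow> (('i \<Rightarrow> 'u) \<Rightarrow> 'u) set"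
  for \<delta> K I where
  const: "c \<in> K \<Longrightarrow> (\<lambda>x. c) \<in> dfuns \<delta> K I"
| var: "i \<in> I \<Longrightarrow> (\<lambda>x. (\<delta> ^^ k) (x i)) \<in> dfuns \<delta> K I"
| add: "f \<in> dfuns \<delta> K I \<Longrightarrow> g \<in> dfuns \<delta> K I \<Longrightarrow> (\<lambda>x. f x + g x) \<in> dfuns \<delta> K I"
| mult: "f \<in> dfuns \<delta> K I \<Longrightarrow> g \<in> dfuns \<delta> K I \<Longrightarrow> (\<lambda>x. f x * g x) \<in> dfuns \<delta> K I"

lemma differential_subfieldD:
  assumes "differential_subfield \<delta> K"
  shows "0 \<in> K" "1 \<in> K" "x \<in> K \<Longrightarrow> y \<in> K \<Longrightarrow> x + y \<in> K" "x \<in> K \<Longrightarrow> y \<in> K \<Longrightarrow> x * y \<in> K"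
    "x \<in> K \<Longrightarrow> - x \<in> K" "x \<in> K \<Longrightarrow> inverse x \<in> K" "x \<in> K \<Longrightarrow> \<delta> x \<in> K"
  using assms unfolding differential_subfield_def by auto

lemma differential_subfield_of_nat: "differential_subfield \<delta> K \<Longrightarrow> of_nat n \<in> K"
  by (induction n) (auto intro: differential_subfieldD)

lemma differential_subfield_funpow: "differential_subfield \<delta> K \<Longrightarrow> x \<in> K \<Longrightarrow> (\<delta> ^^ n) x \<in> K"
  by (induction n) (auto intro: differential_subfieldD)

context
  fixes \<delta> :: "'u::field \<Rightarrow> 'u" and K :: "'u set" and I :: "'i set"
  assumes K: "differential_subfield \<delta> K"
begin

lemma dfuns_sum:
  "(\<And>a. a \<in> A \<Longrightarrow> f a \<in> dfuns \<delta> K I) \<Longrightarrow> (\<lambda>x. \<Sum>a\<in>A. f a x) \<in> dfuns \<delta> K I"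
proof (induction A rule: infinite_finite_induct)
  case (insert a A)
  then show ?case using dfuns.add[of "f a"] by auto
qed (auto intro: dfuns.const differential_subfieldD[OF K])

lemma dfuns_prod:
  "(\<And>a. a \<in> A \<Longrightarrow> f a \<in> dfuns \<delta> K I) \<Longrightarrow> (\<lambda>x. \<Prod>a\<in>A. f a x) \<in> dfuns \<delta> K I"
proof (induction A rule: infinite_finite_induct)
  case (insert a A)
  then show ?case using dfuns.mult[of "f a"] by auto
qed (auto intro: dfuns.const differential_subfieldD[OF K])

lemma dfuns_power: "f \<in> dfuns \<delta> K I \<Longrightarrow> (\<lambda>x. f x ^ n) \<in> dfuns \<delta> K I"
  using dfuns_prod[of "{..<n}" "\<lambda>_. f"] by simp

lemma dfuns_uminus: "f \<in> dfuns \<delta> K I \<Longrightarrow> (\<lambda>x. - f x) \<in> dfuns \<delta> K I"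
  using dfuns.mult[OF dfuns.const[of "-1" K], of f] by (simp add: differential_subfieldD[OF K])

lemma dfuns_diff: "f \<in> dfuns \<delta> K I \<Longrightarrow> g \<in> dfuns \<delta> K I \<Longrightarrow> (\<lambda>x. f x - g x) \<in> dfuns \<delta> K I"
  using dfuns.add[OF _ dfuns_uminus, of f g] by simp

lemma dfuns_var: "i \<in> I \<Longrightarrow> (\<lambda>x. x i) \<in> dfuns \<delta> K I"
  using dfuns.var[of i I 0] by simp

lemma dfuns_deriv:
  assumes "derivation \<delta>"
  shows "f \<in> dfuns \<delta> K I \<Longrightarrow> (\<lambda>x. \<delta> (f x)) \<in> dfuns \<delta> K I"
proof (induction rule: dfuns.induct)
  case (var i k)
  then show ?case using dfuns.var[of i I "Suc k"] by simp
qed (auto simp: derivation_add[OF assms] derivation_mult[OF assms]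
     intro!: dfuns.intros differential_subfieldD[OF K])

lemma dfuns_deriv_funpow:
  assumes "derivation \<delta>" "f \<in> dfuns \<delta> K I"
  shows "(\<lambda>x. (\<delta> ^^ n) (f x)) \<in> dfuns \<delta> K I"
  by (induction n) (auto simp: assms dfuns_deriv)

lemma dfuns_mval:
  "Poly_Mapping.keys m \<subseteq> I \<times> UNIV \<Longrightarrow> (\<lambda>x. mval m (\<lambda>(i, k). (\<delta> ^^ k) (x i))) \<in> dfuns \<delta> K I"
  unfolding mval_def by (intro dfuns_prod dfuns_power) (auto intro!: dfuns.var)

lemma deval_in_dfuns:
  assumes "g \<in> dpolys K I"
  shows "deval \<delta> g \<in> dfuns \<delta> K I"
proof -
  have "(\<lambda>x. peval g (\<lambda>(i, k). (\<delta> ^^ k) (x i))) \<in> dfuns \<delta> K I"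
    unfolding peval_def using assms
    by (intro dfuns_sum dfuns.mult dfuns.const dfuns_mval) (auto simp: dpolys_def dvars_def)
  then show ?thesis by (simp add: deval_peval[abs_def])
qed

lemma dpolys_add: "f \<in> dpolys K I \<Longrightarrow> g \<in> dpolys K I \<Longrightarrow> f + g \<in> dpolys K I"
  unfolding dpolys_def dvars_def using keys_add[of f g]
  by (fastforce simp: lookup_add intro: differential_subfieldD[OF K])

lemma dpolys_single:
  "c \<in> K \<Longrightarrow> Poly_Mapping.keys m \<subseteq> I \<times> UNIV \<Longrightarrow> Poly_Mapping.single m c \<in> dpolys K I"
  unfolding dpolys_def dvars_def
  by (auto simp: lookup_single when_def differential_subfieldD[OF K])

lemma dpolys_sum: "(\<And>a. a \<in> A \<Longrightarrow> f a \<in> dpolys K I) \<Longrightarrow> (\<Sum>a\<in>A. f a) \<in> dpolys K I"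
proof (induction A rule: infinite_finite_induct)
  case (insert a A)
  then show ?case using dpolys_add by auto
qed (auto simp: dpolys_def dvars_def differential_subfieldD[OF K])

lemma dpolys_mult:
  assumes f: "f \<in> dpolys K I" and g: "g \<in> dpolys K I"
  shows "f * g \<in> dpolys K I"
proof -
  have "f * g = (\<Sum>m\<in>Poly_Mapping.keys f. Poly_Mapping.single m (Poly_Mapping.lookup f m)) *
                (\<Sum>n\<in>Poly_Mapping.keys g. Poly_Mapping.single n (Poly_Mapping.lookup g n))"
    using poly_mapping_sum_singles[of f] poly_mapping_sum_singles[of g] by simp
  also have "\<dots> = (\<Sum>m\<in>Poly_Mapping.keys f. \<Sum>n\<in>Poly_Mapping.keys g.
      Poly_Mapping.single (m + n) (Poly_Mapping.lookup f m * Poly_Mapping.lookup g n))"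
    by (simp add: sum_product mult_single)
  also have "\<dots> \<in> dpolys K I"
  proof (intro dpolys_sum dpolys_single differential_subfieldD(4)[OF K])
    fix m n assume "m \<in> Poly_Mapping.keys f" "n \<in> Poly_Mapping.keys g"
    then show "Poly_Mapping.keys (m + n) \<subseteq> I \<times> UNIV"
      using f g keys_add[of m n] unfolding dpolys_def dvars_def by fastforce
  qed (use f g in \<open>auto simp: dpolys_def\<close>)
  finally show ?thesis .
qed

lemma dfuns_eq: "dfuns \<delta> K I = deval \<delta> ` dpolys K I"
proof safe
  fix f assume "f \<in> dfuns \<delta> K I"
  then have "\<exists>g\<in>dpolys K I. \<forall>x. f x = deval \<delta> g x"
  proof induction
    case (const c)
    then show ?case
      by (intro bexI[of _ "Poly_Mapping.single 0 c"]) (auto simp: deval_peval dpolys_single)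
  next
    case (var i k)
    then show ?case
      by (intro bexI[of _ "Poly_Mapping.single (Poly_Mapping.single (i, k) 1) 1"])
         (auto simp: deval_peval dpolys_single differential_subfieldD[OF K])
  next
    case (add f g)
    then obtain p q where "p \<in> dpolys K I" "q \<in> dpolys K I"
      "\<forall>x. f x = deval \<delta> p x" "\<forall>x. g x = deval \<delta> q x" by blast
    then show ?case by (intro bexI[of _ "p + q"]) (auto simp: deval_peval peval_add dpolys_add)
  next
    case (mult f g)
    then obtain p q where "p \<in> dpolys K I" "q \<in> dpolys K I"
      "\<forall>x. f x = deval \<delta> p x" "\<forall>x. g x = deval \<delta> q x" by blast
    then show ?case by (intro bexI[of _ "p * q"]) (auto simp: deval_peval peval_mult dpolys_mult)
  qed
  then show "f \<in> deval \<delta> ` dpolys K I" by (auto simp: image_iff fun_eq_iff)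
qed (rule deval_in_dfuns)

end

section \<open>Homogenisation\<close>

lemma dfuns_subst:
  assumes "differential_subfield \<delta> K'" "derivation \<delta>" "K \<subseteq> K'"
    and X: "\<And>i. i \<in> I \<Longrightarrow> X i \<in> dfuns \<delta> K' I'"
    and "f \<in> dfuns \<delta> K I"
  shows "(\<lambda>l. f (\<lambda>i. X i l)) \<in> dfuns \<delta> K' I'"
  using assms(5)
proof induction
  case (var i k)
  then show ?case by (intro dfuns_deriv_funpow assms X)
qed (use assms(3) in \<open>auto intro: dfuns.intros\<close>)

text \<open>The factor \<open>x\<close> on the left replaces the exponent \<open>n - 1\<close> on the right.\<close>

lemma derivation_power:
  assumes "derivation \<delta>"
  shows "x * \<delta> (x ^ n) = of_nat n * x ^ n * \<delta> x"
proof (induction n)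
  case (Suc n)
  have "x * \<delta> (x ^ Suc n) = x * x ^ n * \<delta> x + x * (x * \<delta> (x ^ n))"
    by (simp add: derivation_mult[OF assms] algebra_simps)
  then show ?case by (simp add: Suc algebra_simps)
qed (simp add: derivation_1[OF assms])

text \<open>If \<open>g = y i ^ N * q\<close> with \<open>q\<close> a derivative of \<open>y j / y i\<close>, then the quotient rule gives
  \<open>y i ^ Suc N * \<delta> q = y i * \<delta> g - N * \<delta> (y i) * g\<close>, so each derivative costs one more power
  of \<open>y i\<close>.\<close>

lemma dfuns_clear_denominators_var:
  fixes \<delta> :: "'u::field \<Rightarrow> 'u"
  assumes K: "differential_subfield \<delta> K" and d: "derivation \<delta>" and ij: "i \<in> I" "j \<in> I"
  shows "\<exists>g\<in>dfuns \<delta> K I. \<exists>N. \<forall>y. y i \<noteq> 0 \<longrightarrow> g y = y i ^ N * (\<delta> ^^ k) (y j / y i)"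
proof (induction k)
  case 0
  show ?case using ij by (intro bexI[of _ "\<lambda>y. y j"] exI[of _ 1]) (auto intro: dfuns_var[OF K])
next
  case (Suc k)
  then obtain g N where g: "g \<in> dfuns \<delta> K I"
    and gN: "\<And>y. y i \<noteq> 0 \<Longrightarrow> g y = y i ^ N * (\<delta> ^^ k) (y j / y i)" by blast
  let ?h = "\<lambda>y. y i * \<delta> (g y) - of_nat N * \<delta> (y i) * g y"
  have "?h \<in> dfuns \<delta> K I"
    using ij by (intro dfuns_diff[OF K] dfuns.mult dfuns.const dfuns_deriv[OF K d] g dfuns_var[OF K]
      differential_subfield_of_nat[OF K]) auto
  moreover have "?h y = y i ^ Suc N * (\<delta> ^^ Suc k) (y j / y i)" if "y i \<noteq> 0" for y
  proof -
    let ?q = "(\<delta> ^^ k) (y j / y i)"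
    have "\<delta> (g y) = \<delta> (y i ^ N) * ?q + y i ^ N * \<delta> ?q"
      unfolding gN[of y, OF that] by (rule derivation_mult[OF d])
    then have "y i * \<delta> (g y) = (y i * \<delta> (y i ^ N)) * ?q + y i ^ Suc N * \<delta> ?q"
      by (simp only: distrib_left power_Suc mult.assoc)
    also have "(y i * \<delta> (y i ^ N)) * ?q = of_nat N * \<delta> (y i) * g y"
      unfolding derivation_power[OF d] gN[of y, OF that] by (simp only: mult_ac)
    finally show ?thesis by (simp only: funpow.simps o_apply add_diff_cancel_left')
  qed
  ultimately show ?case by (intro bexI[of _ ?h] exI[of _ "Suc N"] allI impI)
qed

lemma dfuns_clear_denominators:
  fixes \<delta> :: "'u::field \<Rightarrow> 'u"
  assumes K: "differential_subfield \<delta> K" and d: "derivation \<delta>" and i: "i \<in> I"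
    and "f \<in> dfuns \<delta> K I"
  shows "\<exists>g\<in>dfuns \<delta> K I. \<exists>N. \<forall>y. y i \<noteq> 0 \<longrightarrow> g y = y i ^ N * f (\<lambda>j. y j / y i)"
  using assms(4)
proof induction
  case (const c)
  then show ?case by (intro bexI[of _ "\<lambda>y. c"] exI[of _ 0]) (auto intro: dfuns.const)
next
  case (var j k)
  then show ?case using dfuns_clear_denominators_var[OF K d i] by blast
next
  case (add f1 f2)
  then obtain g1 N1 g2 N2 where
    g: "g1 \<in> dfuns \<delta> K I" "g2 \<in> dfuns \<delta> K I"
    "\<And>y. y i \<noteq> 0 \<Longrightarrow> g1 y = y i ^ N1 * f1 (\<lambda>j. y j / y i)"
    "\<And>y. y i \<noteq> 0 \<Longrightarrow> g2 y = y i ^ N2 * f2 (\<lambda>j. y j / y i)" by blast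
  have "(\<lambda>y. y i ^ N2 * g1 y + y i ^ N1 * g2 y) \<in> dfuns \<delta> K I"
    by (intro dfuns.add dfuns.mult dfuns_power[OF K] dfuns_var[OF K] g i)
  then show ?case
    by (rule rev_bexI) (auto intro!: exI[of _ "N1 + N2"] simp: g power_add algebra_simps)
next
  case (mult f1 f2)
  then obtain g1 N1 g2 N2 where
    g: "g1 \<in> dfuns \<delta> K I" "g2 \<in> dfuns \<delta> K I"
    "\<And>y. y i \<noteq> 0 \<Longrightarrow> g1 y = y i ^ N1 * f1 (\<lambda>j. y j / y i)"
    "\<And>y. y i \<noteq> 0 \<Longrightarrow> g2 y = y i ^ N2 * f2 (\<lambda>j. y j / y i)" by blast
  have "(\<lambda>y. g1 y * g2 y) \<in> dfuns \<delta> K I"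
    by (intro dfuns.mult g)
  then show ?case
    by (rule rev_bexI) (auto intro!: exI[of _ "N1 + N2"] simp: g power_add)
qed

text \<open>The homogeneous form of \<open>f\<close> in the chart \<open>y i \<noteq> 0\<close>. A denominator-free multiple of
  \<open>f (y / y i)\<close> is multiplied by one more \<open>y i\<close>, so that it vanishes off the chart; then zero
  loci given in the separate charts can be intersected without losing points.\<close>

lemma homogenisation:
  fixes \<delta> :: "'u::field \<Rightarrow> 'u" and f :: "(nat \<Rightarrow> 'u) \<Rightarrow> 'u"
  assumes K: "differential_subfield \<delta> K" and d: "derivation \<delta>" and i: "i \<in> I"
    and "f \<in> dfuns \<delta> K I"
  shows "\<exists>g\<in>dpolys K I. dhomogeneous K \<delta> g \<and>
    (\<forall>y. deval \<delta> g y = 0 \<longleftrightarrow> y i = 0 \<or> f (\<lambda>j. y j / y i) = 0)"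
proof -
  obtain h N where h: "h \<in> dfuns \<delta> K I"
    and hN: "\<And>y. y i \<noteq> 0 \<Longrightarrow> h y = y i ^ N * f (\<lambda>j. y j / y i)"
    using dfuns_clear_denominators[OF assms] by blast
  have "(\<lambda>y. y i * h y) \<in> dfuns \<delta> K I"
    by (intro dfuns.mult dfuns_var[OF K] i h)
  then obtain g where g: "g \<in> dpolys K I" "\<And>y. deval \<delta> g y = y i * h y"
    unfolding dfuns_eq[OF K] by (auto simp: fun_eq_iff)
  have "deval \<delta> g (\<lambda>j. l * y j) = l ^ Suc N * deval \<delta> g y" if "l \<noteq> 0" for l y
    using that by (cases "y i = 0") (simp_all add: g hN power_mult_distrib)
  then have "dhomogeneous K \<delta> g"
    unfolding dhomogeneous_def by (intro exI[of _ "Suc N"]) auto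
  moreover have "deval \<delta> g y = 0 \<longleftrightarrow> y i = 0 \<or> f (\<lambda>j. y j / y i) = 0" for y
    by (cases "y i = 0") (simp_all add: g hN)
  ultimately show ?thesis using g(1) by blast
qed

section \<open>Differential polynomials on a differentially closed field\<close>

lemma single_single_eq: "Poly_Mapping.single i (1::nat) = Poly_Mapping.single j 1 \<longleftrightarrow> i = j"
  by (metis keys_single one_neq_zero singleton_inject)

lemma dorder_ge:
  assumes "((), n) \<in> dvars f"
  shows "int n \<le> dorder f"
proof -
  have "finite (dvars f)" by (simp add: dvars_def)
  then have "n \<le> Max (snd ` dvars f)"
    using assms by (intro Max_ge) (auto intro: image_eqI[of _ _ "((), n)"])
  then show ?thesis using assms by (auto simp: dorder_def)
qed

lemma differentially_closedD:
  assumes "differentially_closed \<delta> K" "f \<in> dpolys K UNIV" "g \<in> dpolys K UNIV" "g \<noteq> 0"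
    "dorder g < dorder f"
  shows "\<exists>a\<in>K. deval \<delta> f (\<lambda>_. a) = 0 \<and> deval \<delta> g (\<lambda>_. a) \<noteq> 0"
  using assms unfolding differentially_closed_def by blast

text \<open>Blum's axiom applied to \<open>x\<^sup>(\<^sup>n\<^sup>) = 0\<close>, with \<open>n\<close> above the order of \<open>g\<close>: if \<open>g\<close> is not the zero
  polynomial, some solution in \<open>K\<close> is not a zero of \<open>g\<close>.\<close>

lemma vanishing_on_differentially_closed:
  assumes K: "differentially_closed \<delta> K"
    and f: "f \<in> dfuns \<delta> K (UNIV :: unit set)" and van: "\<And>a. a \<in> K \<Longrightarrow> f (\<lambda>_. a) = 0"
  shows "f x = 0"
proof -
  have sub: "differential_subfield \<delta> K" using K by (simp add: differentially_closed_def)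
  obtain g where g: "g \<in> dpolys K UNIV" "f = deval \<delta> g"
    using f unfolding dfuns_eq[OF sub] by blast
  have "g = 0"
  proof (rule ccontr)
    assume "g \<noteq> 0"
    define n where "n = nat (dorder g + 1)"
    let ?h = "Poly_Mapping.single (Poly_Mapping.single ((), n) 1) 1 :: ('a, unit) dpoly"
    have "int n \<le> dorder ?h" by (rule dorder_ge) (simp add: dvars_def)
    then have "dorder g < dorder ?h" unfolding n_def by linarith
    moreover have "?h \<in> dpolys K UNIV"
      by (rule dpolys_single[OF sub]) (auto simp: differential_subfieldD[OF sub])
    ultimately obtain a where "a \<in> K" "deval \<delta> g (\<lambda>_. a) \<noteq> 0"
      using differentially_closedD[OF K _ g(1) \<open>g \<noteq> 0\<close>] by blast
    then show False using van g(2) by auto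
  qed
  then show ?thesis by (simp add: g(2) deval_def)
qed

lemma dfuns_closed:
  assumes K: "differential_subfield \<delta> K" and f: "f \<in> dfuns \<delta> K I" and "\<And>i. i \<in> I \<Longrightarrow> x i \<in> K"
  shows "f x \<in> K"
  using f by induction (auto intro: differential_subfieldD[OF K] differential_subfield_funpow[OF K] assms(3))

text \<open>At a nonzero point of \<open>K\<close> every \<open>f i\<close> has a value in \<open>K\<close>. So if the coefficients \<open>c i\<close> are
  linearly independent over \<open>K\<close>, each \<open>f i\<close> vanishes there by itself, hence everywhere except
  possibly at \<open>0\<close>. A linear relation between the \<open>c i\<close> allows one of them to be eliminated.\<close>

lemma vanishing_combination:
  fixes \<delta> :: "'u::field_char_0 \<Rightarrow> 'u" and c :: "'a \<Rightarrow> 'u"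
  assumes K: "differentially_closed \<delta> K"
  shows "finite A \<Longrightarrow> (\<And>i. i \<in> A \<Longrightarrow> f i \<in> dfuns \<delta> K (UNIV :: unit set)) \<Longrightarrow>
    (\<And>a. a \<in> K - {0} \<Longrightarrow> (\<Sum>i\<in>A. c i * f i (\<lambda>_. a)) = 0) \<Longrightarrow> a \<noteq> 0 \<Longrightarrow>
    (\<Sum>i\<in>A. c i * f i (\<lambda>_. a)) = 0"
proof (induction "card A" arbitrary: A f rule: less_induct)
  case less
  note fin = less.prems(1) and f = less.prems(2) and van = less.prems(3)
  have sub: "differential_subfield \<delta> K" using K by (simp add: differentially_closed_def)
  show ?case
  proof (cases "\<exists>e. (\<forall>i\<in>A. e i \<in> K) \<and> (\<exists>i\<in>A. e i \<noteq> 0) \<and> (\<Sum>i\<in>A. e i * c i) = 0")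
    case True
    then obtain e i0 where e: "\<And>i. i \<in> A \<Longrightarrow> e i \<in> K" "(\<Sum>i\<in>A. e i * c i) = 0" and i0: "i0 \<in> A" "e i0 \<noteq> 0"
      by blast
    let ?A = "A - {i0}"
    let ?r = "\<lambda>i. e i * inverse (e i0)"
    define h where "h i x = f i x - ?r i * f i0 x" for i x
    have c0: "c i0 = - (\<Sum>i\<in>?A. ?r i * c i)"
    proof -
      have "e i0 * c i0 + (\<Sum>i\<in>?A. e i * c i) = 0"
        using e(2) i0(1) fin by (simp add: sum.remove)
      then have "inverse (e i0) * (e i0 * c i0 + (\<Sum>i\<in>?A. e i * c i)) = 0" by simp
      then have "c i0 + inverse (e i0) * (\<Sum>i\<in>?A. e i * c i) = 0"
        using i0(2) by (simp add: distrib_left mult.assoc[symmetric])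
      then show ?thesis by (simp add: sum_distrib_left eq_neg_iff_add_eq_0 mult_ac)
    qed
    have eq: "(\<Sum>i\<in>A. c i * f i x) = (\<Sum>i\<in>?A. c i * h i x)" for x
    proof -
      have "(\<Sum>i\<in>A. c i * f i x) = c i0 * f i0 x + (\<Sum>i\<in>?A. c i * f i x)"
        using i0(1) fin by (simp add: sum.remove)
      then show ?thesis unfolding c0 h_def
        by (simp add: algebra_simps sum_subtractf sum_distrib_right sum_distrib_left)
    qed
    have "(\<Sum>i\<in>?A. c i * h i (\<lambda>_. a)) = 0"
    proof (rule less.hyps)
      show "card ?A < card A" using i0(1) fin by (rule card_Diff1_less[rotated])
      show "h i \<in> dfuns \<delta> K UNIV" if "i \<in> ?A" for i
        unfolding h_def using that i0(1)
        by (intro dfuns_diff[OF sub] dfuns.mult dfuns.const f differential_subfieldD[OF sub] e) auto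
    qed (use fin van less.prems(4) eq in auto)
    then show ?thesis by (simp add: eq)
  next
    case False
    have *: "f i (\<lambda>_. b) = 0" if "i \<in> A" "b \<in> K - {0}" for i b
    proof (rule ccontr)
      assume "f i (\<lambda>_. b) \<noteq> 0"
      moreover have "\<forall>j\<in>A. f j (\<lambda>_. b) \<in> K"
        using that(2) dfuns_closed[OF sub f, of _ "\<lambda>_. b"] by blast
      moreover have "(\<Sum>j\<in>A. f j (\<lambda>_. b) * c j) = 0"
        using van[OF that(2)] by (simp add: mult.commute)
      ultimately show False using False that(1) by meson
    qed
    \<comment> \<open>multiplying by the indeterminate removes the exceptional point \<open>0\<close>\<close>
    have "f i (\<lambda>_. a) = 0" if i: "i \<in> A" for i
    proof -
      have "(\<lambda>x. x () * f i x) \<in> dfuns \<delta> K UNIV"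
        by (intro dfuns.mult dfuns_var[OF sub] f i) simp
      from vanishing_on_differentially_closed[OF K this, of "\<lambda>_. a"]
      show ?thesis using * [OF i] less.prems(4) by auto
    qed
    then show ?thesis using less.prems(4) by simp
  qed
qed

text \<open>A differential polynomial over the big field is a combination of monomials, which are defined
  over \<open>K\<close>.\<close>

lemma vanishing_on_nonzero:
  fixes \<delta> :: "'u::field_char_0 \<Rightarrow> 'u"
  assumes K: "differentially_closed \<delta> K" and U: "differential_subfield \<delta> (UNIV :: 'u set)"
    and f: "f \<in> dfuns \<delta> UNIV (UNIV :: unit set)" and van: "\<And>a. a \<in> K - {0} \<Longrightarrow> f (\<lambda>_. a) = 0"
    and "a \<noteq> 0"
  shows "f (\<lambda>_. a) = 0"
proof -
  have sub: "differential_subfield \<delta> K" using K by (simp add: differentially_closed_def)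
  obtain g where g: "f = deval \<delta> g"
    using f unfolding dfuns_eq[OF U] by blast
  have eq: "f x = (\<Sum>m\<in>Poly_Mapping.keys g. Poly_Mapping.lookup g m * mval m (\<lambda>(i, k). (\<delta> ^^ k) (x i)))" for x
    by (simp add: g deval_peval peval_def)
  show ?thesis unfolding eq
  proof (rule vanishing_combination[OF K])
    show "(\<lambda>x. mval m (\<lambda>(i, k). (\<delta> ^^ k) (x i))) \<in> dfuns \<delta> K UNIV" for m :: "unit \<times> nat \<Rightarrow>\<^sub>0 nat"
      by (rule dfuns_mval[OF sub]) simp
  qed (use van \<open>a \<noteq> 0\<close> eq in auto)
qed

text \<open>For fixed \<open>x\<close> the homogeneity relation is a differential polynomial identity in the scalar \<open>l\<close>
  alone. The predicate \<open>P\<close> selects the group of coordinates that is scaled.\<close>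

lemma homogeneity_extends:
  fixes \<delta> :: "'u::field_char_0 \<Rightarrow> 'u"
  assumes K: "differentially_closed \<delta> K" and d: "derivation \<delta>"
    and U: "differential_subfield \<delta> (UNIV :: 'u set)" and f: "f \<in> dfuns \<delta> K I"
    and hom: "\<And>l. l \<in> K - {0} \<Longrightarrow> f (\<lambda>i. if P i then l * x i else x i) = l ^ e * f x"
    and "l \<noteq> 0"
  shows "f (\<lambda>i. if P i then l * x i else x i) = l ^ e * f x"
proof -
  let ?X = "\<lambda>i (y :: unit \<Rightarrow> 'u). if P i then y () * x i else x i"
  have X: "?X i \<in> dfuns \<delta> UNIV UNIV" for i
    by (cases "P i") (auto intro!: dfuns.mult dfuns.const dfuns_var[OF U])
  have "(\<lambda>y. f (\<lambda>i. ?X i y)) \<in> dfuns \<delta> UNIV UNIV"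
    by (rule dfuns_subst[OF U d _ X f]) auto
  then have "(\<lambda>y. f (\<lambda>i. ?X i y) - y () ^ e * f x) \<in> dfuns \<delta> UNIV UNIV"
    by (intro dfuns_diff[OF U] dfuns.mult dfuns.const dfuns_power[OF U] dfuns_var[OF U]) auto
  from vanishing_on_nonzero[OF K U this _ \<open>l \<noteq> 0\<close>] show ?thesis using hom by auto
qed

section \<open>Linear differential operators\<close>

text \<open>Linear differential operators over \<open>K\<close> of order less than \<open>k\<close>.\<close>

inductive_set linops :: "('u::field \<Rightarrow> 'u) \<Rightarrow> 'u set \<Rightarrow> nat \<Rightarrow> ('u \<Rightarrow> 'u) set" for \<delta> K k where
  zero: "(\<lambda>x. 0) \<in> linops \<delta> K k"
| step: "f \<in> linops \<delta> K k \<Longrightarrow> a \<in> K \<Longrightarrow> i < k \<Longrightarrow> (\<lambda>x. f x + a * (\<delta> ^^ i) x) \<in> linops \<delta> K k"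

lemma linops_mono: "f \<in> linops \<delta> K k \<Longrightarrow> k \<le> l \<Longrightarrow> f \<in> linops \<delta> K l"
  by (induction rule: linops.induct) (auto intro: linops.intros)

lemma linops_add: "f \<in> linops \<delta> K k \<Longrightarrow> g \<in> linops \<delta> K k \<Longrightarrow> (\<lambda>x. f x + g x) \<in> linops \<delta> K k"
proof (induction rule: linops.induct)
  case (step f a i)
  then show ?case using linops.step[of "\<lambda>x. f x + g x" \<delta> K k a i] by (simp add: algebra_simps)
qed simp

lemma linops_monomial: "a \<in> K \<Longrightarrow> i < k \<Longrightarrow> (\<lambda>x. a * (\<delta> ^^ i) x) \<in> linops \<delta> K k"
  using linops.step[OF linops.zero, of a K i k \<delta>] by simp

lemma linops_sum: "(\<And>i. i < k \<Longrightarrow> a i \<in> K) \<Longrightarrow> (\<lambda>x. \<Sum>i<k. a i * (\<delta> ^^ i) x) \<in> linops \<delta> K k"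
proof (induction k)
  case (Suc k)
  then have "(\<lambda>x. \<Sum>i<k. a i * (\<delta> ^^ i) x) \<in> linops \<delta> K (Suc k)"
    by (auto intro: linops_mono)
  then show ?case using Suc.prems by (auto intro!: linops_add linops_monomial)
qed (simp add: linops.zero)

lemma linops_top:
  "f \<in> linops \<delta> K (Suc k) \<Longrightarrow> differential_subfield \<delta> K \<Longrightarrow>
    \<exists>g\<in>linops \<delta> K k. \<exists>a\<in>K. \<forall>x. f x = g x + a * (\<delta> ^^ k) x"
proof (induction rule: linops.induct)
  case zero
  then show ?case
    by (intro bexI[of _ "\<lambda>x. 0"] bexI[of _ 0]) (auto simp: linops.zero differential_subfieldD)
next
  case (step f a i)
  then obtain g b where g: "g \<in> linops \<delta> K k" "b \<in> K" "\<And>x. f x = g x + b * (\<delta> ^^ k) x"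
    by blast
  show ?case
  proof (cases "i = k")
    case True
    then show ?thesis using g step
      by (intro bexI[of _ g] bexI[of _ "b + a"]) (auto simp: algebra_simps differential_subfieldD)
  next
    case False
    then show ?thesis using g step
      by (intro bexI[of _ "\<lambda>x. g x + a * (\<delta> ^^ i) x"] bexI[of _ b]) (auto intro: linops.step)
  qed
qed

context
  fixes \<delta> :: "'u::field \<Rightarrow> 'u" and K :: "'u set"
  assumes K: "differential_subfield \<delta> K" and d: "derivation \<delta>"
begin

lemma linops_0: "f \<in> linops \<delta> K k \<Longrightarrow> f 0 = 0"
  by (induction rule: linops.induct) (auto simp: derivation_funpow_0[OF d])

lemma linops_scale: "f \<in> linops \<delta> K k \<Longrightarrow> c \<in> K \<Longrightarrow> (\<lambda>x. c * f x) \<in> linops \<delta> K k"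
proof (induction rule: linops.induct)
  case (step f a i)
  then have "(\<lambda>x. c * f x + (c * a) * (\<delta> ^^ i) x) \<in> linops \<delta> K k"
    by (intro linops.step differential_subfieldD(4)[OF K]) auto
  then show ?case by (simp add: algebra_simps)
qed (simp add: linops.zero)

lemma linops_uminus: "f \<in> linops \<delta> K k \<Longrightarrow> (\<lambda>x. - f x) \<in> linops \<delta> K k"
  using linops_scale[of f k "-1"] differential_subfieldD(2,5)[OF K] by simp

lemma linops_deriv: "f \<in> linops \<delta> K k \<Longrightarrow> (\<lambda>x. \<delta> (f x)) \<in> linops \<delta> K (Suc k)"
proof (induction rule: linops.induct)
  case zero
  then show ?case by (simp add: derivation_0[OF d] linops.zero)
next
  case (step f a i)
  then have "(\<lambda>x. \<delta> (f x) + \<delta> a * (\<delta> ^^ i) x + a * (\<delta> ^^ Suc i) x) \<in> linops \<delta> K (Suc k)"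
    by (intro linops.step differential_subfieldD(7)[OF K]) auto
  then show ?case by (simp add: derivation_add[OF d] derivation_mult[OF d] algebra_simps)
qed

lemma linops_leibniz:
  assumes "c \<in> K"
  shows "\<exists>f\<in>linops \<delta> K k. \<forall>x. (\<delta> ^^ k) (c * x) = c * (\<delta> ^^ k) x + f x"
proof (induction k)
  case 0
  show ?case by (intro bexI[of _ "\<lambda>x. 0"]) (auto simp: linops.zero)
next
  case (Suc k)
  then obtain f where f: "f \<in> linops \<delta> K k" "\<And>x. (\<delta> ^^ k) (c * x) = c * (\<delta> ^^ k) x + f x"
    by blast
  have "(\<lambda>x. \<delta> (f x) + \<delta> c * (\<delta> ^^ k) x) \<in> linops \<delta> K (Suc k)"
    using assms by (intro linops.step linops_deriv f differential_subfieldD(7)[OF K]) auto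
  then show ?case
    by (rule rev_bexI) (auto simp: f(2) derivation_add[OF d] derivation_mult[OF d])
qed

lemma linops_conj: "c \<in> K \<Longrightarrow> (\<lambda>x. (\<delta> ^^ k) (c * x)) \<in> linops \<delta> K (Suc k)"
proof -
  assume c: "c \<in> K"
  then obtain f where f: "f \<in> linops \<delta> K k" "\<And>x. (\<delta> ^^ k) (c * x) = c * (\<delta> ^^ k) x + f x"
    using linops_leibniz by blast
  have "(\<lambda>x. f x + c * (\<delta> ^^ k) x) \<in> linops \<delta> K (Suc k)"
    using f(1) c by (intro linops.step linops_mono[OF f(1)]) auto
  then show ?thesis by (simp add: f(2) add.commute)
qed

text \<open>Right division by \<open>x \<mapsto> \<delta> x - c * x\<close>. The leading term is reduced by
  \<open>x\<^sup>(\<^sup>k\<^sup>+\<^sup>1\<^sup>) = (\<delta> x - c x)\<^sup>(\<^sup>k\<^sup>) + (c x)\<^sup>(\<^sup>k\<^sup>)\<close>, where the last summand has order \<open>k\<close>.\<close>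

lemma linops_division:
  assumes c: "c \<in> K"
  shows "f \<in> linops \<delta> K (Suc k) \<Longrightarrow>
    \<exists>q\<in>linops \<delta> K k. \<exists>r\<in>K. \<forall>x. f x = q (\<delta> x - c * x) + r * x"
proof (induction k arbitrary: f)
  case 0
  from linops_top[OF 0 K] obtain g a where "g \<in> linops \<delta> K 0" "a \<in> K" "\<And>x. f x = g x + a * x"
    by auto
  moreover from this(1) have "g = (\<lambda>x. 0)" by cases auto
  ultimately show ?case
    by (intro bexI[of _ "\<lambda>x. 0"] bexI[of _ a]) (auto simp: linops.zero)
next
  case (Suc k)
  from linops_top[OF Suc.prems K] obtain g a where g: "g \<in> linops \<delta> K (Suc k)" "a \<in> K"
    "\<And>x. f x = g x + a * (\<delta> ^^ Suc k) x"
    by blast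
  have "(\<lambda>x. g x + a * (\<delta> ^^ k) (c * x)) \<in> linops \<delta> K (Suc k)"
    by (intro linops_add linops_scale linops_conj g c)
  from Suc.IH[OF this] obtain q r where q: "q \<in> linops \<delta> K k" "r \<in> K"
    "\<And>x. g x + a * (\<delta> ^^ k) (c * x) = q (\<delta> x - c * x) + r * x" by blast
  have "f x = (q (\<delta> x - c * x) + a * (\<delta> ^^ k) (\<delta> x - c * x)) + r * x" for x
  proof -
    have "(\<delta> ^^ Suc k) x = (\<delta> ^^ k) (\<delta> x - c * x) + (\<delta> ^^ k) (c * x)"
      unfolding funpow_Suc_right o_apply by (simp add: derivation_funpow_diff[OF d])
    then have "f x = (g x + a * (\<delta> ^^ k) (c * x)) + a * (\<delta> ^^ k) (\<delta> x - c * x)"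
      by (simp add: g(3) algebra_simps del: funpow.simps)
    then show ?thesis by (simp add: q(3))
  qed
  moreover have "(\<lambda>z. q z + a * (\<delta> ^^ k) z) \<in> linops \<delta> K (Suc k)"
    using q(1) g(2) by (intro linops.step linops_mono[OF q(1)]) auto
  ultimately show ?case using q(2) by (intro bexI[of _ "\<lambda>z. q z + a * (\<delta> ^^ k) z"] bexI[of _ r]) auto
qed

end

lemma single_one_neq_0: "Poly_Mapping.single i (1::'a::zero_neq_one) \<noteq> 0"
  by (metis lookup_single_eq lookup_zero one_neq_zero)

lemma linops_dpoly:
  assumes K: "differential_subfield \<delta> K" and "f \<in> linops \<delta> K k"
  shows "\<exists>g\<in>dpolys K (UNIV :: unit set). (\<forall>x. deval \<delta> g (\<lambda>_. x) = f x) \<and>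
    Poly_Mapping.lookup g (Poly_Mapping.single ((), k) 1) = 0"
  using assms(2)
proof induction
  case zero
  have "0 \<in> dpolys K (UNIV :: unit set)"
    by (auto simp: dpolys_def dvars_def differential_subfieldD[OF K])
  then show ?case by (rule rev_bexI) (auto simp: deval_def)
next
  case (step f a i)
  then obtain g where g: "g \<in> dpolys K UNIV" "\<And>x. deval \<delta> g (\<lambda>_. x) = f x"
    "Poly_Mapping.lookup g (Poly_Mapping.single ((), k) 1) = 0" by blast
  show ?case using step g
    by (intro bexI[of _ "g + Poly_Mapping.single (Poly_Mapping.single ((), i) 1) a"])
       (auto simp: deval_peval peval_add lookup_add lookup_single when_def single_single_eq
         simp del: One_nat_def
         intro!: dpolys_add[OF K] dpolys_single[OF K])
qed

text \<open>Blum's axiom for the equation, which has order \<open>k\<close>, and the inequation \<open>x \<noteq> 0\<close> of order \<open>0\<close>.\<close>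

lemma linear_ode_solvable:
  fixes \<delta> :: "'u::field_char_0 \<Rightarrow> 'u"
  assumes K: "differentially_closed \<delta> K" and d: "derivation \<delta>"
    and f: "f \<in> linops \<delta> K k" and k: "0 < k" and b: "b \<in> K"
  shows "\<exists>x\<in>K. x \<noteq> 0 \<and> (\<delta> ^^ k) x = f x + b"
proof -
  have sub: "differential_subfield \<delta> K" using K by (simp add: differentially_closed_def)
  obtain g where g: "g \<in> dpolys K (UNIV :: unit set)" "\<And>x. deval \<delta> g (\<lambda>_. x) = - f x"
    "Poly_Mapping.lookup g (Poly_Mapping.single ((), k) 1) = 0"
    using linops_dpoly[OF sub linops_uminus[OF sub d f]] by blast
  define X where "X n = (Poly_Mapping.single (Poly_Mapping.single ((), n) 1) 1 :: ('u, unit) dpoly)" for n :: nat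
  have X: "X n \<in> dpolys K UNIV" for n
    unfolding X_def by (rule dpolys_single[OF sub]) (auto simp: differential_subfieldD[OF sub])
  define h where "h = X k + g + Poly_Mapping.single 0 (- b)"
  have h: "h \<in> dpolys K UNIV"
    unfolding h_def using b by (intro dpolys_add[OF sub] X g dpolys_single[OF sub] differential_subfieldD[OF sub]) auto
  have "Poly_Mapping.lookup h (Poly_Mapping.single ((), k) 1) = 1"
    unfolding h_def X_def lookup_add g(3)
    by (simp add: lookup_single_not_eq[OF single_one_neq_0[symmetric]] del: One_nat_def)
  then have "((), k) \<in> dvars h"
    unfolding dvars_def by (intro UN_I[of "Poly_Mapping.single ((), k) 1"]) (auto simp: in_keys_iff)
  then have "int k \<le> dorder h" by (rule dorder_ge)
  moreover have "dorder (X 0) = 0"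
    by (simp add: dorder_def dvars_def X_def)
  moreover have "X 0 \<noteq> 0" unfolding X_def by (rule single_one_neq_0)
  ultimately obtain x where x: "x \<in> K" "deval \<delta> h (\<lambda>_. x) = 0" "deval \<delta> (X 0) (\<lambda>_. x) \<noteq> 0"
    using differentially_closedD[OF K h X, of 0] k by auto
  have "deval \<delta> h (\<lambda>_. x) = (\<delta> ^^ k) x - f x - b"
    using g(2)[of x] unfolding h_def X_def by (simp add: deval_peval peval_add)
  then show ?thesis using x by (intro bexI[of _ x]) (auto simp: X_def deval_peval algebra_simps)
qed

text \<open>A basis of the solutions over the constants whose members lie in \<open>K\<close>, although the solutions
  range over the whole field.\<close>

definition solution_basis :: "('u::field \<Rightarrow> 'u) \<Rightarrow> 'u set \<Rightarrow> ('u \<Rightarrow> 'u) \<Rightarrow> nat \<Rightarrow> (nat \<Rightarrow> 'u) \<Rightarrow> bool" where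
  "solution_basis \<delta> K f k v \<longleftrightarrow> (\<forall>i<k. v i \<in> K \<and> (\<delta> ^^ k) (v i) = f (v i)) \<and>
    (\<forall>c. (\<forall>i. \<delta> (c i) = 0) \<and> (\<Sum>i<k. c i * v i) = 0 \<longrightarrow> (\<forall>i<k. c i = 0)) \<and>
    (\<forall>x. (\<delta> ^^ k) x = f x \<longrightarrow> (\<exists>c. (\<forall>i. \<delta> (c i) = 0) \<and> x = (\<Sum>i<k. c i * v i)))"

lemma solution_basisD:
  assumes "solution_basis \<delta> K f k v"
  shows "i < k \<Longrightarrow> v i \<in> K" "i < k \<Longrightarrow> (\<delta> ^^ k) (v i) = f (v i)"
    "\<forall>i. \<delta> (c i) = 0 \<Longrightarrow> (\<Sum>i<k. c i * v i) = 0 \<Longrightarrow> i < k \<Longrightarrow> c i = 0"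
    "(\<delta> ^^ k) x = f x \<Longrightarrow> \<exists>c. (\<forall>i. \<delta> (c i) = 0) \<and> x = (\<Sum>i<k. c i * v i)"
  using assms unfolding solution_basis_def by simp_all

text \<open>Reduction of order. A nonzero solution \<open>w\<close> in \<open>K\<close> yields a factorisation \<open>M \<circ> T\<close> of the operator
  with \<open>T x = \<delta> x - (\<delta> w / w) * x\<close>. Preimages under \<open>T\<close> of a basis for \<open>M\<close>, together with \<open>w\<close>, form
  a basis, since the kernel of \<open>T\<close> consists of the constant multiples of \<open>w\<close>.\<close>

lemma solution_basis_exists:
  fixes \<delta> :: "'u::field_char_0 \<Rightarrow> 'u"
  assumes K: "differentially_closed \<delta> K" and d: "derivation \<delta>"
  shows "f \<in> linops \<delta> K k \<Longrightarrow> \<exists>v. solution_basis \<delta> K f k v"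
proof (induction k arbitrary: f)
  case 0
  then have "f = (\<lambda>x. 0)" by cases auto
  then show ?case
    using derivation_0[OF d] by (auto simp: solution_basis_def intro!: exI[of _ "\<lambda>_. 0"])
next
  case (Suc k)
  have sub: "differential_subfield \<delta> K" using K by (simp add: differentially_closed_def)
  obtain w where w: "w \<in> K" "w \<noteq> 0" "(\<delta> ^^ Suc k) w = f w"
    using linear_ode_solvable[OF K d Suc.prems _ differential_subfieldD(1)[OF sub]] by auto
  define c where "c = \<delta> w * inverse w"
  have c: "c \<in> K" unfolding c_def using w by (intro differential_subfieldD[OF sub])
  define T where "T x = \<delta> x - c * x" for x
  have Tw: "T w = 0" using w(2) by (simp add: T_def c_def)
  have T_add: "T (x + y) = T x + T y" for x y
    by (simp add: T_def derivation_add[OF d] algebra_simps)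
  have T_kernel: "\<delta> (y * inverse w) = 0" if "T y = 0" for y
  proof -
    have "\<delta> y = \<delta> w * inverse w * y" using that by (simp add: T_def c_def)
    then show ?thesis
      using w(2) by (simp add: derivation_mult[OF d] derivation_inverse[OF d] power2_eq_square)
  qed
  have T_const: "T (e * x) = e * T x" if "\<delta> e = 0" for e x
    by (simp add: T_def derivation_mult[OF d] that algebra_simps)
  have T_sum: "T (\<Sum>i\<in>I. e i * u i) = (\<Sum>i\<in>I. e i * T (u i))" if "\<forall>i. \<delta> (e i) = 0" for e u and I :: "nat set"
    by (induction I rule: infinite_finite_induct)
       (simp_all add: T_add T_const that, simp_all add: T_def derivation_0[OF d])
  \<comment> \<open>right division of the operator by \<open>T\<close>\<close>
  have "(\<lambda>x. (\<delta> ^^ k) (c * x) + - f x) \<in> linops \<delta> K (Suc k)"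
    by (intro linops_add linops_conj[OF sub d c] linops_uminus[OF sub d] Suc.prems)
  from linops_division[OF sub d c this] obtain q r where q: "q \<in> linops \<delta> K k"
    and qr: "\<And>x. (\<delta> ^^ k) (c * x) + - f x = q (T x) + r * x"
    unfolding T_def by blast
  have fact0: "(\<delta> ^^ Suc k) x - f x = (\<delta> ^^ k) (T x) + q (T x) + r * x" for x
  proof -
    have "(\<delta> ^^ Suc k) x = (\<delta> ^^ k) (T x) + (\<delta> ^^ k) (c * x)"
      unfolding funpow_Suc_right o_apply T_def by (simp add: derivation_funpow_diff[OF d])
    then show ?thesis using qr[of x] by (simp add: algebra_simps del: funpow.simps)
  qed
  have "r = 0"
    using fact0[of w] w(2,3) linops_0[OF sub d q] Tw by (simp add: derivation_funpow_0[OF d] del: funpow.simps)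
  then have factor: "(\<delta> ^^ Suc k) x = f x \<longleftrightarrow> (\<delta> ^^ k) (T x) = - q (T x)" for x
    using fact0[of x] by (auto simp: eq_neg_iff_add_eq_0 simp del: funpow.simps)
  from Suc.IH[OF linops_uminus[OF sub d q]] obtain u where
    "solution_basis \<delta> K (\<lambda>x. - q x) k u" by (elim exE)
  note u = solution_basisD[OF this]
  have "\<exists>y\<in>K. T y = u i" if i: "i < k" for i
    using linear_ode_solvable[OF K d linops_monomial[of c K 0 1 \<delta>], of "u i"] c u(1)[OF i]
    by (auto simp: T_def algebra_simps)
  then obtain v where v: "\<And>i. i < k \<Longrightarrow> v i \<in> K" "\<And>i. i < k \<Longrightarrow> T (v i) = u i" by metis
  let ?v = "v(k := w)"
  have basis: "\<forall>i<Suc k. ?v i \<in> K \<and> (\<delta> ^^ Suc k) (?v i) = f (?v i)"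
    using v u w by (auto simp: less_Suc_eq factor simp del: funpow.simps)
  have indep: "\<forall>e. (\<forall>i. \<delta> (e i) = 0) \<and> (\<Sum>i<Suc k. e i * ?v i) = 0 \<longrightarrow> (\<forall>i<Suc k. e i = 0)"
  proof (intro allI impI, elim conjE)
    fix e j assume e: "\<forall>i. \<delta> (e i) = 0" and s: "(\<Sum>i<Suc k. e i * ?v i) = 0" and j: "j < Suc k"
    have "(\<Sum>i<k. e i * ?v i) = (\<Sum>i<k. e i * v i)" by (intro sum.cong) auto
    then have s': "(\<Sum>i<k. e i * v i) + e k * w = 0" using s by simp
    have "(\<Sum>i<k. e i * u i) = T ((\<Sum>i<k. e i * v i) + e k * w)"
      using v(2) e by (simp add: T_add T_sum T_const Tw)
    also have "\<dots> = 0" unfolding s' by (simp add: T_def derivation_0[OF d])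
    finally have "\<forall>i<k. e i = 0" using u(3)[OF e] by simp
    then show "e j = 0" using s' w(2) j by (auto simp: less_Suc_eq)
  qed
  have span: "\<forall>x. (\<delta> ^^ Suc k) x = f x \<longrightarrow> (\<exists>e. (\<forall>i. \<delta> (e i) = 0) \<and> x = (\<Sum>i<Suc k. e i * ?v i))"
  proof (intro allI impI)
    fix x assume "(\<delta> ^^ Suc k) x = f x"
    then have "(\<delta> ^^ k) (T x) = - q (T x)" by (simp only: factor)
    from u(4)[OF this] obtain e where e: "\<forall>i. \<delta> (e i) = 0" "T x = (\<Sum>i<k. e i * u i)" by blast
    let ?y = "x - (\<Sum>i<k. e i * v i)"
    have "T x = T ?y + T (\<Sum>i<k. e i * v i)" by (simp flip: T_add)
    then have "T ?y = 0" using v(2) e by (simp add: T_sum)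
    then have "\<delta> (?y * inverse w) = 0" by (rule T_kernel)
    then have "\<forall>i. \<delta> ((e(k := ?y * inverse w)) i) = 0" using e(1) by simp
    moreover have "(\<Sum>i<k. (e(k := ?y * inverse w)) i * ?v i) = (\<Sum>i<k. e i * v i)"
      by (intro sum.cong) auto
    then have "x = (\<Sum>i<Suc k. (e(k := ?y * inverse w)) i * ?v i)"
      using w(2) by (simp add: mult.assoc)
    ultimately show "\<exists>e. (\<forall>i. \<delta> (e i) = 0) \<and> x = (\<Sum>i<Suc k. e i * ?v i)"
      by (intro exI[of _ "e(k := ?y * inverse w)"] conjI)
  qed
  have "solution_basis \<delta> K f (Suc k) ?v"
    unfolding solution_basis_def by (intro conjI basis indep span)
  then show ?case by (rule exI[of _ ?v])
qed

text \<open>The particular solution is put in position \<open>k\<close>, behind the basis \<open>v 0, \<dots>, v (k - 1)\<close> of the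
  homogeneous equation.\<close>

lemma linear_ode_parametrisation:
  fixes \<delta> :: "'u::field_char_0 \<Rightarrow> 'u"
  assumes K: "differentially_closed \<delta> K" and d: "derivation \<delta>"
    and a: "\<forall>i<k. a i \<in> K" and b: "b \<in> K"
  obtains v where "\<And>i. i \<le> k \<Longrightarrow> v i \<in> K"
    "\<And>c. \<forall>i. \<delta> (c i) = 0 \<Longrightarrow> (\<Sum>i<k. c i * v i) = 0 \<Longrightarrow> (\<forall>i<k. c i = 0)"
    "\<And>x. x \<in> linear_ode_solutions \<delta> k a b \<Longrightarrow>
      \<exists>c. (\<forall>i. \<delta> (c i) = 0) \<and> c k = 1 \<and> x = (\<Sum>i\<le>k. c i * v i)"
proof -
  let ?f = "\<lambda>x. \<Sum>i<k. a i * (\<delta> ^^ i) x"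
  have f: "?f \<in> linops \<delta> K k" by (intro linops_sum) (use a in auto)
  have f_diff: "?f (x - y) = ?f x - ?f y" for x y
    by (simp add: derivation_funpow_diff[OF d] algebra_simps sum_subtractf)
  have "\<exists>p\<in>K. (\<delta> ^^ k) p = ?f p + b"
  proof (cases k)
    case 0
    then show ?thesis using b by (intro bexI[of _ b]) auto
  next
    case (Suc j)
    then show ?thesis using linear_ode_solvable[OF K d f _ b] by blast
  qed
  then obtain p where p: "p \<in> K" "(\<delta> ^^ k) p = ?f p + b" by blast
  obtain v where "solution_basis \<delta> K ?f k v"
    using solution_basis_exists[OF K d f] by (elim exE)
  note v = solution_basisD[OF this]
  let ?v = "v(k := p)"
  show ?thesis
  proof (rule that)
    show "?v i \<in> K" if "i \<le> k" for i using that p(1) v(1) by auto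
  next
    fix c :: "nat \<Rightarrow> 'u" assume c: "\<forall>i. \<delta> (c i) = 0" and s: "(\<Sum>i<k. c i * ?v i) = 0"
    have "(\<Sum>i<k. c i * ?v i) = (\<Sum>i<k. c i * v i)" by (intro sum.cong) auto
    then show "\<forall>i<k. c i = 0" using v(3)[OF c] s by simp
  next
    fix x assume "x \<in> linear_ode_solutions \<delta> k a b"
    then have "(\<delta> ^^ k) (x - p) = ?f x - ?f p"
      unfolding linear_ode_solutions_def derivation_funpow_diff[OF d] p(2) by simp
    then have "(\<delta> ^^ k) (x - p) = ?f (x - p)" by (simp only: f_diff)
    from v(4)[OF this] obtain c where c: "\<forall>i. \<delta> (c i) = 0" "x - p = (\<Sum>i<k. c i * v i)" by blast
    show "\<exists>c. (\<forall>i. \<delta> (c i) = 0) \<and> c k = 1 \<and> x = (\<Sum>i\<le>k. c i * ?v i)"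
    proof (intro exI[of _ "c(k := 1)"] conjI allI)
      have "(\<Sum>i<k. (c(k := 1)) i * ?v i) = (\<Sum>i<k. c i * v i)" by (intro sum.cong) auto
      then have "(\<Sum>i\<le>k. (c(k := 1)) i * ?v i) = (\<Sum>i<k. c i * v i) + p"
        by (simp add: lessThan_Suc_atMost[symmetric])
      then show "x = (\<Sum>i\<le>k. (c(k := 1)) i * ?v i)" using c(2) by (simp add: algebra_simps)
    qed (use c(1) derivation_1[OF d] in auto)
  qed
qed

section \<open>Linear algebra\<close>

lemma underdetermined_kernel:
  fixes M :: "'s \<Rightarrow> 'b \<Rightarrow> 'u::field"
  assumes "finite S"
  shows "finite B \<Longrightarrow> card S < card B \<Longrightarrow>
    \<exists>u. (\<exists>b\<in>B. u b \<noteq> 0) \<and> (\<forall>s\<in>S. (\<Sum>b\<in>B. M s b * u b) = 0)"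
  using assms
proof (induction S arbitrary: B M)
  case empty
  then obtain b where "b \<in> B" by fastforce
  then show ?case by (intro exI[of _ "\<lambda>_. 1"]) auto
next
  case (insert s S)
  show ?case
  proof (cases "\<forall>b\<in>B. M s b = 0")
    case True
    obtain u where u: "\<exists>b\<in>B. u b \<noteq> 0" "\<forall>r\<in>S. (\<Sum>b\<in>B. M r b * u b) = 0"
      using insert.IH[of B M] insert.prems insert.hyps by (auto simp: card_insert_if)
    then show ?thesis using True by (intro exI[of _ u]) auto
  next
    case False
    then obtain b0 where b0: "b0 \<in> B" "M s b0 \<noteq> 0" by blast
    let ?B = "B - {b0}"
    define M' where "M' r b = M r b - M r b0 * M s b / M s b0" for r b
    have card: "card S < card ?B"
      using insert.prems insert.hyps b0 by (simp add: card_insert_if)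
    obtain u where u: "\<exists>b\<in>?B. u b \<noteq> 0" and ker: "\<forall>r\<in>S. (\<Sum>b\<in>?B. M' r b * u b) = 0"
      using insert.IH[OF _ card, of M'] insert.prems(1) by auto
    define u' where "u' = u(b0 := - (\<Sum>b\<in>?B. M s b * u b) / M s b0)"
    have sum: "(\<Sum>b\<in>B. M r b * u' b) = (\<Sum>b\<in>?B. M' r b * u b)" for r
    proof -
      have "(\<Sum>b\<in>B. M r b * u' b) = M r b0 * u' b0 + (\<Sum>b\<in>?B. M r b * u' b)"
        using insert.prems(1) b0(1) by (simp add: sum.remove)
      also have "(\<Sum>b\<in>?B. M r b * u' b) = (\<Sum>b\<in>?B. M r b * u b)"
        by (intro sum.cong) (auto simp: u'_def)
      finally show ?thesis
        by (simp add: u'_def M'_def algebra_simps sum_subtractf sum_distrib_left sum_divide_distrib)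
    qed
    have "(\<Sum>b\<in>?B. M' s b * u b) = 0" using b0(2) by (simp add: M'_def)
    then have "\<forall>r\<in>insert s S. (\<Sum>b\<in>B. M r b * u' b) = 0" using ker by (simp add: sum)
    moreover have "\<exists>b\<in>B. u' b \<noteq> 0" using u by (auto simp: u'_def)
    ultimately show ?thesis by blast
  qed
qed

text \<open>A possibly infinite system of linear equations in finitely many unknowns has a nontrivial
  solution, or a square subsystem has only the trivial one. Gaussian elimination: a row with
  nonzero entry in column \<open>a\<close> serves as pivot, and the system with that column eliminated is treated
  by induction.\<close>

lemma kernel_or_nonsingular_minor:
  fixes v :: "'r \<Rightarrow> 'a \<Rightarrow> 'u::field"
  assumes "finite A"
  shows "(\<exists>w. (\<exists>\<alpha>\<in>A. w \<alpha> \<noteq> 0) \<and> (\<forall>r\<in>R. (\<Sum>\<alpha>\<in>A. v r \<alpha> * w \<alpha>) = 0)) \<or>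
    (\<exists>\<rho>. \<rho> ` A \<subseteq> R \<and> (\<forall>w. (\<forall>\<alpha>\<in>A. (\<Sum>\<beta>\<in>A. v (\<rho> \<alpha>) \<beta> * w \<beta>) = 0) \<longrightarrow> (\<forall>\<alpha>\<in>A. w \<alpha> = 0)))"
  using assms
proof (induction A arbitrary: v)
  case (insert a A)
  show ?case
  proof (cases "\<forall>r\<in>R. v r a = 0")
    case True
    have "\<forall>r\<in>R. (\<Sum>\<alpha>\<in>insert a A. v r \<alpha> * (if \<alpha> = a then 1 else 0)) = 0"
      using True insert.hyps by (auto intro!: sum.neutral)
    then show ?thesis by (intro disjI1 exI[of _ "\<lambda>\<alpha>. if \<alpha> = a then 1 else 0"]) auto
  next
    case False
    then obtain r0 where r0: "r0 \<in> R" "v r0 a \<noteq> 0" by blast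
    define v' where "v' r \<alpha> = v r \<alpha> - v r a / v r0 a * v r0 \<alpha>" for r \<alpha>
    have elim: "(\<Sum>\<alpha>\<in>A. v' r \<alpha> * w \<alpha>) = (\<Sum>\<alpha>\<in>insert a A. v r \<alpha> * w \<alpha>) -
        v r a / v r0 a * (\<Sum>\<alpha>\<in>insert a A. v r0 \<alpha> * w \<alpha>)" for r w
      using insert.hyps r0(2)
      by (simp add: v'_def algebra_simps sum_subtractf sum_distrib_left)
    from insert.IH[of v'] show ?thesis
    proof (elim disjE exE conjE)
      fix w assume w: "\<exists>\<alpha>\<in>A. w \<alpha> \<noteq> 0" "\<forall>r\<in>R. (\<Sum>\<alpha>\<in>A. v' r \<alpha> * w \<alpha>) = 0"
      define w' where "w' = w(a := - (\<Sum>\<alpha>\<in>A. v r0 \<alpha> * w \<alpha>) / v r0 a)"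
      have w'_eq: "(\<Sum>\<alpha>\<in>A. x \<alpha> * w' \<alpha>) = (\<Sum>\<alpha>\<in>A. x \<alpha> * w \<alpha>)" for x
        using insert.hyps by (intro sum.cong) (auto simp: w'_def)
      have w'_a: "w' a = - (\<Sum>\<alpha>\<in>A. v r0 \<alpha> * w \<alpha>) / v r0 a" by (simp add: w'_def)
      have z: "(\<Sum>\<alpha>\<in>insert a A. v r0 \<alpha> * w' \<alpha>) = 0"
        using insert.hyps r0(2) by (simp add: w'_eq w'_a)
      have "(\<Sum>\<alpha>\<in>insert a A. v r \<alpha> * w' \<alpha>) = 0" if "r \<in> R" for r
        using elim[of r w'] that w(2) unfolding z w'_eq by simp
      moreover have "\<exists>\<alpha>\<in>insert a A. w' \<alpha> \<noteq> 0"
        using w(1) insert.hyps by (auto simp: w'_def)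
      ultimately show ?thesis by (intro disjI1 exI[of _ w']) auto
    next
      fix \<rho> assume \<rho>: "\<rho> ` A \<subseteq> R"
        "\<forall>w. (\<forall>\<alpha>\<in>A. (\<Sum>\<beta>\<in>A. v' (\<rho> \<alpha>) \<beta> * w \<beta>) = 0) \<longrightarrow> (\<forall>\<alpha>\<in>A. w \<alpha> = 0)"
      let ?\<rho> = "\<rho>(a := r0)"
      have "\<forall>\<alpha>\<in>insert a A. w \<alpha> = 0"
        if w: "\<forall>\<alpha>\<in>insert a A. (\<Sum>\<beta>\<in>insert a A. v (?\<rho> \<alpha>) \<beta> * w \<beta>) = 0" for w
      proof -
        have a: "(\<Sum>\<beta>\<in>insert a A. v r0 \<beta> * w \<beta>) = 0" using bspec[OF w, of a] by simp
        have "(\<Sum>\<beta>\<in>A. v' (\<rho> \<alpha>) \<beta> * w \<beta>) = 0" if "\<alpha> \<in> A" for \<alpha>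
          using bspec[OF w, of \<alpha>] that insert.hyps(2) unfolding elim a by (cases "\<alpha> = a") auto
        then have A: "\<forall>\<alpha>\<in>A. w \<alpha> = 0" using \<rho>(2) by simp
        then show ?thesis using a insert.hyps r0(2) by simp
      qed
      moreover have "?\<rho> ` insert a A \<subseteq> R" using \<rho>(1) r0(1) by auto
      ultimately show ?thesis by (intro disjI2 exI[of _ ?\<rho>]) auto
    qed
  qed
qed auto

section \<open>The field of constants\<close>

lemma constant_derivation_poly:
  assumes d: "derivation \<delta>" and "\<And>i. \<delta> (coeff p i) = 0"
  shows "\<delta> (poly p x) = poly (pderiv p) x * \<delta> x"
  using assms(2)
proof (induction p)
  case (pCons a p)
  have "\<delta> a = 0" using pCons.prems[of 0] by simp
  moreover have "\<delta> (poly p x) = poly (pderiv p) x * \<delta> x"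
    using pCons.IH pCons.prems[of "Suc _"] by simp
  ultimately show ?case
    by (simp add: pderiv_pCons derivation_add[OF d] derivation_mult[OF d] algebra_simps)
qed (simp add: derivation_0[OF d])

text \<open>For a polynomial \<open>p\<close> with constant coefficients of least degree among those with root \<open>x\<close>, the derivative \<open>p'(x)\<close> is nonzero, while
  \<open>0 = \<delta> (p(x)) = p'(x) * \<delta> x\<close>.\<close>

lemma algebraic_over_constants:
  fixes p :: "'u::field_char_0 poly"
  assumes d: "derivation \<delta>" and "p \<noteq> 0" "\<And>i. \<delta> (coeff p i) = 0" "poly p x = 0"
  shows "\<delta> x = 0"
  using assms(2-)
proof (induction "degree p" arbitrary: p rule: less_induct)
  case less
  have "degree p \<noteq> 0"
  proof
    assume "degree p = 0"
    then obtain c where "p = [:c:]" by (rule degree_eq_zeroE)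
    then show False using less.prems by auto
  qed
  then have "pderiv p \<noteq> 0" by (simp add: pderiv_eq_0_iff)
  have const: "\<delta> (coeff (pderiv p) i) = 0" for i
    using less.prems(2) derivation_of_nat[OF d, of "Suc i"]
    by (simp add: coeff_pderiv derivation_mult[OF d] del: of_nat_Suc)
  show ?case
  proof (cases "poly (pderiv p) x = 0")
    case True
    then show ?thesis
      using less.hyps[of "pderiv p"] \<open>pderiv p \<noteq> 0\<close> const \<open>degree p \<noteq> 0\<close> by (simp add: degree_pderiv)
  next
    case False
    then show ?thesis
      using constant_derivation_poly[OF d less.prems(2), of x] less.prems(3) derivation_0[OF d] by simp
  qed
qed

lemma constants_algebraically_closed:
  fixes p :: "'u::field_char_0 poly"
  assumes U: "differentially_closed \<delta> (UNIV :: 'u set)" and d: "derivation \<delta>"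
    and const: "\<And>i. \<delta> (coeff p i) = 0" and deg: "degree p \<noteq> 0"
  shows "\<exists>a. \<delta> a = 0 \<and> poly p a = 0"
proof -
  have sub: "differential_subfield \<delta> (UNIV :: 'u set)"
    using U by (simp add: differentially_closed_def)
  have "(\<lambda>x. \<Sum>i\<le>degree p. coeff p i * x () ^ i) \<in> dfuns \<delta> UNIV (UNIV :: unit set)"
    by (intro dfuns_sum[OF sub] dfuns.mult dfuns.const dfuns_power[OF sub] dfuns_var[OF sub]) auto
  then obtain f where f: "f \<in> dpolys UNIV UNIV" "\<And>x. deval \<delta> f x = poly p (x ())"
    unfolding dfuns_eq[OF sub] by (auto simp: fun_eq_iff poly_altdef)
  have "dvars f \<noteq> {}"
  proof
    assume "dvars f = {}"
    then have "\<forall>m\<in>Poly_Mapping.keys f. Poly_Mapping.keys m = {}" by (simp add: dvars_def)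
    then have "deval \<delta> f (\<lambda>_. a) = deval \<delta> f (\<lambda>_. 0)" for a
      unfolding deval_def by (intro sum.cong) auto
    then have "\<forall>a. poly (p - [:poly p 0:]) a = 0" using f(2) by simp
    then have "p - [:poly p 0:] = 0" using poly_all_0_iff_0 by blast
    then have "p = [:poly p 0:]" by simp
    then show False using deg by (metis degree_pCons_0)
  qed
  then have "0 \<le> dorder f" using dorder_ge[of _ f] by (metis (full_types) all_not_in_conv old.unit.exhaust prod.exhaust of_nat_0_le_iff order_trans)
  moreover have "dorder (1 :: ('u, unit) dpoly) = - 1" by (simp add: dorder_def dvars_def)
  moreover have "1 \<in> dpolys (UNIV :: 'u set) (UNIV :: unit set)" by (simp add: dpolys_def)
  ultimately obtain a where "deval \<delta> f (\<lambda>_. a) = 0"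
    using differentially_closedD[OF U f(1), of 1] by auto
  then have a: "poly p a = 0" using f(2) by simp
  then have "\<delta> a = 0" using algebraic_over_constants[OF d _ const a] deg by (cases "p = 0") auto
  then show ?thesis using a by blast
qed

text \<open>If the constants were countable, saturation would realise the type of a constant that differs
  from every constant; it is finitely satisfiable since there are infinitely many constants.\<close>

lemma constants_uncountable:
  fixes \<delta> :: "'u::field_char_0 \<Rightarrow> 'u" and F :: "'a set"
  assumes d: "derivation \<delta>" and sat: "saturated \<delta>"
    and F: "infinite F" "|F| <o |UNIV :: 'u set|"
  shows "uncountable {a. \<delta> a = 0}"
proof
  let ?C = "{a. \<delta> a = 0}"
  assume "countable ?C"
  then have "|?C| \<le>o |UNIV :: nat set|" by (auto simp: countable_def card_of_ordLeq[symmetric])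
  also have "|UNIV :: nat set| \<le>o |F|" using F(1) by (simp add: infinite_iff_card_of_nat)
  finally have small: "|?C| <o |UNIV :: 'u set|" using F(2) by (rule ordLeq_ordLess_trans)
  have inf: "infinite ?C"
  proof
    assume "finite ?C"
    then have "finite (range (of_nat :: nat \<Rightarrow> 'u))"
      by (rule finite_subset[rotated]) (auto simp: derivation_of_nat[OF d])
    moreover have "inj (of_nat :: nat \<Rightarrow> 'u)" by (rule inj_onI) simp
    ultimately have "finite (UNIV :: nat set)" by (rule finite_imageD)
    then show False by simp
  qed
  define \<Phi> where "\<Phi> = insert (FEq (TDeriv (TVar 0)) TZero) ((\<lambda>c. FNot (FEq (TVar 0) (TParam c))) ` ?C)"
  have \<Phi>_cases: "\<phi> = FEq (TDeriv (TVar 0)) TZero \<or> (\<exists>c\<in>?C. \<phi> = FNot (FEq (TVar 0) (TParam c)))"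
    if "\<phi> \<in> \<Phi>" for \<phi>
    using that unfolding \<Phi>_def by auto
  have params: "\<forall>\<phi>\<in>\<Phi>. fm_params \<phi> \<subseteq> ?C \<and> fm_free \<phi> \<subseteq> {0}"
    using \<Phi>_cases by fastforce
  have fin_sat: "\<forall>\<Psi>. finite \<Psi> \<and> \<Psi> \<subseteq> \<Phi> \<longrightarrow> (\<exists>a. \<forall>\<phi>\<in>\<Psi>. fm_sat \<delta> (\<lambda>_. a) \<phi>)"
  proof (intro allI impI, elim conjE)
    fix \<Psi> assume \<Psi>: "finite \<Psi>" "\<Psi> \<subseteq> \<Phi>"
    let ?B = "\<Union>(fm_params ` \<Psi>)"
    have "finite ?B"
    proof (rule finite_UN_I[OF \<Psi>(1)])
      fix \<phi> assume "\<phi> \<in> \<Psi>"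
      then have "\<phi> \<in> \<Phi>" using \<Psi>(2) by (rule subsetD[rotated])
      from \<Phi>_cases[OF this] show "finite (fm_params \<phi>)" by auto
    qed
    then have "infinite (?C - ?B)" using inf by (rule Diff_infinite_finite)
    then have "?C - ?B \<noteq> {}" by (rule infinite_imp_nonempty)
    then obtain a where a: "a \<in> ?C" "a \<notin> ?B" by auto
    have "fm_sat \<delta> (\<lambda>_. a) \<phi>" if "\<phi> \<in> \<Psi>" for \<phi>
    proof -
      have "\<phi> \<in> \<Phi>" using that \<Psi>(2) by (rule subsetD[rotated])
      moreover have "a \<notin> fm_params \<phi>" using that a(2) by simp
      ultimately show ?thesis using \<Phi>_cases[of \<phi>] a(1) by auto
    qed
    then show "\<exists>a. \<forall>\<phi>\<in>\<Psi>. fm_sat \<delta> (\<lambda>_. a) \<phi>" by (intro exI[of _ a] ballI)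
  qed
  from sat[unfolded saturated_def, THEN spec, THEN spec, THEN mp, OF small, THEN mp, OF params,
    THEN mp, OF fin_sat]
  show False unfolding \<Phi>_def by auto
qed

section \<open>Differential ideals of polynomials in constant indeterminates\<close>

text \<open>The derivation of the polynomial ring that extends \<open>\<delta>\<close> and treats the indeterminates as
  constants.\<close>

definition cderiv :: "('u::zero \<Rightarrow> 'u) \<Rightarrow> ('v, 'u) mpoly \<Rightarrow> ('v, 'u) mpoly" where
  "cderiv \<delta> P = Poly_Mapping.map \<delta> P"

lemma lookup_cderiv: "\<delta> 0 = 0 \<Longrightarrow> Poly_Mapping.lookup (cderiv \<delta> P) m = \<delta> (Poly_Mapping.lookup P m)"
  by (simp add: cderiv_def map.rep_eq when_def)

lemma cderiv_add: "derivation \<delta> \<Longrightarrow> cderiv \<delta> (P + Q) = cderiv \<delta> P + cderiv \<delta> Q"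
  by (rule poly_mapping_eqI) (simp add: lookup_cderiv derivation_0 lookup_add derivation_add)

lemma cderiv_0: "derivation \<delta> \<Longrightarrow> cderiv \<delta> 0 = 0"
  by (rule poly_mapping_eqI) (simp add: lookup_cderiv derivation_0)

lemma cderiv_single: "derivation \<delta> \<Longrightarrow> cderiv \<delta> (Poly_Mapping.single m c) = Poly_Mapping.single m (\<delta> c)"
  by (rule poly_mapping_eqI) (simp add: lookup_cderiv derivation_0 lookup_single when_def)

lemma cderiv_mult:
  assumes d: "derivation \<delta>"
  shows "cderiv \<delta> (P * Q) = cderiv \<delta> P * Q + P * cderiv \<delta> Q"
proof (induction P rule: poly_mapping_add_induct)
  case (single m c)
  show ?case
    by (induction Q rule: poly_mapping_add_induct)
       (simp_all add: cderiv_0[OF d] cderiv_single[OF d] cderiv_add[OF d] mult_single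
         derivation_mult[OF d] single_add algebra_simps)
qed (simp_all add: cderiv_0[OF d] cderiv_add[OF d] algebra_simps)

lemma cderiv_diff: "derivation \<delta> \<Longrightarrow> cderiv \<delta> (P - Q) = cderiv \<delta> P - cderiv \<delta> Q"
  by (rule poly_mapping_eqI) (simp add: lookup_cderiv derivation_0 lookup_minus derivation_diff)

lemma cderiv_sum: "derivation \<delta> \<Longrightarrow> cderiv \<delta> (\<Sum>i\<in>I. f i) = (\<Sum>i\<in>I. cderiv \<delta> (f i))"
  by (induction I rule: infinite_finite_induct) (simp_all add: cderiv_0 cderiv_add)

lemma cderiv_power_const: "derivation \<delta> \<Longrightarrow> cderiv \<delta> s = 0 \<Longrightarrow> cderiv \<delta> (s ^ n) = 0"
proof (induction n)
  case 0
  then show ?case using cderiv_single[of \<delta> 0 1] by (simp add: derivation_1)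
qed (simp add: cderiv_mult)

lemma peval_cderiv:
  assumes d: "derivation \<delta>" and z: "\<And>v. \<delta> (z v) = 0"
  shows "peval (cderiv \<delta> P) z = \<delta> (peval P z)"
proof -
  have prod: "\<delta> (\<Prod>v\<in>S. z v ^ e v) = 0" for S and e :: "_ \<Rightarrow> nat"
    by (induction S rule: infinite_finite_induct)
       (simp_all add: derivation_1[OF d] derivation_mult[OF d] derivation_power_const[OF d z])
  have "\<delta> (mval m z) = 0" for m unfolding mval_def by (rule prod)
  then show ?thesis
    by (induction P rule: poly_mapping_add_induct)
       (simp_all add: cderiv_0[OF d] cderiv_single[OF d] cderiv_add[OF d] derivation_0[OF d]
         derivation_add[OF d] derivation_mult[OF d] peval_add)
qed

lemma peval_cderiv_funpow:
  assumes "derivation \<delta>" "\<And>v. \<delta> (z v) = 0"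
  shows "peval ((cderiv \<delta> ^^ l) P) z = (\<delta> ^^ l) (peval P z)"
  by (induction l) (simp_all add: peval_cderiv[OF assms])

lemma keys_cderiv_funpow:
  fixes P :: "('v, 'u::field) mpoly"
  shows "derivation \<delta> \<Longrightarrow> Poly_Mapping.keys ((cderiv \<delta> ^^ l) P) \<subseteq> Poly_Mapping.keys P"
proof (induction l)
  case (Suc l)
  have "Poly_Mapping.keys (cderiv \<delta> Q) \<subseteq> Poly_Mapping.keys Q" for Q :: "('v, 'u) mpoly"
    using Suc.prems by (auto simp: in_keys_iff lookup_cderiv derivation_0)
  from this[of "(cderiv \<delta> ^^ l) P"] show ?case using Suc by simp
qed simp

abbreviation cst :: "'u::zero \<Rightarrow> ('v, 'u) mpoly" where
  "cst c \<equiv> Poly_Mapping.single 0 c"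

lemma lookup_cst_mult: "Poly_Mapping.lookup (cst c * P) m = c * Poly_Mapping.lookup P (m :: 'v \<Rightarrow>\<^sub>0 nat)"
  for c :: "'u::comm_semiring_1"
  by (simp add: mult_map_scale_conv_mult[symmetric] map.rep_eq when_def)

definition is_ideal :: "'r::comm_ring_1 set \<Rightarrow> bool" where
  "is_ideal J \<longleftrightarrow> 0 \<in> J \<and> (\<forall>x\<in>J. \<forall>y\<in>J. x + y \<in> J) \<and> (\<forall>r. \<forall>x\<in>J. r * x \<in> J)"

lemma is_idealD:
  assumes "is_ideal J"
  shows "0 \<in> J" "x \<in> J \<Longrightarrow> y \<in> J \<Longrightarrow> x + y \<in> J" "x \<in> J \<Longrightarrow> r * x \<in> J" "x \<in> J \<Longrightarrow> x * r \<in> J"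
    "x \<in> J \<Longrightarrow> y \<in> J \<Longrightarrow> x - y \<in> J"
proof -
  show a: "x \<in> J \<Longrightarrow> y \<in> J \<Longrightarrow> x + y \<in> J" and m: "x \<in> J \<Longrightarrow> r * x \<in> J" for x y r
    using assms by (simp_all add: is_ideal_def)
  show "0 \<in> J" using assms by (simp add: is_ideal_def)
  show "x \<in> J \<Longrightarrow> x * r \<in> J" using m[of x r] by (simp add: mult.commute)
  show "x \<in> J \<Longrightarrow> y \<in> J \<Longrightarrow> x - y \<in> J" using a[of x "-1 * y"] m[of y "-1"] by simp
qed

lemma is_ideal_sum: "is_ideal J \<Longrightarrow> (\<And>i. i \<in> I \<Longrightarrow> f i \<in> J) \<Longrightarrow> (\<Sum>i\<in>I. f i) \<in> J"
  by (induction I rule: infinite_finite_induct) (auto intro: is_idealD)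

lemma ideal_cong_mult:
  assumes J: "is_ideal J" and "x - y \<in> J" "x' - y' \<in> J"
  shows "x * x' - y * y' \<in> J"
proof -
  have "x * x' - y * y' = x' * (x - y) + y * (x' - y')" by (simp add: algebra_simps)
  then show ?thesis using assms by (auto intro: is_idealD)
qed

lemma ideal_cong_power: "is_ideal J \<Longrightarrow> x - y \<in> J \<Longrightarrow> x ^ n - y ^ n \<in> J"
  by (induction n) (auto intro: ideal_cong_mult is_idealD)

lemma ideal_cong_prod: "is_ideal J \<Longrightarrow> (\<And>i. i \<in> I \<Longrightarrow> x i - y i \<in> J) \<Longrightarrow> (\<Prod>i\<in>I. x i) - (\<Prod>i\<in>I. y i) \<in> J"
  by (induction I rule: infinite_finite_induct) (auto intro: ideal_cong_mult is_idealD)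

text \<open>The value \<open>s\<^sup>e * p (t / s)\<close>, written without denominators.\<close>

definition hom_poly :: "nat \<Rightarrow> 'u::comm_ring_1 poly \<Rightarrow> ('v, 'u) mpoly \<Rightarrow> ('v, 'u) mpoly \<Rightarrow> ('v, 'u) mpoly" where
  "hom_poly e p t s = (\<Sum>i\<le>e. cst (coeff p i) * t ^ i * s ^ (e - i))"

lemma hom_poly_add: "hom_poly e (p + q) t s = hom_poly e p t s + hom_poly e q t s"
  by (simp add: hom_poly_def single_add algebra_simps sum.distrib)

lemma hom_poly_0: "hom_poly e 0 t s = 0"
  by (simp add: hom_poly_def)

lemma hom_poly_smult:
  fixes p :: "'u::comm_ring_1 poly" and t :: "('v, 'u) mpoly"
  shows "hom_poly e (smult a p) t s = cst a * hom_poly e p t s"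
proof -
  have "cst (a * b) = (cst a * cst b :: ('v, 'u) mpoly)" for b :: 'u by (simp add: mult_single)
  then show ?thesis by (simp add: hom_poly_def sum_distrib_left mult.assoc)
qed

lemma hom_poly_1: "hom_poly e 1 t s = s ^ e"
proof -
  have "hom_poly e 1 t s = (\<Sum>i\<in>{0}. cst (coeff 1 i) * t ^ i * s ^ (e - i))"
    unfolding hom_poly_def by (intro sum.mono_neutral_right) (auto simp: coeff_eq_0)
  then show ?thesis by simp
qed

lemma hom_poly_linear:
  assumes "degree p \<le> e"
  shows "hom_poly (Suc e) ([:- a, 1:] * p) t s = (t - cst a * s) * hom_poly e p t s"
proof -
  have 1: "hom_poly (Suc e) (pCons 0 p) t s = t * hom_poly e p t s"
    unfolding hom_poly_def
    by (simp add: sum.atMost_Suc_shift sum_distrib_left mult_ac del: sum.atMost_Suc)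
  have "coeff p (Suc e) = 0" using assms by (simp add: coeff_eq_0)
  then have 2: "hom_poly (Suc e) p t s = s * hom_poly e p t s"
    unfolding hom_poly_def by (simp add: sum_distrib_left Suc_diff_le mult_ac)
  have "[:- a, 1:] * p = smult (- a) p + pCons 0 p" by simp
  then show ?thesis
    by (simp only: hom_poly_add hom_poly_smult 1 2) (simp add: single_uminus algebra_simps)
qed

lemma hom_poly_prod_linear:
  fixes B :: "'u::idom set" and t :: "('v, 'u) mpoly"
  shows "finite B \<Longrightarrow> hom_poly (card B) (\<Prod>b\<in>B. [:- b, 1:]) t s = (\<Prod>b\<in>B. t - cst b * s)"
proof (induction B rule: finite_induct)
  case empty
  then show ?case using hom_poly_1[of 0] by simp
next
  case (insert b B)
  have "degree (\<Prod>b\<in>B. [:- b, 1:]) \<le> (\<Sum>b\<in>B. degree [:- b, 1:])" 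
    using degree_prod_sum_le[OF insert.hyps(1), of "\<lambda>b. [:- b, 1:]"] by (simp add: o_def)
  then have "degree (\<Prod>b\<in>B. [:- b, 1:]) \<le> card B" by simp
  from hom_poly_linear[OF this, of b t s] insert show ?case by (simp del: mult_pCons_left)
qed

lemma cderiv_hom_poly:
  assumes d: "derivation \<delta>" and "cderiv \<delta> s = 0" "cderiv \<delta> t = 0"
  shows "cderiv \<delta> (hom_poly e p t s) = hom_poly e (map_poly \<delta> p) t s"
  unfolding hom_poly_def
  by (simp add: cderiv_sum[OF d] cderiv_mult[OF d] cderiv_single[OF d] coeff_map_poly derivation_0[OF d]
    cderiv_power_const[OF d] assms)

definition monomials :: "nat \<Rightarrow> nat \<Rightarrow> (nat \<Rightarrow>\<^sub>0 nat) set" where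
  "monomials n N = {m. Poly_Mapping.keys m \<subseteq> {..<n} \<and> (\<Sum>i<n. Poly_Mapping.lookup m i) = N}"

lemma finite_monomials: "finite (monomials n N)"
proof -
  let ?f = "\<lambda>m. map (Poly_Mapping.lookup m) [0..<n]"
  have "?f ` monomials n N \<subseteq> {xs. set xs \<subseteq> {..N} \<and> length xs = n}"
  proof safe
    fix m x assume m: "m \<in> monomials n N" and "x \<in> set (?f m)"
    then obtain i where i: "i < n" "x = Poly_Mapping.lookup m i" by auto
    have "Poly_Mapping.lookup m i \<le> (\<Sum>i<n. Poly_Mapping.lookup m i)"
      using i by (intro member_le_sum) auto
    then show "x \<le> N" using m i by (simp add: monomials_def)
  qed simp
  then have "finite (?f ` monomials n N)" by (rule finite_subset) (simp add: finite_lists_length_eq)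
  moreover have "inj_on ?f (monomials n N)"
  proof (rule inj_onI, rule poly_mapping_eqI)
    fix m m' k assume m: "m \<in> monomials n N" "m' \<in> monomials n N" and eq: "?f m = ?f m'"
    show "Poly_Mapping.lookup m k = Poly_Mapping.lookup m' k"
    proof (cases "k < n")
      case True
      then show ?thesis using eq by simp
    next
      case False
      then have "k \<notin> Poly_Mapping.keys m" "k \<notin> Poly_Mapping.keys m'" using m by (auto simp: monomials_def)
      then show ?thesis by (simp add: in_keys_iff)
    qed
  qed
  ultimately show ?thesis by (rule finite_imageD)
qed

lemma countable_exponents: "countable (UNIV :: (nat \<Rightarrow>\<^sub>0 nat) set)"
proof -
  have "\<exists>n. Poly_Mapping.keys m \<subseteq> {..<n}" for m :: "nat \<Rightarrow>\<^sub>0 nat"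
    using finite_nat_iff_bounded[of "Poly_Mapping.keys m"] by simp
  then have "\<exists>n N. m \<in> monomials n N" for m :: "nat \<Rightarrow>\<^sub>0 nat"
    unfolding monomials_def by simp
  then have "(UNIV :: (nat \<Rightarrow>\<^sub>0 nat) set) = (\<Union>n. \<Union>N. monomials n N)"
    by (simp add: set_eq_iff)
  also have "countable \<dots>" by (intro countable_UN[OF countableI_type] countable_finite finite_monomials)
  finally show ?thesis .
qed

lemma uncountable_infinite_fibre:
  assumes "uncountable A" "countable (f ` A)"
  obtains y where "infinite {a \<in> A. f a = y}"
proof (rule ccontr)
  assume "\<not> thesis"
  then have fin: "finite {a \<in> A. f a = y}" for y using that by blast
  have "A = (\<Union>y\<in>f ` A. {a \<in> A. f a = y})" by auto
  also have "countable \<dots>" by (intro countable_UN assms(2) countable_finite fin)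
  finally show False using assms(1) by simp
qed

definition adjoin :: "'r::comm_ring_1 set \<Rightarrow> 'r \<Rightarrow> 'r set" where
  "adjoin J x = {j + r * x | j r. j \<in> J}"

lemma adjoinI: "j \<in> J \<Longrightarrow> j + r * x \<in> adjoin J x"
  unfolding adjoin_def by auto

lemma adjoin_iff: "a \<in> adjoin J x \<longleftrightarrow> (\<exists>r. a - r * x \<in> J)"
proof
  assume "a \<in> adjoin J x"
  then obtain j r where "j \<in> J" "a = j + r * x" unfolding adjoin_def by auto
  then show "\<exists>r. a - r * x \<in> J" by (intro exI[of _ r]) simp
next
  assume "\<exists>r. a - r * x \<in> J"
  then obtain r where "a - r * x \<in> J" ..
  from adjoinI[OF this, of r x] show "a \<in> adjoin J x" by simp
qed

lemma adjoin_ideal: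
  assumes "is_ideal J"
  shows "is_ideal (adjoin J x)"
  unfolding is_ideal_def
proof (intro conjI ballI allI)
  show "0 \<in> adjoin J x" using adjoinI[OF is_idealD(1)[OF assms], of 0 x] by simp
next
  fix a b assume "a \<in> adjoin J x" "b \<in> adjoin J x"
  then obtain j r j' r' where "j \<in> J" "j' \<in> J" "a = j + r * x" "b = j' + r' * x"
    unfolding adjoin_def by auto
  then have "a + b = (j + j') + (r + r') * x" "j + j' \<in> J"
    using assms by (auto simp: algebra_simps intro: is_idealD)
  then show "a + b \<in> adjoin J x" unfolding adjoin_def by auto
next
  fix c a assume "a \<in> adjoin J x"
  then obtain j r where "j \<in> J" "a = j + r * x" unfolding adjoin_def by auto
  then have "c * a = c * j + (c * r) * x" "c * j \<in> J"
    using assms by (auto simp: algebra_simps intro: is_idealD)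
  then show "c * a \<in> adjoin J x" unfolding adjoin_def by auto
qed

lemma adjoin_subset: "J \<subseteq> adjoin J x"
proof
  fix j assume "j \<in> J"
  then show "j \<in> adjoin J x" using adjoinI[of j J 0 x] by simp
qed

lemma adjoin_mem: "is_ideal J \<Longrightarrow> x \<in> adjoin J x"
  using adjoinI[OF is_idealD(1), of J 1 x] by simp

lemma adjoin_cderiv:
  assumes d: "derivation \<delta>" and J: "is_ideal J" "\<And>x. x \<in> J \<Longrightarrow> cderiv \<delta> x \<in> J" and x: "cderiv \<delta> x = 0"
    and a: "a \<in> adjoin J x"
  shows "cderiv \<delta> a \<in> adjoin J x"
proof -
  obtain j r where "j \<in> J" "a = j + r * x" using a unfolding adjoin_def by auto
  then have "cderiv \<delta> a = cderiv \<delta> j + cderiv \<delta> r * x" "cderiv \<delta> j \<in> J"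
    using x J(2) by (simp_all add: cderiv_add[OF d] cderiv_mult[OF d])
  then show ?thesis unfolding adjoin_def by auto
qed

text \<open>Think of \<open>\<tau> = t / s\<close> in the quotient by \<open>J\<close>, localised at \<open>s\<close>; some \<open>\<tau> - a\<close> with \<open>a\<close> constant has to be a
  non-unit. Suppose that all of them are units. Their inverses, one for each of uncountably many
  constants, lie in a space of countable dimension, so finitely many of them are linearly
  dependent. Clearing denominators turns the dependence into a polynomial relation \<open>p(\<tau>) = 0\<close>.
  Take \<open>p\<close> monic of least degree. Applying the derivation, under which \<open>\<tau>\<close> is constant,
  gives a relation of lower degree, so \<open>p\<close> has constant coefficients and a constant root \<open>a\<close>.
  Cancelling the unit \<open>\<tau> - a\<close> contradicts the minimality of the degree. The proof expresses all
  this in the ring itself: membership in \<open>J\<close> after multiplication by some power of \<open>s\<close>.\<close>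

lemma ideal_specialisation:
  fixes \<delta> :: "'u::field_char_0 \<Rightarrow> 'u" and J :: "(nat, 'u) mpoly set"
  assumes d: "derivation \<delta>" and U: "differentially_closed \<delta> (UNIV :: 'u set)"
    and unc: "uncountable {a. \<delta> a = 0}"
    and J: "is_ideal J" "\<And>x. x \<in> J \<Longrightarrow> cderiv \<delta> x \<in> J"
    and st: "cderiv \<delta> s = 0" "cderiv \<delta> t = 0" and proper: "\<And>N. s ^ N \<notin> J"
  shows "\<exists>a. \<delta> a = 0 \<and> (\<forall>N. s ^ N \<notin> adjoin J (t - cst a * s))"
proof (rule ccontr)
  let ?C = "{a. \<delta> a = 0}"
  assume "\<not> ?thesis"
  then have "\<forall>a\<in>?C. \<exists>N. s ^ N \<in> adjoin J (t - cst a * s)" by blast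
  then have "\<forall>a\<in>?C. \<exists>N r. s ^ N - r * (t - cst a * s) \<in> J"
    unfolding adjoin_iff .
  then obtain N where "\<forall>a\<in>?C. \<exists>r. s ^ N a - r * (t - cst a * s) \<in> J" unfolding bchoice_iff ..
  then obtain r where "\<forall>a\<in>?C. s ^ N a - r a * (t - cst a * s) \<in> J" unfolding bchoice_iff ..
  then have Nr: "s ^ N a - r a * (t - cst a * s) \<in> J" if "\<delta> a = 0" for a
    using that by simp
  \<comment> \<open>infinitely many of the \<open>r a\<close> have the same finite set of monomials\<close>
  let ?f = "\<lambda>a. (N a, Poly_Mapping.keys (r a))"
  have "countable ((UNIV :: nat set) \<times> {S. finite S \<and> S \<subseteq> (UNIV :: (nat \<Rightarrow>\<^sub>0 nat) set)})"
    by (intro countable_SIGMA countableI_type countable_Collect_finite_subset countable_exponents)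
  then have "countable (?f ` ?C)" by (rule countable_subset[rotated]) auto
  with unc obtain y where inf: "infinite {a \<in> ?C. ?f a = y}" by (rule uncountable_infinite_fibre)
  define M S where "M = fst y" and "S = snd y"
  have "finite S"
  proof -
    from inf have "{a \<in> ?C. ?f a = y} \<noteq> {}" by (rule infinite_imp_nonempty)
    then obtain a where "?f a = y" by auto
    then show ?thesis unfolding S_def by auto
  qed
  obtain B where B: "finite B" "card B = Suc (card S)" "B \<subseteq> {a \<in> ?C. ?f a = y}"
    using infinite_arbitrarily_large[OF inf, of "Suc (card S)"] by auto
  then have B': "\<delta> b = 0" "N b = M" "Poly_Mapping.keys (r b) = S" if "b \<in> B" for b
    using that unfolding M_def S_def by auto
  obtain u where u: "\<exists>b\<in>B. u b \<noteq> 0"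
    and ker: "\<forall>m\<in>S. (\<Sum>b\<in>B. Poly_Mapping.lookup (r b) m * u b) = 0"
    using underdetermined_kernel[OF \<open>finite S\<close> B(1), of "\<lambda>m b. Poly_Mapping.lookup (r b) m"] B(2) by auto
  have dep: "(\<Sum>b\<in>B. cst (u b) * r b) = 0"
  proof (rule poly_mapping_eqI)
    fix m
    have "(\<Sum>b\<in>B. u b * Poly_Mapping.lookup (r b) m) = 0"
    proof (cases "m \<in> S")
      case True
      then show ?thesis using ker by (simp add: mult.commute)
    next
      case False
      have "Poly_Mapping.lookup (r b) m = 0" if "b \<in> B" for b
        using False B'(3)[OF that] by (simp flip: not_in_keys_iff_lookup_eq_zero)
      then show ?thesis by (intro sum.neutral) auto
    qed
    then show "Poly_Mapping.lookup (\<Sum>b\<in>B. cst (u b) * r b) m = Poly_Mapping.lookup 0 m"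
      by (simp add: lookup_sum lookup_cst_mult)
  qed
  \<comment> \<open>polynomials \<open>p\<close> such that \<open>p (t / s)\<close> vanishes modulo the saturation of \<open>J\<close>\<close>
  define rel where "rel p \<longleftrightarrow> p \<noteq> 0 \<and> (\<exists>e M. degree p \<le> e \<and> s ^ M * hom_poly e p t s \<in> J)" for p
  \<comment> \<open>numerator of \<open>\<Sum>b\<in>B. u b / (T - b)\<close> over the common denominator\<close>
  define q where "q = (\<Sum>b\<in>B. smult (u b) (\<Prod>c\<in>B - {b}. [:- c, 1:]))"
  have "rel q"
  proof -
    obtain b0 where b0: "b0 \<in> B" "u b0 \<noteq> 0" using u by blast
    have "poly q b0 = (\<Sum>b\<in>B. u b * (\<Prod>c\<in>B - {b}. b0 - c))"
      by (simp add: q_def poly_sum poly_prod)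
    also have "\<dots> = (\<Sum>b\<in>{b0}. u b * (\<Prod>c\<in>B - {b}. b0 - c))"
      using b0(1) B(1) by (intro sum.mono_neutral_right) auto
    also have "\<dots> \<noteq> 0" using b0(2) B(1) by (auto simp: prod_zero_iff)
    finally have "q \<noteq> 0" by auto
    moreover have "degree q \<le> card S"
      unfolding q_def
    proof (intro degree_sum_le B(1))
      fix b assume "b \<in> B"
      have "degree (\<Prod>c\<in>B - {b}. [:- c, 1:]) \<le> (\<Sum>c\<in>B - {b}. degree [:- c, 1:])"
        using degree_prod_sum_le[of "B - {b}" "\<lambda>c. [:- c, 1:]"] B(1) by (simp add: o_def)
      also have "\<dots> = card S" using B(1,2) \<open>b \<in> B\<close> by simp
      finally show "degree (smult (u b) (\<Prod>c\<in>B - {b}. [:- c, 1:])) \<le> card S"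
        by (rule order_trans[OF degree_smult_le])
    qed
    moreover have "s ^ M * hom_poly (card S) q t s \<in> J"
    proof -
      define L where "L b = t - cst b * s" for b
      have "hom_poly (card S) (\<Sum>b\<in>D. smult (u b) (\<Prod>c\<in>B - {b}. [:- c, 1:])) t s =
          (\<Sum>b\<in>D. cst (u b) * (\<Prod>c\<in>B - {b}. L c))" if "D \<subseteq> B" for D
        using finite_subset[OF that B(1)] that
      proof (induction D rule: finite_induct)
        case (insert b D)
        have "card (B - {b}) = card S" using insert.prems B(1,2) by simp
        then show ?case
          using hom_poly_prod_linear[of "B - {b}" t s] insert B(1)
          by (simp add: hom_poly_add hom_poly_smult L_def)
      qed (simp add: hom_poly_0)
      then have "s ^ M * hom_poly (card S) q t s = (\<Sum>b\<in>B. s ^ M * (cst (u b) * (\<Prod>c\<in>B - {b}. L c)))"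
        by (simp add: q_def sum_distrib_left)
      also have "\<dots> = (\<Sum>b\<in>B. cst (u b) * (\<Prod>c\<in>B - {b}. L c) * (s ^ M - r b * L b)) +
          (\<Sum>b\<in>B. cst (u b) * r b * (L b * (\<Prod>c\<in>B - {b}. L c)))"
        by (simp add: algebra_simps flip: sum.distrib)
      also have "(\<Sum>b\<in>B. cst (u b) * r b * (L b * (\<Prod>c\<in>B - {b}. L c))) =
          (\<Sum>b\<in>B. cst (u b) * r b * (\<Prod>c\<in>B. L c))"
        using B(1) by (intro sum.cong) (auto simp: prod.remove)
      also have "\<dots> = 0" using dep by (simp flip: sum_distrib_right)
      also have "(\<Sum>b\<in>B. cst (u b) * (\<Prod>c\<in>B - {b}. L c) * (s ^ M - r b * L b)) + 0 \<in> J"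
        using Nr B' by (auto intro!: is_ideal_sum[OF J(1)] is_idealD(3)[OF J(1)] simp: L_def)
      finally show ?thesis .
    qed
    ultimately show ?thesis unfolding rel_def by auto
  qed
  \<comment> \<open>a relation of least degree, made monic, has constant coefficients\<close>
  obtain p where "rel p" and least: "\<And>p'. rel p' \<Longrightarrow> degree p \<le> degree p'"
    using ex_has_least_nat[of rel q degree] \<open>rel q\<close> by auto
  then obtain e M where p0: "p \<noteq> 0" "degree p \<le> e" "s ^ M * hom_poly e p t s \<in> J"
    unfolding rel_def by auto
  define p1 where "p1 = smult (inverse (lead_coeff p)) p"
  have p1: "lead_coeff p1 = 1" "degree p1 = degree p" "p1 \<noteq> 0" using p0(1) by (auto simp: p1_def)
  have p1J: "s ^ M * hom_poly e p1 t s \<in> J"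
    using is_idealD(3)[OF J(1) p0(3), of "cst (inverse (lead_coeff p))"]
    by (simp add: p1_def hom_poly_smult mult_ac)
  have const: "\<delta> (coeff p1 i) = 0" for i
  proof (rule ccontr)
    assume "\<delta> (coeff p1 i) \<noteq> 0"
    then have "coeff (map_poly \<delta> p1) i \<noteq> 0" by (simp add: coeff_map_poly derivation_0[OF d])
    then have nz: "map_poly \<delta> p1 \<noteq> 0" by auto
    have "cderiv \<delta> (s ^ M * hom_poly e p1 t s) = s ^ M * hom_poly e (map_poly \<delta> p1) t s"
      by (simp add: cderiv_mult[OF d] cderiv_power_const[OF d st(1)] cderiv_hom_poly[OF d st])
    then have "s ^ M * hom_poly e (map_poly \<delta> p1) t s \<in> J" using J(2)[OF p1J] by simp
    moreover have le: "degree (map_poly \<delta> p1) \<le> degree p1" 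
      by (rule degree_le) (simp add: coeff_map_poly derivation_0[OF d] coeff_eq_0)
    ultimately have "rel (map_poly \<delta> p1)"
      unfolding rel_def using nz p0(2) p1(2) by (intro conjI exI[of _ e] exI[of _ M]) auto
    then have "degree (map_poly \<delta> p1) = degree p1" using least le p1(2) by force
    moreover have "coeff (map_poly \<delta> p1) (degree p1) = 0"
      using p1(1) by (simp add: coeff_map_poly derivation_0[OF d] derivation_1[OF d])
    ultimately show False using nz by (metis leading_coeff_0_iff)
  qed
  \<comment> \<open>otherwise a power of \<open>s\<close> would lie in \<open>J\<close>\<close>
  have "degree p1 \<noteq> 0"
  proof
    assume "degree p1 = 0"
    then obtain c where "p1 = [:c:]" by (rule degree_eq_zeroE)
    then have "p1 = 1" using p1(1) by (simp add: one_pCons)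
    then have "s ^ (M + e) \<in> J" using p1J by (simp add: hom_poly_1 power_add)
    with proper show False by simp
  qed
  then obtain a where a: "\<delta> a = 0" "poly p1 a = 0"
    using constants_algebraically_closed[OF U d const] by auto
  from a(2) obtain p' where p': "p1 = [:- a, 1:] * p'" unfolding poly_eq_0_iff_dvd by (rule dvdE)
  then have "p' \<noteq> 0" using p1(3) by auto
  then have deg: "degree p1 = Suc (degree p')" unfolding p' by (subst degree_mult_eq) auto
  then obtain e' where e': "e = Suc e'" "degree p' \<le> e'" using p0(2) p1(2) by (cases e) auto
  define h where "h = hom_poly e' p' t s"
  have "s ^ M * ((t - cst a * s) * h) \<in> J"
    using p1J unfolding p' e'(1) hom_poly_linear[OF e'(2)] h_def .
  then have "s ^ M * h * (s ^ N a - r a * (t - cst a * s)) + r a * (s ^ M * ((t - cst a * s) * h)) \<in> J"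
    by (rule is_idealD(2)[OF J(1) is_idealD(3)[OF J(1) Nr[OF a(1)]] is_idealD(3)[OF J(1)]])
  also have "s ^ M * h * (s ^ N a - r a * (t - cst a * s)) + r a * (s ^ M * ((t - cst a * s) * h)) =
      s ^ (M + N a) * h"
    by (simp add: algebra_simps power_add)
  finally have "s ^ (M + N a) * h \<in> J" .
  then have "rel p'" unfolding rel_def h_def using \<open>p' \<noteq> 0\<close> e'(2) by auto
  then show False using least[of p'] deg p1(2) by simp
qed

section \<open>Elimination of constants\<close>

definition indet :: "nat \<Rightarrow> (nat, 'u::zero_neq_one) mpoly" where
  "indet i = Poly_Mapping.single (Poly_Mapping.single i 1) 1"

lemma indet_power: "indet i ^ N = (Poly_Mapping.single (Poly_Mapping.single i N) 1 :: (nat, 'u::comm_semiring_1) mpoly)"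
  by (induction N) (simp_all add: indet_def mult_single single_add[symmetric])

lemma monomial_eq_prod:
  assumes "Poly_Mapping.keys m \<subseteq> {..<n}"
  shows "(Poly_Mapping.single m 1 :: (nat, 'u::comm_semiring_1) mpoly) = (\<Prod>i<n. indet i ^ Poly_Mapping.lookup m i)"
proof -
  have "(\<Prod>i\<in>A. indet i ^ Poly_Mapping.lookup m i) =
      (Poly_Mapping.single (\<Sum>i\<in>A. Poly_Mapping.single i (Poly_Mapping.lookup m i)) 1 :: (nat, 'u) mpoly)" for A
    unfolding indet_power
    by (induction A rule: infinite_finite_induct) (simp_all add: mult_single)
  moreover have "(\<Sum>i<n. Poly_Mapping.single i (Poly_Mapping.lookup m i)) = m"
  proof -
    have "(\<Sum>i<n. Poly_Mapping.single i (Poly_Mapping.lookup m i)) =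
        (\<Sum>i\<in>Poly_Mapping.keys m. Poly_Mapping.single i (Poly_Mapping.lookup m i))"
      using assms by (intro sum.mono_neutral_right) (auto simp: in_keys_iff)
    then show ?thesis using poly_mapping_sum_singles[of m] by simp
  qed
  ultimately show ?thesis by simp
qed

text \<open>The case \<open>l = i\<close> is included; there \<open>indet i \<notin> J'\<close> forces \<open>c i = 1\<close> when \<open>i < n\<close>.\<close>

lemma ideal_specialisation_iterated:
  fixes \<delta> :: "'u::field_char_0 \<Rightarrow> 'u" and J :: "(nat, 'u) mpoly set"
  assumes d: "derivation \<delta>" and U: "differentially_closed \<delta> (UNIV :: 'u set)"
    and unc: "uncountable {a. \<delta> a = 0}"
    and J: "is_ideal J" "\<And>x. x \<in> J \<Longrightarrow> cderiv \<delta> x \<in> J" and proper: "\<And>N. indet i ^ N \<notin> J"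
  shows "\<exists>J' c. is_ideal J' \<and> (\<forall>x\<in>J'. cderiv \<delta> x \<in> J') \<and> J \<subseteq> J' \<and> (\<forall>N. indet i ^ N \<notin> J') \<and>
    (\<forall>l<n. \<delta> (c l) = 0 \<and> indet l - cst (c l) * indet i \<in> J')"
proof (induction n)
  case 0
  show ?case using J proper by (intro exI[of _ J]) auto
next
  case (Suc n)
  then obtain J' c where J': "is_ideal J'" "\<And>x. x \<in> J' \<Longrightarrow> cderiv \<delta> x \<in> J'" "J \<subseteq> J'"
    "\<And>N. indet i ^ N \<notin> J'"
    and c: "\<And>l. l < n \<Longrightarrow> \<delta> (c l) = 0 \<and> indet l - cst (c l) * indet i \<in> J'" by auto
  have indet: "cderiv \<delta> (indet l) = 0" for l
    by (simp add: indet_def cderiv_single[OF d] derivation_1[OF d])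
  obtain a where a: "\<delta> a = 0" "\<And>N. indet i ^ N \<notin> adjoin J' (indet n - cst a * indet i)"
    using ideal_specialisation[OF d U unc J'(1,2) indet[of i] indet[of n] J'(4)] by auto
  let ?x = "indet n - cst a * indet i"
  have "cderiv \<delta> ?x = 0"
    by (simp add: cderiv_diff[OF d] cderiv_mult[OF d] indet cderiv_single[OF d] a(1))
  note adj = adjoin_ideal[OF J'(1), of ?x] adjoin_cderiv[OF d J'(1,2) this] adjoin_subset[of J' ?x]
    adjoin_mem[OF J'(1), of ?x]
  show ?case
  proof (intro exI[of _ "adjoin J' ?x"] exI[of _ "c(n := a)"] conjI ballI allI impI)
    fix l assume "l < Suc n"
    then show "\<delta> ((c(n := a)) l) = 0" "indet l - cst ((c(n := a)) l) * indet i \<in> adjoin J' ?x"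
      using c[of l] a(1) adj(3,4) by (auto simp: less_Suc_eq)
  qed (use adj a J'(3) in auto)
qed

text \<open>The differential ideal generated by the polynomials \<open>P g\<close>, as sums of monomial multiples of their
  derivatives; this is the form on which a linear functional can be evaluated.\<close>

inductive_set diff_ideal :: "('u::field \<Rightarrow> 'u) \<Rightarrow> ('g \<Rightarrow> (nat, 'u) mpoly) \<Rightarrow> 'g set \<Rightarrow> (nat, 'u) mpoly set"
  for \<delta> P G where
  zero: "0 \<in> diff_ideal \<delta> P G"
| step: "x \<in> diff_ideal \<delta> P G \<Longrightarrow> g \<in> G \<Longrightarrow>
    x + Poly_Mapping.single m u * (cderiv \<delta> ^^ l) (P g) \<in> diff_ideal \<delta> P G"

lemma diff_ideal_add: "x \<in> diff_ideal \<delta> P G \<Longrightarrow> y \<in> diff_ideal \<delta> P G \<Longrightarrow> x + y \<in> diff_ideal \<delta> P G"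
proof (induction rule: diff_ideal.induct)
  case (step x g m u l)
  then have "(x + y) + Poly_Mapping.single m u * (cderiv \<delta> ^^ l) (P g) \<in> diff_ideal \<delta> P G"
    by (intro diff_ideal.step)
  then show ?case by (simp add: algebra_simps)
qed simp

lemma is_ideal_diff_ideal: "is_ideal (diff_ideal \<delta> P G)"
  unfolding is_ideal_def
proof (intro conjI ballI allI diff_ideal.zero diff_ideal_add)
  fix r x assume x: "x \<in> diff_ideal \<delta> P G"
  show "r * x \<in> diff_ideal \<delta> P G"
  proof (induction r rule: poly_mapping_add_induct)
    case (single m' c)
    show ?case using x
    proof (induction rule: diff_ideal.induct)
      case (step x g m u l)
      then have "Poly_Mapping.single m' c * x +
          Poly_Mapping.single (m' + m) (c * u) * (cderiv \<delta> ^^ l) (P g) \<in> diff_ideal \<delta> P G"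
        by (intro diff_ideal.step)
      then show ?case by (simp only: mult_single[symmetric] distrib_left mult.assoc)
    qed (simp add: diff_ideal.zero)
  qed (simp_all add: diff_ideal.zero diff_ideal_add distrib_right)
qed

lemma diff_ideal_cderiv:
  assumes d: "derivation \<delta>"
  shows "x \<in> diff_ideal \<delta> P G \<Longrightarrow> cderiv \<delta> x \<in> diff_ideal \<delta> P G"
proof (induction rule: diff_ideal.induct)
  case (step x g m u l)
  have "cderiv \<delta> x + Poly_Mapping.single m (\<delta> u) * (cderiv \<delta> ^^ l) (P g) +
      Poly_Mapping.single m u * (cderiv \<delta> ^^ Suc l) (P g) \<in> diff_ideal \<delta> P G"
    using step by (intro diff_ideal.step)
  then show ?case by (simp add: cderiv_add[OF d] cderiv_mult[OF d] cderiv_single[OF d] add.assoc)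
qed (simp add: cderiv_0[OF d] diff_ideal.zero)

lemma diff_ideal_gen: "g \<in> G \<Longrightarrow> P g \<in> diff_ideal \<delta> P G"
  using diff_ideal.step[OF diff_ideal.zero[of \<delta> P G], of g 0 1 0] by simp

text \<open>The rows of the Macaulay matrix in degree \<open>N\<close>: \<open>(g, l, m)\<close> stands for the product of the monomial
  \<open>m\<close> and the \<open>l\<close>-th derivative of \<open>P g\<close>, a form of degree \<open>N\<close>.\<close>

definition macaulay_rows :: "nat \<Rightarrow> ('g \<Rightarrow> nat) \<Rightarrow> 'g set \<Rightarrow> nat \<Rightarrow> ('g \<times> nat \<times> (nat \<Rightarrow>\<^sub>0 nat)) set" where
  "macaulay_rows n deg G N = {(g, l, m). g \<in> G \<and> deg g \<le> N \<and> m \<in> monomials n (N - deg g)}"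

definition macaulay :: "('u::field \<Rightarrow> 'u) \<Rightarrow> ('g \<Rightarrow> (nat, 'u) mpoly) \<Rightarrow> ('g \<times> nat \<times> (nat \<Rightarrow>\<^sub>0 nat)) \<Rightarrow> (nat \<Rightarrow>\<^sub>0 nat) \<Rightarrow> 'u" where
  "macaulay \<delta> P = (\<lambda>(g, l, m). Poly_Mapping.lookup (Poly_Mapping.single m 1 * (cderiv \<delta> ^^ l) (P g)))"

lemma monomials_add: "a \<in> monomials n M \<Longrightarrow> b \<in> monomials n N \<Longrightarrow> a + b \<in> monomials n (M + N)"
  using keys_add[of a b] by (auto simp: monomials_def lookup_add sum.distrib)

lemma monomials_add_cancel:
  assumes "a + b \<in> monomials n N" "b \<in> monomials n M"
  shows "M \<le> N \<and> a \<in> monomials n (N - M)"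
proof -
  have "(\<Sum>i<n. Poly_Mapping.lookup a i) + M = N"
    using assms by (simp add: monomials_def lookup_add sum.distrib)
  moreover have "Poly_Mapping.keys a \<subseteq> Poly_Mapping.keys (a + b)"
    by (auto simp: in_keys_iff lookup_add)
  ultimately show ?thesis using assms by (auto simp: monomials_def)
qed

lemma single_in_monomials: "i < n \<Longrightarrow> Poly_Mapping.single i N \<in> monomials n N"
  by (auto simp: monomials_def lookup_single when_def)

lemma monomial_divisible_by_power:
  assumes m: "m \<in> monomials n (\<Sum>i<n. N i)" and n: "0 < n"
  obtains i m' where "i < n" "m = m' + Poly_Mapping.single i (N i)"
proof -
  have "\<exists>i<n. N i \<le> Poly_Mapping.lookup m i"
  proof (rule ccontr)
    assume "\<not> ?thesis"
    then have "(\<Sum>i<n. Poly_Mapping.lookup m i) < (\<Sum>i<n. N i)"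
      using n by (intro sum_strict_mono) auto
    then show False using m by (simp add: monomials_def)
  qed
  then obtain i where i: "i < n" "N i \<le> Poly_Mapping.lookup m i" by auto
  have "m = (m - Poly_Mapping.single i (N i)) + Poly_Mapping.single i (N i)"
    by (rule poly_mapping_eqI) (use i(2) in \<open>auto simp: lookup_add lookup_minus lookup_single when_def\<close>)
  with i(1) show ?thesis by (rule that)
qed

text \<open>Every row, evaluated at a constant common zero \<open>c\<close>, is a multiple of a derivative of
  \<open>P g\<close> at \<open>c\<close>, which is zero; hence the monomials at \<open>c\<close> form a kernel vector.\<close>

lemma common_zero_imp_kernel:
  assumes d: "derivation \<delta>" and hom: "\<And>g. g \<in> G \<Longrightarrow> Poly_Mapping.keys (P g) \<subseteq> monomials n (deg g)"
    and c: "\<And>i. \<delta> (c i) = 0" and zero: "\<And>g. g \<in> G \<Longrightarrow> peval (P g) c = 0"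
    and r: "r \<in> macaulay_rows n deg G N"
  shows "(\<Sum>\<alpha>\<in>monomials n N. macaulay \<delta> P r \<alpha> * mval \<alpha> c) = 0"
proof -
  obtain g l m where r_eq: "r = (g, l, m)" "g \<in> G" "deg g \<le> N" "m \<in> monomials n (N - deg g)"
    using r by (auto simp: macaulay_rows_def)
  let ?Q = "Poly_Mapping.single m 1 * (cderiv \<delta> ^^ l) (P g)"
  have "Poly_Mapping.keys ?Q \<subseteq> monomials n N"
  proof
    fix \<alpha> assume "\<alpha> \<in> Poly_Mapping.keys ?Q"
    then obtain \<beta> where "\<beta> \<in> Poly_Mapping.keys ((cderiv \<delta> ^^ l) (P g))" "\<alpha> = m + \<beta>"
      using keys_mult[of "Poly_Mapping.single m 1" "(cderiv \<delta> ^^ l) (P g)"] by auto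
    then show "\<alpha> \<in> monomials n N"
      using keys_cderiv_funpow[OF d, of l "P g"] hom[OF r_eq(2)] monomials_add[OF r_eq(4), of \<beta> "deg g"] r_eq(3)
      by auto
  qed
  then have "(\<Sum>\<alpha>\<in>monomials n N. macaulay \<delta> P r \<alpha> * mval \<alpha> c) = peval ?Q c"
    unfolding macaulay_def r_eq(1) by (subst peval_superset[OF finite_monomials]) auto
  also have "\<dots> = 0"
    by (simp add: peval_mult peval_cderiv_funpow[OF d c] zero[OF r_eq(2)] derivation_funpow_0[OF d])
  finally show ?thesis .
qed

text \<open>The kernel vector in degree \<open>N\<close> is a linear functional on forms of degree \<open>N\<close> that kills the
  differential ideal. If a power of each indeterminate were in the ideal, then so would be all
  monomials of a high degree, and the functional of that degree would be zero. So all
  powers of some indeterminate lie outside the ideal; all indeterminates are then specialised to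
  constant multiples \<open>c l\<close> of it. Modulo the resulting ideal a form of degree \<open>N\<close> is congruent
  to its value at \<open>c\<close> times the \<open>N\<close>-th power of that indeterminate, so forms in the ideal vanish at
  \<open>c\<close>.\<close>

lemma kernel_imp_common_zero:
  fixes \<delta> :: "'u::field_char_0 \<Rightarrow> 'u" and P :: "'g \<Rightarrow> (nat, 'u) mpoly"
  assumes d: "derivation \<delta>" and U: "differentially_closed \<delta> (UNIV :: 'u set)"
    and unc: "uncountable {a. \<delta> a = 0}" and n: "0 < n"
    and hom: "\<And>g. g \<in> G \<Longrightarrow> Poly_Mapping.keys (P g) \<subseteq> monomials n (deg g)"
    and ker: "\<And>N. \<exists>w. (\<exists>\<alpha>\<in>monomials n N. w \<alpha> \<noteq> 0) \<and>
      (\<forall>r\<in>macaulay_rows n deg G N. (\<Sum>\<alpha>\<in>monomials n N. macaulay \<delta> P r \<alpha> * w \<alpha>) = 0)"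
  shows "\<exists>c. (\<forall>i. \<delta> (c i) = 0) \<and> (\<exists>i<n. c i \<noteq> 0) \<and> (\<forall>g\<in>G. peval (P g) c = 0)"
proof -
  define I where "I = diff_ideal \<delta> P G"
  have I: "is_ideal I" "\<And>x. x \<in> I \<Longrightarrow> cderiv \<delta> x \<in> I"
    unfolding I_def by (rule is_ideal_diff_ideal) (rule diff_ideal_cderiv[OF d])
  have "\<exists>i<n. \<forall>N. indet i ^ N \<notin> I"
  proof (rule ccontr)
    assume "\<not> ?thesis"
    then have "\<forall>i. \<exists>N. i < n \<longrightarrow> indet i ^ N \<in> I" by auto
    then obtain e where e: "\<And>i. i < n \<Longrightarrow> indet i ^ e i \<in> I" unfolding choice_iff by auto
    let ?N = "\<Sum>i<n. e i"
    obtain w where w: "\<exists>\<alpha>\<in>monomials n ?N. w \<alpha> \<noteq> 0"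
      "\<And>r. r \<in> macaulay_rows n deg G ?N \<Longrightarrow> (\<Sum>\<alpha>\<in>monomials n ?N. macaulay \<delta> P r \<alpha> * w \<alpha>) = 0"
      using ker[of ?N] by auto
    \<comment> \<open>the kernel vector as a functional on all polynomials, which only sees the terms of degree \<open>?N\<close>\<close>
    define \<Lambda> where "\<Lambda> x = (\<Sum>\<alpha>\<in>monomials n ?N. Poly_Mapping.lookup x \<alpha> * w \<alpha>)" for x
    have gen: "\<Lambda> (Poly_Mapping.single m u * (cderiv \<delta> ^^ l) (P g)) = 0" if g: "g \<in> G" for m u l g
    proof (cases "(g, l, m) \<in> macaulay_rows n deg G ?N")
      case True
      have "Poly_Mapping.single m u = cst u * Poly_Mapping.single m 1" by (simp add: mult_single)
      then have "\<Lambda> (Poly_Mapping.single m u * (cderiv \<delta> ^^ l) (P g)) =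
          u * (\<Sum>\<alpha>\<in>monomials n ?N. macaulay \<delta> P (g, l, m) \<alpha> * w \<alpha>)"
        by (simp add: \<Lambda>_def macaulay_def mult.assoc lookup_cst_mult sum_distrib_left)
      then show ?thesis using w(2)[OF True] by simp
    next
      case False
      have "Poly_Mapping.lookup (Poly_Mapping.single m u * (cderiv \<delta> ^^ l) (P g)) \<alpha> = 0"
        if \<alpha>: "\<alpha> \<in> monomials n ?N" for \<alpha>
      proof (rule ccontr)
        assume "\<not> ?thesis"
        then have "\<alpha> \<in> Poly_Mapping.keys (Poly_Mapping.single m u * (cderiv \<delta> ^^ l) (P g))"
          by (simp add: in_keys_iff)
        then obtain \<beta> where \<beta>: "\<beta> \<in> Poly_Mapping.keys ((cderiv \<delta> ^^ l) (P g))" "\<alpha> = m + \<beta>"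
          using keys_mult[of "Poly_Mapping.single m u" "(cderiv \<delta> ^^ l) (P g)"] by (auto split: if_splits)
        then have "\<beta> \<in> monomials n (deg g)" using keys_cderiv_funpow[OF d, of l "P g"] hom[OF g] by auto
        then show False
          using monomials_add_cancel[of m \<beta> n ?N "deg g"] \<alpha> \<beta>(2) False g by (auto simp: macaulay_rows_def)
      qed
      then show ?thesis by (simp add: \<Lambda>_def)
    qed
    have \<Lambda>I: "\<Lambda> x = 0" if "x \<in> I" for x
      using that unfolding I_def
    proof (induction rule: diff_ideal.induct)
      case (step x g m u l)
      have "\<Lambda> (x + y) = \<Lambda> x + \<Lambda> y" for y
        by (simp add: \<Lambda>_def lookup_add distrib_right sum.distrib)
      then show ?case using step gen by simp
    qed (simp add: \<Lambda>_def)
    have "w \<alpha> = 0" if \<alpha>: "\<alpha> \<in> monomials n ?N" for \<alpha>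
    proof -
      obtain i m' where i: "i < n" "\<alpha> = m' + Poly_Mapping.single i (e i)"
        by (rule monomial_divisible_by_power[OF \<alpha> n])
      have "(Poly_Mapping.single \<alpha> 1 :: (nat, 'u) mpoly) = Poly_Mapping.single m' 1 * indet i ^ e i"
        by (simp add: i(2) indet_power mult_single)
      then have "(Poly_Mapping.single \<alpha> 1 :: (nat, 'u) mpoly) \<in> I" using is_idealD(3)[OF I(1) e[OF i(1)]] by simp
      from \<Lambda>I[OF this] have "(\<Sum>\<beta>\<in>monomials n ?N. (1 when \<alpha> = \<beta>) * w \<beta>) = 0"
        by (simp add: \<Lambda>_def lookup_single)
      then show ?thesis
        using \<alpha> by (simp add: when_def if_distrib[of "\<lambda>x. x * _"] finite_monomials cong: if_cong)
    qed
    then show False using w(1) by auto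
  qed
  then obtain i where i: "i < n" "\<And>N. indet i ^ N \<notin> I" by auto
  have "\<exists>J c. is_ideal J \<and> (\<forall>x\<in>J. cderiv \<delta> x \<in> J) \<and> I \<subseteq> J \<and> (\<forall>N. indet i ^ N \<notin> J) \<and>
      (\<forall>l<n. \<delta> (c l) = 0 \<and> indet l - cst (c l) * indet i \<in> J)"
    by (rule ideal_specialisation_iterated[OF d U unc I(1) _ i(2)]) (rule I(2))
  then obtain J c0 where J0: "is_ideal J" "I \<subseteq> J" "\<forall>N. indet i ^ N \<notin> J"
    and c00: "\<forall>l<n. \<delta> (c0 l) = 0 \<and> indet l - cst (c0 l) * indet i \<in> J"
    by (elim exE conjE) (rule that)
  have J: "is_ideal J" "I \<subseteq> J" "\<And>N. indet i ^ N \<notin> J" using J0 by simp_all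
  have c0: "\<And>l. l < n \<Longrightarrow> \<delta> (c0 l) = 0" "\<And>l. l < n \<Longrightarrow> indet l - cst (c0 l) * indet i \<in> J"
    using c00 by simp_all
  define c where "c l = (if l < n then c0 l else 0)" for l
  have "c i = 1"
  proof (rule ccontr)
    assume "c i \<noteq> 1"
    then have nz: "1 - c0 i \<noteq> 0" using i(1) by (simp add: c_def)
    have "indet i - cst (c0 i) * indet i = cst (1 - c0 i) * indet i"
      by (simp add: single_diff left_diff_distrib)
    then have "cst (inverse (1 - c0 i)) * (cst (1 - c0 i) * indet i) \<in> J"
      using c0(2)[OF i(1)] by (auto intro: is_idealD(3)[OF J(1)])
    then have "indet i ^ 1 \<in> J" using nz by (simp add: mult.assoc[symmetric] mult_single)
    then show False using J(3) by blast
  qed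
  have mono: "Poly_Mapping.single m 1 - cst (mval m c) * indet i ^ N \<in> J" if m: "m \<in> monomials n N" for m N
  proof -
    have "(\<Prod>l<n. (cst (c0 l) * indet i) ^ Poly_Mapping.lookup m l) =
        cst (\<Prod>l<n. c l ^ Poly_Mapping.lookup m l) * indet i ^ (\<Sum>l<n. Poly_Mapping.lookup m l)"
    proof -
      have "(cst a :: (nat, 'u) mpoly) ^ k = cst (a ^ k)" for a k
        by (induction k) (simp_all add: mult_single)
      moreover have "(\<Prod>l\<in>A. cst (f l)) = (cst (\<Prod>l\<in>A. f l) :: (nat, 'u) mpoly)" for f and A :: "nat set"
        by (induction A rule: infinite_finite_induct) (simp_all add: mult_single)
      ultimately show ?thesis
        by (simp add: power_mult_distrib prod.distrib power_sum c_def)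
    qed
    also have "(\<Prod>l<n. c l ^ Poly_Mapping.lookup m l) = mval m c"
      using m by (subst mval_superset[of "{..<n}"]) (auto simp: monomials_def)
    also have "(\<Sum>l<n. Poly_Mapping.lookup m l) = N" using m by (simp add: monomials_def)
    finally have rhs: "(\<Prod>l<n. (cst (c0 l) * indet i) ^ Poly_Mapping.lookup m l) = cst (mval m c) * indet i ^ N" .
    have "Poly_Mapping.keys m \<subseteq> {..<n}" using m by (simp add: monomials_def)
    then have lhs: "Poly_Mapping.single m 1 = (\<Prod>l<n. indet l ^ Poly_Mapping.lookup m l)"
      by (rule monomial_eq_prod)
    show ?thesis unfolding lhs rhs[symmetric]
      using c0(2) by (intro ideal_cong_prod[OF J(1)] ideal_cong_power[OF J(1)]) simp
  qed
  have "peval (P g) c = 0" if g: "g \<in> G" for g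
  proof (rule ccontr)
    assume nz: "peval (P g) c \<noteq> 0"
    let ?K = "Poly_Mapping.keys (P g)" and ?a = "Poly_Mapping.lookup (P g)"
    have "(\<Sum>m\<in>?K. cst (?a m) * (Poly_Mapping.single m 1 - cst (mval m c) * indet i ^ deg g)) \<in> J"
      using hom[OF g] by (intro is_ideal_sum[OF J(1)] is_idealD(3)[OF J(1)] mono) auto
    also have "(\<Sum>m\<in>?K. cst (?a m) * (Poly_Mapping.single m 1 - cst (mval m c) * indet i ^ deg g)) =
        P g - cst (peval (P g) c) * indet i ^ deg g"
    proof -
      have "(\<Sum>m\<in>?K. cst (?a m) * Poly_Mapping.single m 1) = P g"
        using poly_mapping_sum_singles[of "P g"] by (simp add: mult_single)
      moreover have "(\<Sum>m\<in>?K. cst (?a m) * cst (mval m c)) = (cst (peval (P g) c) :: (nat, 'u) mpoly)"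
      proof -
        have "(\<Sum>m\<in>A. cst (f m)) = (cst (\<Sum>m\<in>A. f m) :: (nat, 'u) mpoly)" for f and A :: "(nat \<Rightarrow>\<^sub>0 nat) set"
          by (induction A rule: infinite_finite_induct) (simp_all add: single_add)
        then show ?thesis by (simp add: peval_def mult_single)
      qed
      ultimately show ?thesis
        by (simp add: right_diff_distrib sum_subtractf sum_distrib_right[symmetric] mult.assoc[symmetric])
    qed
    finally have "P g - cst (peval (P g) c) * indet i ^ deg g \<in> J" .
    moreover have "P g \<in> J" using diff_ideal_gen[OF g] J(2) by (auto simp: I_def)
    ultimately have "P g - (P g - cst (peval (P g) c) * indet i ^ deg g) \<in> J"
      using is_idealD(5)[OF J(1)] by blast
    then have "cst (peval (P g) c) * indet i ^ deg g \<in> J" by simp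
    then have "cst (inverse (peval (P g) c)) * (cst (peval (P g) c) * indet i ^ deg g) \<in> J"
      by (rule is_idealD(3)[OF J(1)])
    then have "indet i ^ deg g \<in> J" using nz by (simp add: mult.assoc[symmetric] mult_single)
    then show False using J(3) by blast
  qed
  moreover have "\<delta> (c l) = 0" for l by (simp add: c_def c0(1) derivation_0[OF d])
  ultimately show ?thesis using i(1) \<open>c i = 1\<close> by (intro exI[of _ c]) auto
qed

section \<open>Determinants over finite index sets\<close>

text \<open>The determinant of a matrix indexed by a finite set is independent of the enumeration, since
  rows and columns are permuted alike; an arbitrary one is fixed.\<close>

definition enum_set :: "'a set \<Rightarrow> nat \<Rightarrow> 'a" where
  "enum_set A = (SOME e. bij_betw e {0..<card A} A)"

definition set_det :: "'a set \<Rightarrow> ('a \<Rightarrow> 'a \<Rightarrow> 'u::comm_ring_1) \<Rightarrow> 'u" where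
  "set_det A M = det (mat (card A) (card A) (\<lambda>(i, j). M (enum_set A i) (enum_set A j)))"

lemma bij_enum_set: "finite A \<Longrightarrow> bij_betw (enum_set A) {0..<card A} A"
  unfolding enum_set_def using ex_bij_betw_nat_finite by (rule someI_ex)

lemma set_det_eq_0_iff:
  fixes M :: "'a \<Rightarrow> 'a \<Rightarrow> 'u::field"
  assumes A: "finite A"
  shows "set_det A M = 0 \<longleftrightarrow> (\<exists>w. (\<exists>\<alpha>\<in>A. w \<alpha> \<noteq> 0) \<and> (\<forall>\<alpha>\<in>A. (\<Sum>\<beta>\<in>A. M \<alpha> \<beta> * w \<beta>) = 0))"
proof -
  let ?n = "card A" and ?e = "enum_set A"
  let ?N = "mat ?n ?n (\<lambda>(i, j). M (?e i) (?e j))"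
  note bij = bij_enum_set[OF A]
  have image: "?e ` {0..<?n} = A" using bij by (simp add: bij_betw_def)
  have mult: "(?N *\<^sub>v v) $ i = (\<Sum>\<beta>\<in>A. M (?e i) \<beta> * w \<beta>)"
    if "v \<in> carrier_vec ?n" "i < ?n" "\<And>j. j < ?n \<Longrightarrow> w (?e j) = v $ j" for v i w
  proof -
    have "(?N *\<^sub>v v) $ i = (\<Sum>j\<in>{0..<?n}. M (?e i) (?e j) * w (?e j))"
      using that by (simp add: scalar_prod_def)
    also have "\<dots> = (\<Sum>\<beta>\<in>A. M (?e i) \<beta> * w \<beta>)"
      using sum.reindex_bij_betw[OF bij, of "\<lambda>\<beta>. M (?e i) \<beta> * w \<beta>"] .
    finally show ?thesis .
  qed
  have "set_det A M = 0 \<longleftrightarrow> (\<exists>v. v \<in> carrier_vec ?n \<and> v \<noteq> 0\<^sub>v ?n \<and> ?N *\<^sub>v v = 0\<^sub>v ?n)"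
    unfolding set_det_def by (rule det_0_iff_vec_prod_zero_field) simp
  also have "\<dots> \<longleftrightarrow> (\<exists>w. (\<exists>\<alpha>\<in>A. w \<alpha> \<noteq> 0) \<and> (\<forall>\<alpha>\<in>A. (\<Sum>\<beta>\<in>A. M \<alpha> \<beta> * w \<beta>) = 0))"
  proof
    assume "\<exists>v. v \<in> carrier_vec ?n \<and> v \<noteq> 0\<^sub>v ?n \<and> ?N *\<^sub>v v = 0\<^sub>v ?n"
    then obtain v where v: "v \<in> carrier_vec ?n" "v \<noteq> 0\<^sub>v ?n" "?N *\<^sub>v v = 0\<^sub>v ?n" by auto
    define w where "w \<alpha> = v $ the_inv_into {0..<?n} ?e \<alpha>" for \<alpha>
    have w: "w (?e j) = v $ j" if "j < ?n" for j
      using that bij by (simp add: w_def the_inv_into_f_f bij_betw_def)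
    have zero: "(\<Sum>\<beta>\<in>A. M (?e i) \<beta> * w \<beta>) = 0" if "i < ?n" for i
      using mult[OF v(1) that w] v(3) that by simp
    have "\<forall>\<alpha>\<in>?e ` {0..<?n}. (\<Sum>\<beta>\<in>A. M \<alpha> \<beta> * w \<beta>) = 0" using zero by simp
    moreover obtain j where "j < ?n" "v $ j \<noteq> 0"
      using v(1,2) by (auto simp: vec_eq_iff)
    then have "\<exists>\<alpha>\<in>?e ` {0..<?n}. w \<alpha> \<noteq> 0" using w by auto
    ultimately show "\<exists>w. (\<exists>\<alpha>\<in>A. w \<alpha> \<noteq> 0) \<and> (\<forall>\<alpha>\<in>A. (\<Sum>\<beta>\<in>A. M \<alpha> \<beta> * w \<beta>) = 0)"
      unfolding image by (intro exI[of _ w] conjI)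
  next
    assume "\<exists>w. (\<exists>\<alpha>\<in>A. w \<alpha> \<noteq> 0) \<and> (\<forall>\<alpha>\<in>A. (\<Sum>\<beta>\<in>A. M \<alpha> \<beta> * w \<beta>) = 0)"
    then obtain w \<alpha> where w: "\<alpha> \<in> A" "w \<alpha> \<noteq> 0" "\<And>\<alpha>. \<alpha> \<in> A \<Longrightarrow> (\<Sum>\<beta>\<in>A. M \<alpha> \<beta> * w \<beta>) = 0" by auto
    define v where "v = vec ?n (\<lambda>j. w (?e j))"
    have "\<alpha> \<in> ?e ` {0..<?n}" using w(1) image by simp
    then obtain j where j: "j < ?n" "?e j = \<alpha>" by auto
    have "v \<noteq> 0\<^sub>v ?n"
    proof
      assume "v = 0\<^sub>v ?n"
      then have "v $ j = 0" using j(1) by simp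
      then show False using j w(2) by (simp add: v_def)
    qed
    moreover have "?e i \<in> A" if "i < ?n" for i using image that by auto
    then have "?N *\<^sub>v v = 0\<^sub>v ?n"
      using w(3) mult[of v _ w] by (intro eq_vecI) (auto simp: v_def simp del: index_mult_mat_vec)
    moreover have "v \<in> carrier_vec ?n" by (simp add: v_def)
    ultimately show "\<exists>v. v \<in> carrier_vec ?n \<and> v \<noteq> 0\<^sub>v ?n \<and> ?N *\<^sub>v v = 0\<^sub>v ?n" by auto
  qed
  finally show ?thesis .
qed

lemma dfuns_set_det:
  assumes K: "differential_subfield \<delta> K" and A: "finite A"
    and M: "\<And>\<alpha> \<beta>. \<alpha> \<in> A \<Longrightarrow> \<beta> \<in> A \<Longrightarrow> (\<lambda>y. M y \<alpha> \<beta>) \<in> dfuns \<delta> K I"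
  shows "(\<lambda>y. set_det A (M y)) \<in> dfuns \<delta> K I"
proof -
  let ?n = "card A" and ?e = "enum_set A"
  have e: "?e i \<in> A" if "i < ?n" for i
    using bij_enum_set[OF A] that by (auto simp: bij_betw_def)
  have "set_det A (M y) = (\<Sum>p\<in>{p. p permutes {0..<?n}}. signof p * (\<Prod>i\<in>{0..<?n}. M y (?e i) (?e (p i))))" for y
  proof -
    have "set_det A (M y) = (\<Sum>p\<in>{p. p permutes {0..<?n}}. signof p *
        (\<Prod>i\<in>{0..<?n}. mat ?n ?n (\<lambda>(i, j). M y (?e i) (?e j)) $$ (i, p i)))"
      unfolding set_det_def by (rule det_def') simp
    also have "\<dots> = (\<Sum>p\<in>{p. p permutes {0..<?n}}. signof p * (\<Prod>i\<in>{0..<?n}. M y (?e i) (?e (p i))))"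
    proof (intro sum.cong prod.cong refl arg_cong2[of _ _ _ _ "(*)"])
      fix p i assume "p \<in> {p. p permutes {0..<?n}}" and i: "i \<in> {0..<?n}"
      then have "p i \<in> {0..<?n}" by (simp add: permutes_in_image del: atLeastLessThan_iff)
      then show "mat ?n ?n (\<lambda>(i, j). M y (?e i) (?e j)) $$ (i, p i) = M y (?e i) (?e (p i))"
        using i by simp
    qed
    finally show ?thesis .
  qed
  moreover have "(\<lambda>y. \<Sum>p\<in>{p. p permutes {0..<?n}}. signof p * (\<Prod>i\<in>{0..<?n}. M y (?e i) (?e (p i)))) \<in> dfuns \<delta> K I"
  proof (rule dfuns_sum[OF K], rule dfuns.mult)
    fix p assume p: "p \<in> {p. p permutes {0..<?n}}"
    show "(\<lambda>y. signof p) \<in> dfuns \<delta> K I"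
      by (rule dfuns.const) (auto simp: sign_def intro!: differential_subfieldD[OF K])
    show "(\<lambda>y. \<Prod>i\<in>{0..<?n}. M y (?e i) (?e (p i))) \<in> dfuns \<delta> K I"
    proof (rule dfuns_prod[OF K])
      fix i assume i: "i \<in> {0..<?n}"
      then have "p i \<in> {0..<?n}" using p by (simp add: permutes_in_image del: atLeastLessThan_iff)
      then show "(\<lambda>y. M y (?e i) (?e (p i))) \<in> dfuns \<delta> K I" using i by (intro M e) auto
    qed
  qed
  ultimately show ?thesis by presburger
qed

text \<open>The map \<open>\<rho>\<close> selects as many rows of the Macaulay matrix as it has columns, so the right-hand side
  says that all its maximal minors vanish, in every degree.\<close>

lemma elimination:
  fixes \<delta> :: "'u::field_char_0 \<Rightarrow> 'u" and P :: "'g \<Rightarrow> (nat, 'u) mpoly"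
  assumes d: "derivation \<delta>" and U: "differentially_closed \<delta> (UNIV :: 'u set)"
    and unc: "uncountable {a. \<delta> a = 0}" and n: "0 < n"
    and hom: "\<And>g. g \<in> G \<Longrightarrow> Poly_Mapping.keys (P g) \<subseteq> monomials n (deg g)"
  shows "(\<exists>c. (\<forall>i. \<delta> (c i) = 0) \<and> (\<exists>i<n. c i \<noteq> 0) \<and> (\<forall>g\<in>G. peval (P g) c = 0)) \<longleftrightarrow>
    (\<forall>N \<rho>. \<rho> ` monomials n N \<subseteq> macaulay_rows n deg G N \<longrightarrow>
      set_det (monomials n N) (\<lambda>\<alpha>. macaulay \<delta> P (\<rho> \<alpha>)) = 0)" (is "?L \<longleftrightarrow> ?R")
proof
  assume ?L
  then obtain c i where c: "\<And>i. \<delta> (c i) = 0" "i < n" "c i \<noteq> 0" "\<And>g. g \<in> G \<Longrightarrow> peval (P g) c = 0" by auto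
  show ?R
  proof (intro allI impI)
    fix N \<rho> assume \<rho>: "\<rho> ` monomials n N \<subseteq> macaulay_rows n deg G N"
    have "mval (Poly_Mapping.single i N) c \<noteq> 0" using c(3) by simp
    then have "\<exists>\<alpha>\<in>monomials n N. mval \<alpha> c \<noteq> 0" using single_in_monomials[OF c(2)] by blast
    moreover have "(\<Sum>\<beta>\<in>monomials n N. macaulay \<delta> P (\<rho> \<alpha>) \<beta> * mval \<beta> c) = 0" if "\<alpha> \<in> monomials n N" for \<alpha>
      using that \<rho> by (intro common_zero_imp_kernel[where deg = deg and G = G] d hom c) auto
    ultimately show "set_det (monomials n N) (\<lambda>\<alpha>. macaulay \<delta> P (\<rho> \<alpha>)) = 0"
      unfolding set_det_eq_0_iff[OF finite_monomials] by (intro exI[of _ "\<lambda>\<alpha>. mval \<alpha> c"] conjI ballI)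
  qed
next
  assume R: ?R
  show ?L
  proof (rule kernel_imp_common_zero[where deg = deg])
    fix N
    have "\<not> (\<exists>\<rho>. \<rho> ` monomials n N \<subseteq> macaulay_rows n deg G N \<and>
      (\<forall>w. (\<forall>\<alpha>\<in>monomials n N. (\<Sum>\<beta>\<in>monomials n N. macaulay \<delta> P (\<rho> \<alpha>) \<beta> * w \<beta>) = 0) \<longrightarrow>
        (\<forall>\<alpha>\<in>monomials n N. w \<alpha> = 0)))"
    proof (rule notI, elim exE conjE)
      fix \<rho> assume \<rho>: "\<rho> ` monomials n N \<subseteq> macaulay_rows n deg G N"
        and inj: "\<forall>w. (\<forall>\<alpha>\<in>monomials n N. (\<Sum>\<beta>\<in>monomials n N. macaulay \<delta> P (\<rho> \<alpha>) \<beta> * w \<beta>) = 0) \<longrightarrow>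
          (\<forall>\<alpha>\<in>monomials n N. w \<alpha> = 0)"
      have "set_det (monomials n N) (\<lambda>\<alpha>. macaulay \<delta> P (\<rho> \<alpha>)) = 0" using R \<rho> by simp
      then show False unfolding set_det_eq_0_iff[OF finite_monomials] using inj by auto
    qed
    then show "\<exists>w. (\<exists>\<alpha>\<in>monomials n N. w \<alpha> \<noteq> 0) \<and>
      (\<forall>r\<in>macaulay_rows n deg G N. (\<Sum>\<alpha>\<in>monomials n N. macaulay \<delta> P r \<alpha> * w \<alpha>) = 0)"
      using kernel_or_nonsingular_minor[OF finite_monomials, of n N "macaulay_rows n deg G N" "macaulay \<delta> P"]
      by (elim disjE) simp_all
  qed (use d U unc n hom in auto)
qed

section \<open>Expansion along the solution space\<close>

text \<open>The point of the projective line with coordinates \<open>(\<Sum>i\<le>k. c i * v i : c k)\<close>: for the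
  parametrisation \<open>v\<close> above, a solution if \<open>c k = 1\<close> and the point at infinity if \<open>c k = 0\<close>.\<close>

definition lin_point :: "nat \<Rightarrow> (nat \<Rightarrow> 'u::field) \<Rightarrow> (nat \<Rightarrow> 'u) \<Rightarrow> nat \<Rightarrow> 'u" where
  "lin_point k v c = (\<lambda>_. 0)(0 := \<Sum>i\<le>k. c i * v i, 1 := c k)"

text \<open>A polynomial whose coefficients depend on \<open>y\<close>, given by a list of exponents and coefficient
  functions. Exponents may repeat in the list, which makes products of expansions simple.\<close>

definition expansion :: "((nat \<Rightarrow>\<^sub>0 nat) \<times> ('y \<Rightarrow> 'u)) list \<Rightarrow> 'y \<Rightarrow> (nat, 'u::comm_ring_1) mpoly" where
  "expansion xs y = (\<Sum>a\<leftarrow>xs. Poly_Mapping.single (fst a) (snd a y))"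

lemma expansion_simps [simp]:
  "expansion [] y = 0"
  "expansion (a # xs) y = Poly_Mapping.single (fst a) (snd a y) + expansion xs y"
  "expansion (xs @ ys) y = expansion xs y + expansion ys y"
  by (simp_all add: expansion_def)

lemma expansion_map_upt:
  "expansion (map (\<lambda>i. (\<alpha> i, q i)) [0..<n]) y = (\<Sum>i<n. Poly_Mapping.single (\<alpha> i) (q i y))"
  by (induction n) simp_all

definition mult_terms where
  "mult_terms xs ys = concat (map (\<lambda>a. map (\<lambda>b. (fst a + fst b, \<lambda>y. snd a y * snd b y)) ys) xs)"

lemma set_mult_terms:
  "set (mult_terms xs ys) = (\<Union>a\<in>set xs. (\<lambda>b. (fst a + fst b, \<lambda>y. snd a y * snd b y)) ` set ys)"
  by (simp add: mult_terms_def)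

lemma expansion_mult: "expansion (mult_terms xs ys) y = expansion xs y * expansion ys y"
  unfolding mult_terms_def
proof (induction xs)
  case (Cons a xs)
  have "expansion (map (\<lambda>b. (fst a + fst b, \<lambda>y. snd a y * snd b y)) ys) y =
      Poly_Mapping.single (fst a) (snd a y) * expansion ys y"
    by (induction ys) (simp_all add: distrib_left mult_single)
  then show ?case using Cons by (simp add: distrib_right)
qed simp

text \<open>For constant \<open>c\<close> the derivatives of \<open>\<Sum>i\<le>k. c i * v i\<close> are linear in \<open>c\<close> with coefficients in
  \<open>K\<close>, and the derivatives of \<open>c k\<close> vanish.\<close>

lemma dfuns_expansion:
  fixes \<delta> :: "'u::field \<Rightarrow> 'u"
  assumes K: "differential_subfield \<delta> K" and d: "derivation \<delta>" and v: "\<And>i. i \<le> k \<Longrightarrow> v i \<in> K"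
    and "f \<in> dfuns \<delta> K ({..1} <+> J)"
  shows "\<exists>xs. (\<forall>a\<in>set xs. Poly_Mapping.keys (fst a) \<subseteq> {..<Suc k} \<and> snd a \<in> dfuns \<delta> K J) \<and>
    (\<forall>y c. (\<forall>i. \<delta> (c i) = 0) \<longrightarrow> f (case_sum (lin_point k v c) y) = peval (expansion xs y) c)"
  using assms(4)
proof induction
  case (const a)
  then show ?case by (intro exI[of _ "[(0, \<lambda>_. a)]"]) (auto intro: dfuns.const)
next
  case (var s l)
  consider "s = Inl 0" | "s = Inl 1" "l = 0" | "s = Inl 1" "l \<noteq> 0" | j where "s = Inr j" "j \<in> J"
    using var by (cases "l = 0") (auto simp: le_Suc_eq)
  then show ?case
  proof cases
    case 1
    have "(\<delta> ^^ l) (\<Sum>i\<le>k. c i * v i) =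
        peval (expansion (map (\<lambda>i. (Poly_Mapping.single i 1, \<lambda>_. (\<delta> ^^ l) (v i))) [0..<Suc k]) y) c"
      if "\<forall>i. \<delta> (c i) = 0" for c and y :: "'b \<Rightarrow> 'u"
      unfolding expansion_map_upt using that
      by (simp add: peval_sum derivation_funpow_sum[OF d] derivation_funpow_mult_const[OF d] mult.commute
        lessThan_Suc_atMost del: One_nat_def)
    then show ?thesis
      using 1 v by (intro exI[of _ "map (\<lambda>i. (Poly_Mapping.single i 1, \<lambda>_. (\<delta> ^^ l) (v i))) [0..<Suc k]"])
        (auto simp: lin_point_def less_Suc_eq_le simp del: upt_Suc intro!: dfuns.const differential_subfield_funpow[OF K])
  next
    case 2
    then show ?thesis
      by (intro exI[of _ "[(Poly_Mapping.single k 1, \<lambda>_. 1)]"])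
         (auto simp: lin_point_def intro!: dfuns.const differential_subfieldD[OF K])
  next
    case 3
    then obtain l' where "l = Suc l'" by (cases l) auto
    then have "(\<delta> ^^ l) x = 0" if "\<delta> x = 0" for x
      using that by (simp add: funpow_swap1 derivation_funpow_0[OF d])
    then show ?thesis using 3 by (intro exI[of _ "[]"]) (auto simp: lin_point_def)
  next
    case 4
    then show ?thesis
      by (intro exI[of _ "[(0, \<lambda>y. (\<delta> ^^ l) (y j))]"]) (auto intro: dfuns.var)
  qed
next
  case (add f g)
  then obtain xs ys where
    xs: "\<forall>a\<in>set xs. Poly_Mapping.keys (fst a) \<subseteq> {..<Suc k} \<and> snd a \<in> dfuns \<delta> K J"
      "\<forall>a\<in>set ys. Poly_Mapping.keys (fst a) \<subseteq> {..<Suc k} \<and> snd a \<in> dfuns \<delta> K J" and eq: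
      "\<forall>y c. (\<forall>i. \<delta> (c i) = 0) \<longrightarrow> f (case_sum (lin_point k v c) y) = peval (expansion xs y) c"
      "\<forall>y c. (\<forall>i. \<delta> (c i) = 0) \<longrightarrow> g (case_sum (lin_point k v c) y) = peval (expansion ys y) c"
    by (elim exE conjE) (rule that)
  show ?case
    by (intro exI[of _ "xs @ ys"] conjI) (use xs eq in \<open>auto simp: peval_add\<close>)
next
  case (mult f g)
  then obtain xs ys where
    xs: "\<forall>a\<in>set xs. Poly_Mapping.keys (fst a) \<subseteq> {..<Suc k} \<and> snd a \<in> dfuns \<delta> K J"
      "\<forall>a\<in>set ys. Poly_Mapping.keys (fst a) \<subseteq> {..<Suc k} \<and> snd a \<in> dfuns \<delta> K J" and eq:
      "\<forall>y c. (\<forall>i. \<delta> (c i) = 0) \<longrightarrow> f (case_sum (lin_point k v c) y) = peval (expansion xs y) c"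
      "\<forall>y c. (\<forall>i. \<delta> (c i) = 0) \<longrightarrow> g (case_sum (lin_point k v c) y) = peval (expansion ys y) c"
    by (elim exE conjE) (rule that)
  have "Poly_Mapping.keys (fst c) \<subseteq> {..<Suc k} \<and> snd c \<in> dfuns \<delta> K J" if c: "c \<in> set (mult_terms xs ys)" for c
  proof -
    obtain a where a: "a \<in> set xs" "c \<in> (\<lambda>b. (fst a + fst b, \<lambda>y. snd a y * snd b y)) ` set ys"
      using c unfolding set_mult_terms by (elim UN_E) (rule that)
    obtain b where b: "b \<in> set ys" "c = (fst a + fst b, \<lambda>y. snd a y * snd b y)"
      using a(2) by (elim imageE)
    have *: "a \<in> set xs" "b \<in> set ys" "fst c = fst a + fst b" "snd c = (\<lambda>y. snd a y * snd b y)"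
      using a b by simp_all
    have "Poly_Mapping.keys (fst a + fst b) \<subseteq> {..<Suc k}"
      using bspec[OF xs(1) *(1)] bspec[OF xs(2) *(2)] keys_add[of "fst a" "fst b"] by blast
    moreover have "(\<lambda>y. snd a y * snd b y) \<in> dfuns \<delta> K J"
      using bspec[OF xs(1) *(1)] bspec[OF xs(2) *(2)] by (intro dfuns.mult) auto
    ultimately show ?thesis by (simp add: *)
  qed
  then have "\<forall>c\<in>set (mult_terms xs ys). Poly_Mapping.keys (fst c) \<subseteq> {..<Suc k} \<and> snd c \<in> dfuns \<delta> K J" ..
  then show ?case
    by (intro exI[of _ "mult_terms xs ys"] conjI) (use eq in \<open>auto simp: peval_mult expansion_mult\<close>)
qed

text \<open>Homogeneity of \<open>f\<close> is tested at \<open>t * c\<close> for the infinitely many constants \<open>t = 1, 2, \<dots>\<close>. Both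
  sides are polynomials in \<open>t\<close>; comparing the coefficients of \<open>t\<^sup>e\<close> shows that the terms of degree
  \<open>e\<close> alone already represent \<open>f\<close>.\<close>

lemma homogeneous_expansion:
  fixes \<delta> :: "'u::field_char_0 \<Rightarrow> 'u"
  assumes K: "differential_subfield \<delta> K" and d: "derivation \<delta>" and v: "\<And>i. i \<le> k \<Longrightarrow> v i \<in> K"
    and f: "f \<in> dfuns \<delta> K ({..1} <+> J)"
    and hom: "\<And>l x y. l \<noteq> 0 \<Longrightarrow> f (case_sum (\<lambda>i. l * x i) y) = l ^ e * f (case_sum x y)"
  shows "\<exists>xs. (\<forall>a\<in>set xs. fst a \<in> monomials (Suc k) e \<and> snd a \<in> dfuns \<delta> K J) \<and>
    (\<forall>y c. (\<forall>i. \<delta> (c i) = 0) \<longrightarrow> f (case_sum (lin_point k v c) y) = peval (expansion xs y) c)"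
proof -
  obtain xs where xs: "\<forall>a\<in>set xs. Poly_Mapping.keys (fst a) \<subseteq> {..<Suc k} \<and> snd a \<in> dfuns \<delta> K J"
    and eq: "\<forall>y c. (\<forall>i. \<delta> (c i) = 0) \<longrightarrow> f (case_sum (lin_point k v c) y) = peval (expansion xs y) c"
  proof -
    have "\<exists>xs. (\<forall>a\<in>set xs. Poly_Mapping.keys (fst a) \<subseteq> {..<Suc k} \<and> snd a \<in> dfuns \<delta> K J) \<and>
      (\<forall>y c. (\<forall>i. \<delta> (c i) = 0) \<longrightarrow> f (case_sum (lin_point k v c) y) = peval (expansion xs y) c)"
      by (rule dfuns_expansion[OF K d v f])
    then show ?thesis by (elim exE conjE) (rule that)
  qed
  define mdeg where "mdeg m = (\<Sum>i<Suc k. Poly_Mapping.lookup m i)" for m :: "nat \<Rightarrow>\<^sub>0 nat"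
  let ?ys = "filter (\<lambda>a. mdeg (fst a) = e) xs"
  have "f (case_sum (lin_point k v c) y) = peval (expansion ?ys y) c" if c: "\<forall>i. \<delta> (c i) = 0" for y c
  proof -
    define A where "A = f (case_sum (lin_point k v c) y)"
    define p where "p zs = (\<Sum>a\<leftarrow>zs. monom (snd a y * mval (fst a) c) (mdeg (fst a)))"
      for zs :: "((nat \<Rightarrow>\<^sub>0 nat) \<times> ((_ \<Rightarrow> 'u) \<Rightarrow> 'u)) list"
    have poly_p: "poly (p zs) t = peval (expansion zs y) (\<lambda>i. t * c i)" if "set zs \<subseteq> set xs" for zs t
      using that
    proof (induction zs)
      case (Cons a zs)
      then have "Poly_Mapping.keys (fst a) \<subseteq> {..<Suc k}" using xs by auto
      then have "mval (fst a) (\<lambda>i. t * c i) = mval (fst a) c * t ^ mdeg (fst a)"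
        by (subst (1 2) mval_superset[of "{..<Suc k}"])
           (simp_all add: power_mult_distrib prod.distrib power_sum mdeg_def mult.commute del: sum.lessThan_Suc prod.lessThan_Suc)
      then show ?case using Cons by (simp add: p_def peval_add poly_monom mult.assoc)
    qed (simp add: p_def)
    have coeff_p: "coeff (p zs) e = peval (expansion (filter (\<lambda>a. mdeg (fst a) = e) zs) y) c" for zs
      by (induction zs) (auto simp: p_def peval_add)
    have "poly (p xs - monom A e) (of_nat (Suc t)) = 0" for t
    proof -
      let ?t = "of_nat (Suc t) :: 'u"
      have t: "?t \<noteq> 0" "\<delta> ?t = 0" using derivation_of_nat[OF d, of "Suc t"] by (simp_all del: of_nat_Suc)
      then have "\<forall>i. \<delta> (?t * c i) = 0" using c by (simp add: derivation_mult[OF d])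
      with eq have "poly (p xs) ?t = f (case_sum (lin_point k v (\<lambda>i. ?t * c i)) y)"
        using poly_p[of xs ?t] by simp
      also have "lin_point k v (\<lambda>i. ?t * c i) = (\<lambda>i. ?t * lin_point k v c i)"
        by (auto simp: lin_point_def fun_eq_iff sum_distrib_left mult.assoc simp del: of_nat_Suc)
      also have "f (case_sum \<dots> y) = ?t ^ e * A" unfolding A_def by (rule hom[OF t(1)])
      finally show ?thesis by (simp add: poly_monom mult.commute del: of_nat_Suc)
    qed
    then have "range (\<lambda>t. of_nat (Suc t)) \<subseteq> {x. poly (p xs - monom A e) x = 0}" by auto
    moreover have "infinite (range (\<lambda>t. of_nat (Suc t) :: 'u))"
      by (rule range_inj_infinite, rule injI) (simp del: of_nat_Suc)
    ultimately have "p xs - monom A e = 0" 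
      using poly_roots_finite[of "p xs - monom A e"] finite_subset by auto
    then have "p xs = monom A e" by simp
    then have "A = coeff (p xs) e" by simp
    then show ?thesis using coeff_p[of xs] by (simp add: A_def)
  qed
  then have "\<forall>y c. (\<forall>i. \<delta> (c i) = 0) \<longrightarrow> f (case_sum (lin_point k v c) y) = peval (expansion ?ys y) c" by simp
  moreover have "\<forall>a\<in>set ?ys. fst a \<in> monomials (Suc k) e \<and> snd a \<in> dfuns \<delta> K J"
    using xs by (auto simp: monomials_def mdeg_def simp del: sum.lessThan_Suc)
  ultimately show ?thesis by (intro exI[of _ ?ys] conjI)
qed

lemma keys_expansion: "(\<And>a. a \<in> set xs \<Longrightarrow> fst a \<in> S) \<Longrightarrow> Poly_Mapping.keys (expansion xs y) \<subseteq> S"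
proof (induction xs)
  case (Cons a xs)
  then have "Poly_Mapping.keys (Poly_Mapping.single (fst a) (snd a y)) \<union> Poly_Mapping.keys (expansion xs y) \<subseteq> S"
    by auto
  then show ?case using keys_add[of "Poly_Mapping.single (fst a) (snd a y)" "expansion xs y"]
    by (simp only: expansion_simps)
qed simp

lemma cderiv_expansion:
  assumes d: "derivation \<delta>"
  shows "(cderiv \<delta> ^^ l) (expansion xs y) = expansion (map (\<lambda>a. (fst a, \<lambda>y. (\<delta> ^^ l) (snd a y))) xs) y"
proof (induction l)
  case (Suc l)
  have "cderiv \<delta> (expansion zs y) = expansion (map (\<lambda>a. (fst a, \<lambda>y. \<delta> (snd a y))) zs) y" for zs
    by (induction zs) (simp_all add: cderiv_0[OF d] cderiv_add[OF d] cderiv_single[OF d])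
  then show ?case using Suc by (simp add: o_def)
qed (simp add: expansion_def o_def)

lemma dfuns_lookup_expansion:
  assumes K: "differential_subfield \<delta> K"
  shows "(\<And>a. a \<in> set xs \<Longrightarrow> snd a \<in> dfuns \<delta> K J) \<Longrightarrow> (\<lambda>y. Poly_Mapping.lookup (expansion xs y) \<beta>) \<in> dfuns \<delta> K J"
proof (induction xs)
  case Nil
  then show ?case by (auto intro: dfuns.const differential_subfieldD[OF K])
next
  case (Cons a xs)
  have "(\<lambda>y. snd a y) \<in> dfuns \<delta> K J" using Cons.prems[of a] by simp
  moreover have "(\<lambda>y. 0) \<in> dfuns \<delta> K J" by (intro dfuns.const differential_subfieldD[OF K])
  ultimately have "(\<lambda>y. Poly_Mapping.lookup (Poly_Mapping.single (fst a) (snd a y)) \<beta>) \<in> dfuns \<delta> K J"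
    by (cases "fst a = \<beta>") (simp_all add: lookup_single when_def)
  moreover have "(\<lambda>y. Poly_Mapping.lookup (expansion xs y) \<beta>) \<in> dfuns \<delta> K J"
    using Cons by simp
  ultimately show ?case by (simp add: lookup_add dfuns.add)
qed

lemma dfuns_macaulay:
  assumes K: "differential_subfield \<delta> K" and d: "derivation \<delta>"
    and r: "r \<in> macaulay_rows n deg G N"
    and X: "\<And>g a. g \<in> G \<Longrightarrow> a \<in> set (X g) \<Longrightarrow> snd a \<in> dfuns \<delta> K J"
  shows "(\<lambda>y. macaulay \<delta> (\<lambda>g. expansion (X g) y) r \<beta>) \<in> dfuns \<delta> K J"
proof -
  obtain g l m where r_eq: "r = (g, l, m)" "g \<in> G" using r by (auto simp: macaulay_rows_def)
  let ?zs = "mult_terms [(m, \<lambda>y. 1)] (map (\<lambda>a. (fst a, \<lambda>y. (\<delta> ^^ l) (snd a y))) (X g))"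
  have "Poly_Mapping.single m 1 * (cderiv \<delta> ^^ l) (expansion (X g) y) = expansion ?zs y" for y
    by (simp add: expansion_mult cderiv_expansion[OF d])
  then have "(\<lambda>y. macaulay \<delta> (\<lambda>g. expansion (X g) y) r \<beta>) = (\<lambda>y. Poly_Mapping.lookup (expansion ?zs y) \<beta>)"
    by (simp add: macaulay_def r_eq(1))
  moreover have "snd a \<in> dfuns \<delta> K J" if "a \<in> set ?zs" for a
  proof -
    have "a \<in> (\<lambda>b. (m + fst b, \<lambda>y. (\<delta> ^^ l) (snd b y))) ` set (X g)"
      using that by (simp add: set_mult_terms image_image)
    then obtain b where "b \<in> set (X g)" "a = (m + fst b, \<lambda>y. (\<delta> ^^ l) (snd b y))" by (elim imageE)
    then show ?thesis using X[OF r_eq(2)] by (simp add: dfuns_deriv_funpow[OF K d])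
  qed
  then have "(\<lambda>y. Poly_Mapping.lookup (expansion ?zs y) \<beta>) \<in> dfuns \<delta> K J"
    by (rule dfuns_lookup_expansion[OF K])
  ultimately show ?thesis by simp
qed

section \<open>Points of projective space\<close>

lemma proj_spaceE:
  assumes "p \<in> proj_space n"
  obtains x where "x \<in> hcoords n" "p = proportional n `` {x}"
  using assms unfolding proj_space_def by (rule quotientE)

lemma class_in_proj_space: "x \<in> hcoords n \<Longrightarrow> proportional n `` {x} \<in> proj_space n"
  unfolding proj_space_def by (rule quotientI)

lemma mem_class_iff:
  "x \<in> hcoords n \<Longrightarrow> y \<in> proportional n `` {x} \<longleftrightarrow> (\<exists>l. l \<noteq> 0 \<and> y = (\<lambda>i. l * x i))"
  by (auto simp: proportional_def hcoords_def)

lemma proj_space_hcoords: "p \<in> proj_space n \<Longrightarrow> x \<in> p \<Longrightarrow> x \<in> hcoords n"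
  by (elim proj_spaceE) (auto simp: proportional_def)

lemma proj_space_class_eq:
  assumes p: "p \<in> proj_space n" and x: "x \<in> p"
  shows "p = proportional n `` {x}"
proof -
  obtain z where z: "z \<in> hcoords n" "p = proportional n `` {z}" using p by (rule proj_spaceE)
  have "\<exists>l. l \<noteq> 0 \<and> x = (\<lambda>i. l * z i)" using x unfolding z(2) mem_class_iff[OF z(1)] .
  then obtain l where l: "l \<noteq> 0" "x = (\<lambda>i. l * z i)" by auto
  have xh: "x \<in> hcoords n" by (rule proj_space_hcoords[OF p x])
  have "y \<in> proportional n `` {z} \<longleftrightarrow> y \<in> proportional n `` {x}" for y
    unfolding mem_class_iff[OF z(1)] mem_class_iff[OF xh]
  proof
    assume "\<exists>m. m \<noteq> 0 \<and> y = (\<lambda>i. m * z i)"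
    then obtain m where "m \<noteq> 0" "y = (\<lambda>i. m * z i)" by auto
    then show "\<exists>m. m \<noteq> 0 \<and> y = (\<lambda>i. m * x i)" using l by (intro exI[of _ "m / l"]) auto
  next
    assume "\<exists>m. m \<noteq> 0 \<and> y = (\<lambda>i. m * x i)"
    then obtain m where "m \<noteq> 0" "y = (\<lambda>i. m * x i)" by auto
    then show "\<exists>m. m \<noteq> 0 \<and> y = (\<lambda>i. m * z i)" using l by (intro exI[of _ "m * l"]) (auto simp: mult.assoc)
  qed
  then show ?thesis unfolding z(2) by auto
qed

lemma proj_space_mem_iff:
  "p \<in> proj_space n \<Longrightarrow> x \<in> p \<Longrightarrow> y \<in> p \<longleftrightarrow> (\<exists>l. l \<noteq> 0 \<and> y = (\<lambda>i. l * x i))"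
  using proj_space_class_eq[of p n x] mem_class_iff[OF proj_space_hcoords[of p n x]] by simp

lemma self_mem_class: "x \<in> hcoords n \<Longrightarrow> x \<in> proportional n `` {x}"
  by (subst mem_class_iff) (auto intro!: exI[of _ 1])

section \<open>The projective closure\<close>

lemma proj_embed_subset: "proj_embed x \<in> proj_space 1" "y \<in> proj_embed x \<longleftrightarrow> (\<exists>l. l \<noteq> 0 \<and> y = (\<lambda>_. 0)(0 := l * x, 1 := l))"
proof -
  have h: "(\<lambda>_. 0)(0 := x, 1 := 1) \<in> hcoords 1" by (auto simp: hcoords_def)
  then show "proj_embed x \<in> proj_space 1" unfolding proj_embed_def by (rule class_in_proj_space)
  have *: "(\<lambda>i. l * ((\<lambda>_. 0)(0 := x, 1 := 1)) i) = (\<lambda>_. 0)(0 := l * x, 1 := l)" for l by auto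
  show "y \<in> proj_embed x \<longleftrightarrow> (\<exists>l. l \<noteq> 0 \<and> y = (\<lambda>_. 0)(0 := l * x, 1 := l))"
    unfolding proj_embed_def mem_class_iff[OF h] * by (rule refl)
qed

text \<open>The closure is defined by all homogeneous differential polynomials that vanish on \<open>X\<close>.\<close>

lemma proj_variety_closure: "proj_variety K \<delta> 1 (proj_closure K \<delta> X)"
proof -
  define G where "G = {g \<in> dpolys K {..1}. dhomogeneous K \<delta> g \<and> (\<forall>x\<in>X. \<forall>y\<in>proj_embed x. deval \<delta> g y = 0)}"
  define V where "V = {p \<in> proj_space 1. \<forall>g\<in>G. \<forall>x\<in>p. deval \<delta> g x = 0}"
  have V: "proj_variety K \<delta> 1 V"
    unfolding proj_variety_def by (intro exI[of _ G]) (auto simp: G_def V_def)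
  moreover have "proj_embed ` X \<subseteq> V" using proj_embed_subset(1) by (auto simp: G_def V_def)
  moreover have "V \<subseteq> V'" if V': "proj_variety K \<delta> 1 V'" "proj_embed ` X \<subseteq> V'" for V'
  proof -
    obtain G' where G': "G' \<subseteq> {g \<in> dpolys K {..1}. dhomogeneous K \<delta> g}"
      "V' = {p \<in> proj_space 1. \<forall>g\<in>G'. \<forall>x\<in>p. deval \<delta> g x = 0}"
      using V'(1) unfolding proj_variety_def by auto
    have "G' \<subseteq> G" using G' V'(2) unfolding G_def by fastforce
    then show ?thesis unfolding V_def G'(2) by auto
  qed
  ultimately have "proj_closure K \<delta> X = V" unfolding proj_closure_def by auto
  then show ?thesis using V by simp
qed

text \<open>For \<open>k = 0\<close> the closure is a single point, and the form \<open>y 0 - b * y 1\<close> excludes the point at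
  infinity. For \<open>k > 0\<close> the chart form of the equation, which admits that point, is used.\<close>

lemma homogenised_linear_ode:
  fixes \<delta> :: "'u::field_char_0 \<Rightarrow> 'u"
  assumes K: "differential_subfield \<delta> K" and d: "derivation \<delta>"
    and a: "\<forall>i<k. a i \<in> K" and b: "b \<in> K"
  obtains g where "g \<in> dpolys K {..1}" "dhomogeneous K \<delta> g"
    "\<And>y. y 1 \<noteq> 0 \<Longrightarrow> deval \<delta> g y = 0 \<longleftrightarrow> y 0 / y 1 \<in> linear_ode_solutions \<delta> k a b"
    "\<And>y. k = 0 \<Longrightarrow> y 1 = 0 \<Longrightarrow> deval \<delta> g y = 0 \<Longrightarrow> y 0 = 0"
proof (cases "k = 0")
  case True
  have "(\<lambda>y. y 0 - b * y 1) \<in> dfuns \<delta> K {..1::nat}"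
    by (intro dfuns_diff[OF K] dfuns.mult dfuns.const dfuns_var[OF K] b) auto
  then obtain g :: "('u, nat) dpoly" where "(\<lambda>y. y 0 - b * y 1) = deval \<delta> g" and g1: "g \<in> dpolys K {..1}"
    unfolding dfuns_eq[OF K] by (rule imageE)
  then have g: "g \<in> dpolys K {..1}" "\<And>y. deval \<delta> g y = y 0 - b * y 1" by (simp_all add: fun_eq_iff)
  have "dhomogeneous K \<delta> g" unfolding dhomogeneous_def g(2)
    by (intro exI[of _ 1]) (auto simp: algebra_simps)
  moreover have "deval \<delta> g y = 0 \<longleftrightarrow> y 0 / y 1 \<in> linear_ode_solutions \<delta> k a b" if "y 1 \<noteq> 0" for y
    using that True by (auto simp: g(2) linear_ode_solutions_def field_simps)
  ultimately show ?thesis using g True by (intro that[of g]) auto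
next
  case False
  let ?f = "\<lambda>x. (\<delta> ^^ k) (x 0) - ((\<Sum>i<k. a i * (\<delta> ^^ i) (x 0)) + b)"
  have "?f \<in> dfuns \<delta> K {..1::nat}"
    using a b by (intro dfuns_diff[OF K] dfuns.add dfuns_sum[OF K] dfuns.mult dfuns.const dfuns.var) auto
  from homogenisation[OF K d _ this, of 1] obtain g where g: "g \<in> dpolys K {..1}" "dhomogeneous K \<delta> g"
    "\<And>y. deval \<delta> g y = 0 \<longleftrightarrow> y 1 = 0 \<or> ?f (\<lambda>j. y j / y 1) = 0" by auto
  moreover have "deval \<delta> g y = 0 \<longleftrightarrow> y 0 / y 1 \<in> linear_ode_solutions \<delta> k a b" if "y 1 \<noteq> 0" for y
    using that by (simp add: g(3) linear_ode_solutions_def)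
  ultimately show ?thesis using False by (intro that[of g]) auto
qed

lemma lin_point_hcoords:
  assumes indep: "\<And>c. \<forall>i. \<delta> (c i) = 0 \<Longrightarrow> (\<Sum>i<k. c i * v i) = 0 \<Longrightarrow> (\<forall>i<k. c i = 0)"
    and c: "\<forall>i. \<delta> (c i) = 0" "i < Suc k" "c i \<noteq> 0"
  shows "lin_point k v c \<in> hcoords 1"
proof (cases "c k = 0")
  case True
  then have "(\<Sum>i\<le>k. c i * v i) = (\<Sum>i<k. c i * v i)" by (simp add: lessThan_Suc_atMost[symmetric])
  moreover have "i < k" using True c by (auto simp: less_Suc_eq)
  then have "(\<Sum>i<k. c i * v i) \<noteq> 0" using indep[OF c(1)] c(3) by auto
  ultimately show ?thesis by (auto simp: lin_point_def hcoords_def intro!: exI[of _ 0])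
next
  case False
  then show ?thesis by (auto simp: lin_point_def hcoords_def intro!: exI[of _ 1])
qed

text \<open>A point of the closure satisfies the homogenised equation, hence is a solution or, if \<open>k > 0\<close>,
  possibly the point at infinity, which is parametrised by \<open>c = (1, 0, \<dots>, 0)\<close>.\<close>

lemma closure_points:
  fixes \<delta> :: "'u::field_char_0 \<Rightarrow> 'u"
  assumes K: "differential_subfield \<delta> K" and d: "derivation \<delta>"
    and a: "\<forall>i<k. a i \<in> K" and b: "b \<in> K"
    and indep: "\<And>c. \<forall>i. \<delta> (c i) = 0 \<Longrightarrow> (\<Sum>i<k. c i * v i) = 0 \<Longrightarrow> (\<forall>i<k. c i = 0)"
    and param: "\<And>x. x \<in> linear_ode_solutions \<delta> k a b \<Longrightarrow>
      \<exists>c. (\<forall>i. \<delta> (c i) = 0) \<and> c k = 1 \<and> x = (\<Sum>i\<le>k. c i * v i)"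
    and p: "p \<in> proj_closure K \<delta> (linear_ode_solutions \<delta> k a b)"
  shows "\<exists>c. (\<forall>i. \<delta> (c i) = 0) \<and> (\<exists>i<Suc k. c i \<noteq> 0) \<and> lin_point k v c \<in> p"
proof -
  let ?X = "linear_ode_solutions \<delta> k a b"
  obtain g where g: "g \<in> dpolys K {..1}" "dhomogeneous K \<delta> g"
    and gX: "\<And>y. y 1 \<noteq> 0 \<Longrightarrow> deval \<delta> g y = 0 \<longleftrightarrow> y 0 / y 1 \<in> ?X"
    and g0: "\<And>y. k = 0 \<Longrightarrow> y 1 = 0 \<Longrightarrow> deval \<delta> g y = 0 \<Longrightarrow> y 0 = 0"
    by (rule homogenised_linear_ode[OF K d a b]) (rule that)
  define V where "V = {p \<in> proj_space 1. \<forall>g'\<in>{g}. \<forall>x\<in>p. deval \<delta> g' x = 0}"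
  have "proj_variety K \<delta> 1 V"
    unfolding proj_variety_def by (intro exI[of _ "{g}"]) (use g in \<open>auto simp: V_def\<close>)
  moreover have "proj_embed ` ?X \<subseteq> V"
  proof
    fix q assume "q \<in> proj_embed ` ?X"
    then obtain x where x: "x \<in> ?X" "q = proj_embed x" by auto
    have "deval \<delta> g y = 0" if y: "y \<in> q" for y
    proof -
      obtain l where l: "l \<noteq> 0" "y = (\<lambda>_. 0)(0 := l * x, 1 := l)"
        using y unfolding x(2) proj_embed_subset(2) by auto
      show ?thesis using x(1) l by (subst gX) auto
    qed
    then show "q \<in> V" using proj_embed_subset(1) x(2) by (auto simp: V_def)
  qed
  ultimately have "p \<in> V" using p unfolding proj_closure_def by auto
  then have pP: "p \<in> proj_space 1" and van: "\<And>x. x \<in> p \<Longrightarrow> deval \<delta> g x = 0" by (auto simp: V_def)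
  obtain y where y: "y \<in> hcoords 1" "p = proportional 1 `` {y}" using pP by (rule proj_spaceE)
  have yp: "y \<in> p" using self_mem_class[OF y(1)] y(2) by simp
  have y0: "y i = 0" if "i \<noteq> 0" "i \<noteq> 1" for i using y(1) that by (auto simp: hcoords_def)
  show ?thesis
  proof (cases "y 1 = 0")
    case False
    then have "y 0 / y 1 \<in> ?X" using gX[of y] van[OF yp] by simp
    from param[OF this] obtain c where c: "\<forall>i. \<delta> (c i) = 0" "c k = 1" "y 0 / y 1 = (\<Sum>i\<le>k. c i * v i)" by auto
    have "lin_point k v c = (\<lambda>i. inverse (y 1) * y i)"
      using False y0 by (auto simp: lin_point_def c(2) c(3)[symmetric] fun_eq_iff field_simps)
    then have "lin_point k v c \<in> p"
      unfolding proj_space_mem_iff[OF pP yp] using False by (intro exI[of _ "inverse (y 1)"]) auto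
    then show ?thesis using c by (intro exI[of _ c]) auto
  next
    case True
    then have y00: "y 0 \<noteq> 0" using y(1) by (auto simp: hcoords_def le_Suc_eq)
    then have k: "k \<noteq> 0" using g0[of y] True van[OF yp] by auto
    define c :: "nat \<Rightarrow> 'u" where "c = (\<lambda>_. 0)(0 := 1)"
    have c: "\<forall>i. \<delta> (c i) = 0" using derivation_0[OF d] derivation_1[OF d] by (auto simp: c_def)
    have sum: "(\<Sum>i\<in>A. c i * v i) = v 0" if "finite A" "0 \<in> A" for A
    proof -
      have "(\<Sum>i\<in>A. c i * v i) = (\<Sum>i\<in>{0}. c i * v i)"
        using that by (intro sum.mono_neutral_right) (auto simp: c_def)
      then show ?thesis by (simp add: c_def)
    qed
    have "v 0 \<noteq> 0"
    proof
      assume "v 0 = 0"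
      then have "(\<Sum>i<k. c i * v i) = 0" using sum[of "{..<k}"] k by simp
      then have "c 0 = 0" using indep[OF c] k by auto
      then show False by (simp add: c_def)
    qed
    moreover have "lin_point k v c = (\<lambda>i. (v 0 / y 0) * y i)"
      using y00 y0 True k sum[of "{..k}"] by (auto simp: lin_point_def fun_eq_iff c_def)
    ultimately have "lin_point k v c \<in> p"
      unfolding proj_space_mem_iff[OF pP yp] using y00 by (intro exI[of _ "v 0 / y 0"]) auto
    then show ?thesis using c by (intro exI[of _ c]) (auto simp: c_def)
  qed
qed

section \<open>Completeness\<close>

text \<open>Projective points are classes modulo all scalars of the big field, so membership in a closed set
  can only be tested on a single representative once homogeneity is known for all of these.\<close>

lemma bihomogeneous_extends:
  fixes \<delta> :: "'u::field_char_0 \<Rightarrow> 'u"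
  assumes F: "differentially_closed \<delta> F" and d: "derivation \<delta>"
    and U: "differential_subfield \<delta> (UNIV :: 'u set)"
    and g: "g \<in> dpolys F ({..n} <+> {..m})" and hom: "dbihomogeneous F \<delta> g"
  shows "\<exists>e e'. (\<forall>l x y. l \<noteq> 0 \<longrightarrow> deval \<delta> g (case_sum (\<lambda>i. l * x i) y) = l ^ e * deval \<delta> g (case_sum x y)) \<and>
    (\<forall>l x y. l \<noteq> 0 \<longrightarrow> deval \<delta> g (case_sum x (\<lambda>i. l * y i)) = l ^ e' * deval \<delta> g (case_sum x y))"
proof -
  have sub: "differential_subfield \<delta> F" using F by (simp add: differentially_closed_def)
  have df: "deval \<delta> g \<in> dfuns \<delta> F ({..n} <+> {..m})" by (rule deval_in_dfuns[OF sub g])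
  obtain e e' where
    e: "\<forall>l\<in>F - {0}. \<forall>x y. deval \<delta> g (case_sum (\<lambda>i. l * x i) y) = l ^ e * deval \<delta> g (case_sum x y)" and
    e': "\<forall>l\<in>F - {0}. \<forall>x y. deval \<delta> g (case_sum x (\<lambda>i. l * y i)) = l ^ e' * deval \<delta> g (case_sum x y)"
    using hom unfolding dbihomogeneous_def by (elim exE conjE) (rule that)
  have L: "(\<lambda>s. if isl s then l * case_sum x y s else case_sum x y s) = case_sum (\<lambda>i. l * x i) y"
    for l and x y :: "nat \<Rightarrow> 'u" by (auto simp: fun_eq_iff split: sum.split)
  have R: "(\<lambda>s. if \<not> isl s then l * case_sum x y s else case_sum x y s) = case_sum x (\<lambda>i. l * y i)"
    for l and x y :: "nat \<Rightarrow> 'u" by (auto simp: fun_eq_iff split: sum.split)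
  have "deval \<delta> g (case_sum (\<lambda>i. l * x i) y) = l ^ e * deval \<delta> g (case_sum x y)" if "l \<noteq> 0" for l x y
    using homogeneity_extends[OF F d U df, of isl "case_sum x y" e l] e that unfolding L by simp
  moreover have "deval \<delta> g (case_sum x (\<lambda>i. l * y i)) = l ^ e' * deval \<delta> g (case_sum x y)" if "l \<noteq> 0" for l x y
    using homogeneity_extends[OF F d U df, of "\<lambda>s. \<not> isl s" "case_sum x y" e' l] e' that unfolding R by simp
  ultimately show ?thesis by auto
qed


text \<open>A point \<open>y\<close> is in the image iff some constant \<open>c \<noteq> 0\<close> makes all equations vanish at
  \<open>(lin_point k v c, y)\<close>. This condition is invariant under scaling \<open>y\<close>. By elimination it says that
  the minors vanish at \<open>y\<close>, equivalently at \<open>y / y i\<close> for every \<open>i\<close> with \<open>y i \<noteq> 0\<close>; the homogeneous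
  chart forms of the minors express the latter.\<close>

lemma image_is_variety:
  fixes \<delta> :: "'u::field_char_0 \<Rightarrow> 'u"
  assumes d: "derivation \<delta>" and U: "differentially_closed \<delta> (UNIV :: 'u set)"
    and F: "differentially_closed \<delta> F" and unc: "uncountable {a. \<delta> a = 0}"
    and v: "\<And>i. i \<le> k \<Longrightarrow> v i \<in> F"
    and indep: "\<And>c. \<forall>i. \<delta> (c i) = 0 \<Longrightarrow> (\<Sum>i<k. c i * v i) = 0 \<Longrightarrow> (\<forall>i<k. c i = 0)"
    and V: "\<And>p. p \<in> V \<Longrightarrow> \<exists>c. (\<forall>i. \<delta> (c i) = 0) \<and> (\<exists>i<Suc k. c i \<noteq> 0) \<and> lin_point k v c \<in> p"
    and Z: "biproj_closed F \<delta> 1 m Z" "Z \<subseteq> V \<times> W"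
  shows "proj_variety F \<delta> m (snd ` Z)"
proof -
  have sub: "differential_subfield \<delta> F" and subU: "differential_subfield \<delta> (UNIV :: 'u set)"
    using F U by (simp_all add: differentially_closed_def)
  obtain G where G: "G \<subseteq> {g \<in> dpolys F ({..1} <+> {..m}). dbihomogeneous F \<delta> g}"
    and Z_eq: "Z = {(p, q) \<in> proj_space 1 \<times> proj_space m. \<forall>g\<in>G. \<forall>x\<in>p. \<forall>y\<in>q. deval \<delta> g (case_sum x y) = 0}"
    using Z(1) unfolding biproj_closed_def by (elim exE conjE) (rule that)
  have Gg: "g \<in> dpolys F ({..1} <+> {..m})" "dbihomogeneous F \<delta> g" if "g \<in> G" for g using that G by auto
  have "\<forall>g\<in>G. \<exists>e. (\<forall>l x y. l \<noteq> 0 \<longrightarrow> deval \<delta> g (case_sum (\<lambda>i. l * x i) y) = l ^ e * deval \<delta> g (case_sum x y)) \<and>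
      (\<exists>e'. \<forall>l x y. l \<noteq> 0 \<longrightarrow> deval \<delta> g (case_sum x (\<lambda>i. l * y i)) = l ^ e' * deval \<delta> g (case_sum x y))"
    using bihomogeneous_extends[OF F d subU Gg] by auto
  then obtain e where "\<forall>g\<in>G. (\<forall>l x y. l \<noteq> 0 \<longrightarrow>
        deval \<delta> g (case_sum (\<lambda>i. l * x i) y) = l ^ e g * deval \<delta> g (case_sum x y)) \<and>
      (\<exists>e'. \<forall>l x y. l \<noteq> 0 \<longrightarrow> deval \<delta> g (case_sum x (\<lambda>i. l * y i)) = l ^ e' * deval \<delta> g (case_sum x y))"
    unfolding bchoice_iff ..
  then have e: "\<And>g l x y. g \<in> G \<Longrightarrow> l \<noteq> 0 \<Longrightarrow>
      deval \<delta> g (case_sum (\<lambda>i. l * x i) y) = l ^ e g * deval \<delta> g (case_sum x y)"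
    and e': "\<And>g. g \<in> G \<Longrightarrow> \<exists>e'. \<forall>l x y. l \<noteq> 0 \<longrightarrow>
      deval \<delta> g (case_sum x (\<lambda>i. l * y i)) = l ^ e' * deval \<delta> g (case_sum x y)"
    by simp_all
  have "\<forall>g\<in>G. \<exists>xs. (\<forall>a\<in>set xs. fst a \<in> monomials (Suc k) (e g) \<and> snd a \<in> dfuns \<delta> F {..m}) \<and>
      (\<forall>y c. (\<forall>i. \<delta> (c i) = 0) \<longrightarrow> deval \<delta> g (case_sum (lin_point k v c) y) = peval (expansion xs y) c)"
    by (intro ballI homogeneous_expansion[OF sub d v deval_in_dfuns[OF sub Gg(1)]] e)
  then obtain X where "\<forall>g\<in>G. (\<forall>a\<in>set (X g). fst a \<in> monomials (Suc k) (e g) \<and> snd a \<in> dfuns \<delta> F {..m}) \<and>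
      (\<forall>y c. (\<forall>i. \<delta> (c i) = 0) \<longrightarrow> deval \<delta> g (case_sum (lin_point k v c) y) = peval (expansion (X g) y) c)"
    unfolding bchoice_iff ..
  then have X: "\<And>g a. g \<in> G \<Longrightarrow> a \<in> set (X g) \<Longrightarrow> fst a \<in> monomials (Suc k) (e g)"
      "\<And>g a. g \<in> G \<Longrightarrow> a \<in> set (X g) \<Longrightarrow> snd a \<in> dfuns \<delta> F {..m}"
    and X_eq: "\<And>g y c. g \<in> G \<Longrightarrow> \<forall>i. \<delta> (c i) = 0 \<Longrightarrow>
      deval \<delta> g (case_sum (lin_point k v c) y) = peval (expansion (X g) y) c"
    by simp_all
  define fibre where "fibre y \<longleftrightarrow> (\<exists>c. (\<forall>i. \<delta> (c i) = 0) \<and> (\<exists>i<Suc k. c i \<noteq> 0) \<and>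
      (\<forall>g\<in>G. deval \<delta> g (case_sum (lin_point k v c) y) = 0))" for y
  define minor where "minor N \<rho> y = set_det (monomials (Suc k) N)
      (\<lambda>\<alpha>. macaulay \<delta> (\<lambda>g. expansion (X g) y) (\<rho> \<alpha>))" for N \<rho> y
  define valid where "valid N \<rho> \<longleftrightarrow> \<rho> ` monomials (Suc k) N \<subseteq> macaulay_rows (Suc k) e G N" for N \<rho>
  have fibre_iff: "fibre y \<longleftrightarrow> (\<forall>N \<rho>. valid N \<rho> \<longrightarrow> minor N \<rho> y = 0)" for y
  proof -
    have "fibre y \<longleftrightarrow> (\<exists>c. (\<forall>i. \<delta> (c i) = 0) \<and> (\<exists>i<Suc k. c i \<noteq> 0) \<and> (\<forall>g\<in>G. peval (expansion (X g) y) c = 0))"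
      unfolding fibre_def using X_eq by (intro ex_cong1) auto
    also have "\<dots> \<longleftrightarrow> (\<forall>N \<rho>. valid N \<rho> \<longrightarrow> minor N \<rho> y = 0)"
      unfolding valid_def minor_def
    proof (rule elimination[OF d U unc])
      fix g assume "g \<in> G"
      then show "Poly_Mapping.keys (expansion (X g) y) \<subseteq> monomials (Suc k) (e g)"
        by (intro keys_expansion X(1))
    qed simp
    finally show ?thesis .
  qed
  have minor_dfuns: "minor N \<rho> \<in> dfuns \<delta> F {..m}" if "valid N \<rho>" for N \<rho>
    unfolding minor_def
  proof (intro dfuns_set_det[OF sub finite_monomials] dfuns_macaulay[OF sub d] X(2))
    fix \<alpha> assume "\<alpha> \<in> monomials (Suc k) N"
    then show "\<rho> \<alpha> \<in> macaulay_rows (Suc k) e G N" using that by (auto simp: valid_def)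
  qed
  have fwd: "q \<in> proj_space m \<and> (\<forall>y\<in>q. fibre y)" if q: "q \<in> snd ` Z" for q
  proof -
    obtain p where p: "(p, q) \<in> Z" using q by auto
    then obtain c where "\<forall>i. \<delta> (c i) = 0" "\<exists>i<Suc k. c i \<noteq> 0" "lin_point k v c \<in> p"
      using Z(2) V[of p] by auto
    then show ?thesis using p unfolding Z_eq fibre_def by (auto intro!: exI[of _ c])
  qed
  have bwd: "q \<in> snd ` Z" if q: "q \<in> proj_space m" "y \<in> q" "fibre y" for q y
  proof -
    obtain c i where c: "\<forall>i. \<delta> (c i) = 0" "i < Suc k" "c i \<noteq> 0"
      "\<And>g. g \<in> G \<Longrightarrow> deval \<delta> g (case_sum (lin_point k v c) y) = 0"
      using q(3) unfolding fibre_def by auto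
    have h: "lin_point k v c \<in> hcoords 1" by (rule lin_point_hcoords[OF indep c(1-3)])
    let ?p = "proportional 1 `` {lin_point k v c}"
    have "deval \<delta> g (case_sum x' y') = 0" if g: "g \<in> G" and x': "x' \<in> ?p" and y': "y' \<in> q" for g x' y'
    proof -
      obtain l where l: "l \<noteq> 0" "x' = (\<lambda>i. l * lin_point k v c i)"
        using x' unfolding mem_class_iff[OF h] by auto
      obtain l' where l': "l' \<noteq> 0" "y' = (\<lambda>i. l' * y i)"
        using y' unfolding proj_space_mem_iff[OF q(1,2)] by auto
      obtain e1 where "deval \<delta> g (case_sum x' y') = l' ^ e1 * deval \<delta> g (case_sum x' y)"
        using e'[OF g] l' by auto
      also have "deval \<delta> g (case_sum x' y) = 0"
        unfolding l(2) using e[OF g l(1)] c(4)[OF g] by simp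
      finally show ?thesis by simp
    qed
    then have "(?p, q) \<in> Z" unfolding Z_eq using class_in_proj_space[OF h] q(1) by simp
    then show ?thesis by force
  qed
  define H where "H = {h \<in> dpolys F {..m}. dhomogeneous F \<delta> h \<and>
    (\<exists>N \<rho>. valid N \<rho> \<and> (\<exists>i\<le>m. \<forall>y. deval \<delta> h y = 0 \<longleftrightarrow> y i = 0 \<or> minor N \<rho> (\<lambda>j. y j / y i) = 0))}"
  have scale: "(\<lambda>j. y j / y i) \<in> q" if "q \<in> proj_space m" "y \<in> q" "y i \<noteq> 0" for q y i
    unfolding proj_space_mem_iff[OF that(1,2)] using that(3)
    by (intro exI[of _ "inverse (y i)"]) (auto simp: field_simps)
  have "snd ` Z = {q \<in> proj_space m. \<forall>h\<in>H. \<forall>y\<in>q. deval \<delta> h y = 0}"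
  proof (rule equalityI; rule subsetI)
    fix q assume "q \<in> snd ` Z"
    then have q: "q \<in> proj_space m" and fib: "\<And>y. y \<in> q \<Longrightarrow> fibre y" using fwd by auto
    have "deval \<delta> h y = 0" if h: "h \<in> H" and y: "y \<in> q" for h y
    proof -
      obtain N \<rho> i where h_eq: "valid N \<rho>"
        "deval \<delta> h y = 0 \<longleftrightarrow> y i = 0 \<or> minor N \<rho> (\<lambda>j. y j / y i) = 0"
        using h unfolding H_def by auto
      show ?thesis
      proof (cases "y i = 0")
        case False
        then have "fibre (\<lambda>j. y j / y i)" by (intro fib scale q y)
        then show ?thesis using h_eq fibre_iff by simp
      qed (simp add: h_eq)
    qed
    then show "q \<in> {q \<in> proj_space m. \<forall>h\<in>H. \<forall>y\<in>q. deval \<delta> h y = 0}" using q by simp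
  next
    fix q assume "q \<in> {q \<in> proj_space m. \<forall>h\<in>H. \<forall>y\<in>q. deval \<delta> h y = 0}"
    then have q: "q \<in> proj_space m" and van: "\<And>h y. h \<in> H \<Longrightarrow> y \<in> q \<Longrightarrow> deval \<delta> h y = 0" by auto
    obtain y where y: "y \<in> hcoords m" "q = proportional m `` {y}" using q by (rule proj_spaceE)
    have yq: "y \<in> q" using self_mem_class[OF y(1)] y(2) by simp
    obtain i where i: "i \<le> m" "y i \<noteq> 0" using y(1) by (auto simp: hcoords_def)
    have "minor N \<rho> (\<lambda>j. y j / y i) = 0" if valid: "valid N \<rho>" for N \<rho>
    proof -
      obtain h where h: "h \<in> dpolys F {..m}" "dhomogeneous F \<delta> h"
        "\<forall>y. deval \<delta> h y = 0 \<longleftrightarrow> y i = 0 \<or> minor N \<rho> (\<lambda>j. y j / y i) = 0"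
        using homogenisation[OF sub d _ minor_dfuns[OF valid], of i] i(1) by auto
      have "h \<in> H" unfolding H_def
        by (intro CollectI conjI h exI[of _ N] exI[of _ \<rho>] exI[of _ i] valid i(1))
      then show ?thesis using van[OF _ yq] h(3) i(2) by auto
    qed
    then have "fibre (\<lambda>j. y j / y i)" by (simp add: fibre_iff)
    then show "q \<in> snd ` Z" by (rule bwd[OF q scale[OF q yq i(2)]])
  qed
  moreover have "H \<subseteq> {h \<in> dpolys F {..m}. dhomogeneous F \<delta> h}" by (auto simp: H_def)
  ultimately show ?thesis unfolding proj_variety_def by (intro exI[of _ H] conjI)
qed

theorem theorem4p1:
  fixes \<delta> :: "'u::field_char_0 \<Rightarrow> 'u"
    and F :: "'u set"
    and k :: nat and a :: "nat \<Rightarrow> 'u" and b :: 'u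
  assumes "derivation \<delta>"
    and "differentially_closed \<delta> (UNIV :: 'u set)"
    and "saturated \<delta>"
    and "differentially_closed \<delta> F"
    and "( |F| ) <o ( |UNIV :: 'u set| )"
    and "\<forall>i<k. a i \<in> F" and "b \<in> F"
  shows "delta_complete F \<delta> 1 (proj_closure F \<delta> (linear_ode_solutions \<delta> k a b))"
proof -
  note d = assms(1) and U = assms(2) and F = assms(4)
  have sub: "differential_subfield \<delta> F" using F by (simp add: differentially_closed_def)
  have "infinite F"
  proof
    assume "finite F"
    then have "finite (range (of_nat :: nat \<Rightarrow> 'u))"
      by (rule finite_subset[rotated]) (auto intro: differential_subfield_of_nat[OF sub])
    moreover have "inj (of_nat :: nat \<Rightarrow> 'u)" by (rule inj_onI) simp
    ultimately have "finite (UNIV :: nat set)" by (rule finite_imageD)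
    then show False by simp
  qed
  then have unc: "uncountable {c. \<delta> c = 0}" by (rule constants_uncountable[OF d assms(3) _ assms(5)])
  obtain v where v: "\<And>i. i \<le> k \<Longrightarrow> v i \<in> F"
    and indep: "\<And>c. \<forall>i. \<delta> (c i) = 0 \<Longrightarrow> (\<Sum>i<k. c i * v i) = 0 \<Longrightarrow> (\<forall>i<k. c i = 0)"
    and param: "\<And>x. x \<in> linear_ode_solutions \<delta> k a b \<Longrightarrow>
      \<exists>c. (\<forall>i. \<delta> (c i) = 0) \<and> c k = 1 \<and> x = (\<Sum>i\<le>k. c i * v i)"
    by (rule linear_ode_parametrisation[OF F d assms(6,7)]) (rule that)
  have points: "\<exists>c. (\<forall>i. \<delta> (c i) = 0) \<and> (\<exists>i<Suc k. c i \<noteq> 0) \<and> lin_point k v c \<in> p"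
    if "p \<in> proj_closure F \<delta> (linear_ode_solutions \<delta> k a b)" for p
    by (rule closure_points[OF sub d assms(6,7) _ _ that]) (fact indep, fact param)
  show ?thesis
    unfolding delta_complete_def
  proof (intro conjI allI impI proj_variety_closure, elim conjE)
    fix m W Z
    assume "biproj_closed F \<delta> 1 m Z" "Z \<subseteq> proj_closure F \<delta> (linear_ode_solutions \<delta> k a b) \<times> W"
    then show "proj_variety F \<delta> m (snd ` Z)"
      by (rule image_is_variety[OF d U F unc, rotated 3]) (fact v, fact indep, fact points)
  qed
qed

end
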